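(* Let $n\geq 2$, let $\{\lambda_{i,jk} : 1\leq i\leq k,\ 1\leq j<k\leq n\}\subseteq\mathbb{T}$, and let $\sigma$ be the two-cocycle of $G(n)$ $$\sigma(r,s)=\prod_{1\leq i<j<k\leq n}\lambda_{i,jk}^{s_{jk}r_i+s_kr_{ij}}\,\lambda_{j,ik}^{s_{ik}r_j+s_k(r_ir_j-r_{ij})}\cdot\prod_{1\leq j<k\leq n}\lambda_{j,jk}^{s_{jk}r_j+\frac{1}{2}s_kr_j(r_j-1)}\,\lambda_{k,jk}^{r_k(s_{jk}+r_js_k)+\frac{1}{2}r_js_k(s_k-1)}.$$ Set $\lambda_{k,ij}=\overline{\lambda_{i,jk}}\,\lambda_{j,ik}$ for $1\leq i<j<k\leq n$. Then $C^*(G(n),\sigma)$ is simple if and only if for each nontrivial central element $s=(0,\dotsc,0,s_{12},s_{13},\dotsc,s_{n-1,n})$ of $G(n)$ there is some $1\leq i\leq n$ such that $$\prod_{1\leq j<k\leq n}\lambda_{i,jk}^{s_{jk}}\neq 1.$$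
   Context: $G(n)$ is the free nilpotent group of class $2$ and rank $n$, realized as the set of integer tuples $r=(r_1,\dotsc,r_n,(r_{jk})_{1\leq j<k\leq n})$ with multiplication $(rs)_i=r_i+s_i$ and $(rs)_{jk}=r_{jk}+s_{jk}+r_js_k$. Its center consists of the elements with $r_1=\dots=r_n=0$. A two-cocycle of a discrete group $G$ is a function $\sigma\colon G\times G\to\mathbb{T}$ with $\sigma(r,s)\sigma(rs,t)=\sigma(r,st)\sigma(s,t)$ and $\sigma(r,e)=\sigma(e,r)=1$. $C^*(G,\sigma)$ denotes the full twisted group $C^*$-algebra: the universal $C^*$-algebra generated by unitaries $i_\sigma(r)$, $r\in G$, with $i_\sigma(r)i_\sigma(s)=\sigma(r,s)i_\sigma(rs)$. *)

theory Defs
  imports "HOL-Analysis.Abstract_Metric_Spaces" "HOL-Algebra.Ideal" "HOL-Algebra.Module"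
begin

section \<open>Unital \<open>C\<^sup>*\<close>-algebras\<close>

record 'a normed_star = "(complex, 'a) module" +
  star :: "'a \<Rightarrow> 'a" (\<open>\<star>\<index>_\<close> [91] 90)
  nrm :: "'a \<Rightarrow> real" (\<open>\<parallel>_\<parallel>\<index>\<close>)

locale star_algebra = ring A for A :: "('a, 'm) normed_star_scheme" (structure) +
  assumes smult_closed [simp, intro]: "x \<in> carrier A \<Longrightarrow> c \<odot> x \<in> carrier A"
    and smult_l_distr: "x \<in> carrier A \<Longrightarrow> (c + d) \<odot> x = c \<odot> x \<oplus> d \<odot> x"
    and smult_r_distr:
      "\<lbrakk>x \<in> carrier A; y \<in> carrier A\<rbrakk> \<Longrightarrow> c \<odot> (x \<oplus> y) = c \<odot> x \<oplus> c \<odot> y"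
    and smult_assoc: "x \<in> carrier A \<Longrightarrow> (c * d) \<odot> x = c \<odot> (d \<odot> x)"
    and smult_one [simp]: "x \<in> carrier A \<Longrightarrow> 1 \<odot> x = x"
    and smult_mult_left:
      "\<lbrakk>x \<in> carrier A; y \<in> carrier A\<rbrakk> \<Longrightarrow> (c \<odot> x) \<otimes> y = c \<odot> (x \<otimes> y)"
    and smult_mult_right:
      "\<lbrakk>x \<in> carrier A; y \<in> carrier A\<rbrakk> \<Longrightarrow> x \<otimes> (c \<odot> y) = c \<odot> (x \<otimes> y)"
    and star_closed [simp, intro]: "x \<in> carrier A \<Longrightarrow> \<star>x \<in> carrier A"
    and star_star [simp]: "x \<in> carrier A \<Longrightarrow> \<star>(\<star>x) = x"
    and star_add: "\<lbrakk>x \<in> carrier A; y \<in> carrier A\<rbrakk> \<Longrightarrow> \<star>(x \<oplus> y) = \<star>x \<oplus> \<star>y"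
    and star_smult: "x \<in> carrier A \<Longrightarrow> \<star>(c \<odot> x) = cnj c \<odot> \<star>x"
    and star_mult: "\<lbrakk>x \<in> carrier A; y \<in> carrier A\<rbrakk> \<Longrightarrow> \<star>(x \<otimes> y) = \<star>y \<otimes> \<star>x"

definition cstar_seminorm :: "('a, 'm) normed_star_scheme \<Rightarrow> ('a \<Rightarrow> real) \<Rightarrow> bool" where
  "cstar_seminorm A p \<longleftrightarrow>
     (\<forall>x\<in>carrier A. 0 \<le> p x) \<and>
     (\<forall>x\<in>carrier A. \<forall>y\<in>carrier A. p (x \<oplus>\<^bsub>A\<^esub> y) \<le> p x + p y) \<and>
     (\<forall>c. \<forall>x\<in>carrier A. p (c \<odot>\<^bsub>A\<^esub> x) = cmod c * p x) \<and>
     (\<forall>x\<in>carrier A. \<forall>y\<in>carrier A. p (x \<otimes>\<^bsub>A\<^esub> y) \<le> p x * p y) \<and>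
     (\<forall>x\<in>carrier A. p (\<star>\<^bsub>A\<^esub>x \<otimes>\<^bsub>A\<^esub> x) = (p x)\<^sup>2)"

text \<open>The value off the carrier only serves to make this a total symmetric function, as
  \<^locale>\<open>Metric_space\<close> requires.\<close>

definition nrm_dist :: "('a, 'm) normed_star_scheme \<Rightarrow> 'a \<Rightarrow> 'a \<Rightarrow> real" where
  "nrm_dist A x y = (if x \<in> carrier A \<and> y \<in> carrier A then \<parallel>x \<ominus>\<^bsub>A\<^esub> y\<parallel>\<^bsub>A\<^esub> else 0)"

locale pre_cstar_algebra = star_algebra +
  assumes seminorm: "cstar_seminorm A (nrm A)"

locale cstar_algebra = pre_cstar_algebra +
  assumes nrm_eq_0: "\<lbrakk>x \<in> carrier A; \<parallel>x\<parallel> = 0\<rbrakk> \<Longrightarrow> x = \<zero>"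
    and complete: "Metric_space.mcomplete (carrier A) (nrm_dist A)"

definition closed_ideal :: "'a set \<Rightarrow> ('a, 'm) normed_star_scheme \<Rightarrow> bool" where
  "closed_ideal I A \<longleftrightarrow>
     ideal I A \<and> closedin (Metric_space.mtopology (carrier A) (nrm_dist A)) I"

text \<open>The zero algebra is not simple.\<close>

definition cstar_simple :: "('a, 'm) normed_star_scheme \<Rightarrow> bool" where
  "cstar_simple A \<longleftrightarrow> carrier A \<noteq> {\<zero>\<^bsub>A\<^esub>} \<and>
     (\<forall>I. closed_ideal I A \<longrightarrow> I = {\<zero>\<^bsub>A\<^esub>} \<or> I = carrier A)"

definition star_hom ::
  "('a, 'm) normed_star_scheme \<Rightarrow> ('b, 'k) normed_star_scheme \<Rightarrow> ('a \<Rightarrow> 'b) set" where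
  "star_hom A B = {\<phi> \<in> ring_hom A B.
     (\<forall>c. \<forall>x\<in>carrier A. \<phi> (c \<odot>\<^bsub>A\<^esub> x) = c \<odot>\<^bsub>B\<^esub> \<phi> x) \<and>
     (\<forall>x\<in>carrier A. \<phi> (\<star>\<^bsub>A\<^esub>x) = \<star>\<^bsub>B\<^esub>(\<phi> x))}"

definition unitary_elem :: "('a, 'm) normed_star_scheme \<Rightarrow> 'a \<Rightarrow> bool" where
  "unitary_elem A u \<longleftrightarrow> u \<in> carrier A \<and>
     \<star>\<^bsub>A\<^esub>u \<otimes>\<^bsub>A\<^esub> u = \<one>\<^bsub>A\<^esub> \<and> u \<otimes>\<^bsub>A\<^esub> \<star>\<^bsub>A\<^esub>u = \<one>\<^bsub>A\<^esub>"

context star_algebra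
begin

lemma smult_zero_left [simp]: "x \<in> carrier A \<Longrightarrow> 0 \<odot> x = \<zero>"
  by (metis add.r_cancel_one' add_cancel_right_left smult_closed smult_l_distr)

lemma smult_zero_right [simp]: "c \<odot> \<zero> = \<zero>"
  by (metis mult_zero_right smult_assoc smult_zero_left zero_closed)

lemma smult_minus_one: "x \<in> carrier A \<Longrightarrow> (- 1) \<odot> x = \<ominus> x"
  by (metis add.inv_closed add.inv_comm add.inv_equality ab_left_minus smult_closed
      smult_l_distr smult_one smult_zero_left)

lemma minus_eq_smult: "\<lbrakk>x \<in> carrier A; y \<in> carrier A\<rbrakk> \<Longrightarrow> x \<ominus> y = x \<oplus> (- 1) \<odot> y"
  by (simp add: smult_minus_one minus_eq)

lemma star_one [simp]: "\<star>\<one> = \<one>"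
  by (metis one_closed r_one star_closed star_mult star_star)

lemma smult_diff:
  "\<lbrakk>x \<in> carrier A; y \<in> carrier A\<rbrakk> \<Longrightarrow> c \<odot> x \<ominus> c \<odot> y = c \<odot> (x \<ominus> y)"
  by (simp add: minus_eq_smult smult_r_distr flip: smult_assoc)

lemma star_diff: "\<lbrakk>x \<in> carrier A; y \<in> carrier A\<rbrakk> \<Longrightarrow> \<star>x \<ominus> \<star>y = \<star>(x \<ominus> y)"
  by (simp add: minus_eq_smult star_add star_smult)

lemma add_diff:
  assumes "x \<in> carrier A" "y \<in> carrier A" "x' \<in> carrier A" "y' \<in> carrier A"
  shows "(x \<oplus> y) \<ominus> (x' \<oplus> y') = (x \<ominus> x') \<oplus> (y \<ominus> y')"
  using assms by (simp add: minus_eq minus_add a_ac)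

lemma diff_trans:
  assumes "x \<in> carrier A" "y \<in> carrier A" "z \<in> carrier A"
  shows "x \<ominus> z = (x \<ominus> y) \<oplus> (y \<ominus> z)"
  using assms by (simp add: minus_eq a_ac r_neg1 r_neg2)

lemma mult_diff:
  assumes "x \<in> carrier A" "y \<in> carrier A" "x' \<in> carrier A" "y' \<in> carrier A"
  shows "x \<otimes> y \<ominus> x' \<otimes> y' = (x \<ominus> x') \<otimes> y \<oplus> x' \<otimes> (y \<ominus> y')"
proof -
  have "(x \<ominus> x') \<otimes> y \<oplus> x' \<otimes> (y \<ominus> y') = (x \<otimes> y \<ominus> x' \<otimes> y) \<oplus> (x' \<otimes> y \<ominus> x' \<otimes> y')"
    using assms by (simp add: minus_eq l_distr r_distr l_minus r_minus)
  also have "\<dots> = x \<otimes> y \<ominus> x' \<otimes> y'"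
    using assms by (intro diff_trans [symmetric]) auto
  finally show ?thesis ..
qed

lemma minus_eq_zero_iff: "\<lbrakk>x \<in> carrier A; y \<in> carrier A\<rbrakk> \<Longrightarrow> x \<ominus> y = \<zero> \<longleftrightarrow> x = y"
  by (metis a_inv_closed add.inv_equality minus_eq minus_minus r_neg)

lemma minus_self [simp]: "x \<in> carrier A \<Longrightarrow> x \<ominus> x = \<zero>"
  by (simp add: minus_eq_zero_iff)

lemma star_homD:
  assumes "\<phi> \<in> star_hom A B" "x \<in> carrier A"
  shows "\<phi> x \<in> carrier B" "\<phi> (c \<odot> x) = c \<odot>\<^bsub>B\<^esub> \<phi> x" "\<phi> (\<star>x) = \<star>\<^bsub>B\<^esub>(\<phi> x)" "\<phi> \<one> = \<one>\<^bsub>B\<^esub>"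
    and "y \<in> carrier A \<Longrightarrow> \<phi> (x \<oplus> y) = \<phi> x \<oplus>\<^bsub>B\<^esub> \<phi> y"
    and "y \<in> carrier A \<Longrightarrow> \<phi> (x \<otimes> y) = \<phi> x \<otimes>\<^bsub>B\<^esub> \<phi> y"
  using assms by (auto simp: star_hom_def ring_hom_def)

lemma star_hom_unitary:
  assumes "\<phi> \<in> star_hom A B" "unitary_elem A u"
  shows "unitary_elem B (\<phi> u)"
proof -
  have u: "u \<in> carrier A" "\<star>u \<otimes> u = \<one>" "u \<otimes> \<star>u = \<one>"
    using assms(2) by (auto simp: unitary_elem_def)
  note h = star_homD[OF assms(1)]
  have "\<star>\<^bsub>B\<^esub>(\<phi> u) \<otimes>\<^bsub>B\<^esub> \<phi> u = \<phi> (\<star>u \<otimes> u)" "\<phi> u \<otimes>\<^bsub>B\<^esub> \<star>\<^bsub>B\<^esub>(\<phi> u) = \<phi> (u \<otimes> \<star>u)"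
    using u(1) by (simp_all add: h)
  then show ?thesis using u h(1)[of u] h(4)[of u] by (simp add: unitary_elem_def)
qed

end

locale star_seminorm = star_algebra +
  fixes p
  assumes cstar_seminorm: "cstar_seminorm A p"
begin

lemma p_nonneg [simp]: "x \<in> carrier A \<Longrightarrow> 0 \<le> p x"
  and p_add: "\<lbrakk>x \<in> carrier A; y \<in> carrier A\<rbrakk> \<Longrightarrow> p (x \<oplus> y) \<le> p x + p y"
  and p_smult: "x \<in> carrier A \<Longrightarrow> p (c \<odot> x) = cmod c * p x"
  and p_mult: "\<lbrakk>x \<in> carrier A; y \<in> carrier A\<rbrakk> \<Longrightarrow> p (x \<otimes> y) \<le> p x * p y"
  and p_star_mult: "x \<in> carrier A \<Longrightarrow> p (\<star>x \<otimes> x) = (p x)\<^sup>2"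
  using cstar_seminorm by (auto simp: cstar_seminorm_def)

lemma p_zero [simp]: "p \<zero> = 0"
  by (metis norm_zero mult_zero_left p_smult smult_zero_left zero_closed)

lemma p_star [simp]:
  assumes "x \<in> carrier A" shows "p (\<star>x) = p x"
proof -
  have *: "p y \<le> p (\<star>y)" if "y \<in> carrier A" for y
  proof (cases "p y = 0")
    case False
    then have "0 < p y" using p_nonneg[OF that] by linarith
    moreover have "p y * p y \<le> p (\<star>y) * p y"
      using p_mult[of "\<star>y" y] p_star_mult[of y] that by (simp add: power2_eq_square)
    ultimately show ?thesis by simp
  qed (use that in simp)
  from *[of x] *[of "\<star>x"] assms show ?thesis by simp
qed

lemma p_one_le: "p \<one> \<le> 1"
proof -
  have "(p \<one>)\<^sup>2 = p \<one>" using p_star_mult[of \<one>] by simp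
  then show ?thesis by (metis order_refl power2_eq_square mult_cancel_right1 zero_le_one)
qed

lemma p_unitary: assumes "unitary_elem A u" shows "p u \<le> 1"
proof -
  have "(p u)\<^sup>2 = p \<one>" using p_star_mult[of u] assms by (simp add: unitary_elem_def)
  then have "(p u)\<^sup>2 \<le> 1" using p_one_le by simp
  then show ?thesis by (simp add: power_le_one_iff abs_square_le_1)
qed

lemma p_minus_commute: "\<lbrakk>x \<in> carrier A; y \<in> carrier A\<rbrakk> \<Longrightarrow> p (x \<ominus> y) = p (y \<ominus> x)"
proof -
  assume xy: "x \<in> carrier A" "y \<in> carrier A"
  have "x \<ominus> y = (- 1) \<odot> (y \<ominus> x)"
    using xy by (simp add: minus_eq_smult smult_r_distr a_comm flip: smult_assoc)
  then show ?thesis using xy by (simp add: p_smult)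
qed

lemma p_triangle:
  "\<lbrakk>x \<in> carrier A; y \<in> carrier A; z \<in> carrier A\<rbrakk> \<Longrightarrow> p (x \<ominus> z) \<le> p (x \<ominus> y) + p (y \<ominus> z)"
  by (metis diff_trans minus_closed p_add)

lemma p_diff_abs:
  assumes "x \<in> carrier A" "y \<in> carrier A" shows "\<bar>p x - p y\<bar> \<le> p (x \<ominus> y)"
proof -
  have z: "\<And>u. u \<in> carrier A \<Longrightarrow> u \<ominus> \<zero> = u" by (simp add: minus_eq)
  show ?thesis
    using p_triangle[of x y \<zero>] p_triangle[of y x \<zero>] p_minus_commute[of x y] assms z by simp
qed

end

sublocale pre_cstar_algebra \<subseteq> star_seminorm A "nrm A"
  by unfold_locales (rule seminorm)

sublocale cstar_algebra \<subseteq> Metric_space "carrier A" "nrm_dist A"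
proof
  show "0 \<le> nrm_dist A x y" for x y by (simp add: nrm_dist_def)
  show "nrm_dist A x y = nrm_dist A y x" for x y
    using p_minus_commute[of x y] by (simp add: nrm_dist_def)
  show "(nrm_dist A x y = 0) = (x = y)" if "x \<in> carrier A" "y \<in> carrier A" for x y
    using that nrm_eq_0[of "x \<ominus> y"] minus_eq_zero_iff[OF that]
    by (auto simp: nrm_dist_def)
  show "nrm_dist A x z \<le> nrm_dist A x y + nrm_dist A y z"
    if "x \<in> carrier A" "y \<in> carrier A" "z \<in> carrier A" for x y z
    using that p_triangle[of x y z] by (simp add: nrm_dist_def)
qed


section \<open>Hausdorff completion\<close>

text \<open>Elements are classes of Cauchy sequences modulo null sequences; the operations are computed on
  chosen representatives and do not depend on the choice.\<close>

definition cauchy_seqs :: "('a, 'm) normed_star_scheme \<Rightarrow> (nat \<Rightarrow> 'a) set" where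
  "cauchy_seqs A = {x. (\<forall>k. x k \<in> carrier A) \<and>
     (\<forall>e>0. \<exists>N. \<forall>m\<ge>N. \<forall>k\<ge>N. \<parallel>x m \<ominus>\<^bsub>A\<^esub> x k\<parallel>\<^bsub>A\<^esub> < e)}"

definition cauchy_class :: "('a, 'm) normed_star_scheme \<Rightarrow> (nat \<Rightarrow> 'a) \<Rightarrow> (nat \<Rightarrow> 'a) set" where
  "cauchy_class A x = {y \<in> cauchy_seqs A. (\<lambda>k. \<parallel>x k \<ominus>\<^bsub>A\<^esub> y k\<parallel>\<^bsub>A\<^esub>) \<longlonglongrightarrow> 0}"

definition cauchy_rep :: "(nat \<Rightarrow> 'a) set \<Rightarrow> nat \<Rightarrow> 'a" where
  "cauchy_rep X = (SOME x. x \<in> X)"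

definition completion :: "'a normed_star \<Rightarrow> (nat \<Rightarrow> 'a) set normed_star" where
  "completion A = \<lparr>
     carrier = cauchy_class A ` cauchy_seqs A,
     monoid.mult = (\<lambda>X Y. cauchy_class A (\<lambda>k. cauchy_rep X k \<otimes>\<^bsub>A\<^esub> cauchy_rep Y k)),
     one = cauchy_class A (\<lambda>k. \<one>\<^bsub>A\<^esub>),
     zero = cauchy_class A (\<lambda>k. \<zero>\<^bsub>A\<^esub>),
     add = (\<lambda>X Y. cauchy_class A (\<lambda>k. cauchy_rep X k \<oplus>\<^bsub>A\<^esub> cauchy_rep Y k)),
     smult = (\<lambda>c X. cauchy_class A (\<lambda>k. c \<odot>\<^bsub>A\<^esub> cauchy_rep X k)),
     star = (\<lambda>X. cauchy_class A (\<lambda>k. \<star>\<^bsub>A\<^esub>(cauchy_rep X k))),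
     nrm = (\<lambda>X. lim (\<lambda>k. \<parallel>cauchy_rep X k\<parallel>\<^bsub>A\<^esub>))\<rparr>"

definition completion_embed :: "'a normed_star \<Rightarrow> 'a \<Rightarrow> (nat \<Rightarrow> 'a) set" where
  "completion_embed A x = cauchy_class A (\<lambda>k. x)"

locale completing = pre_cstar_algebra A for A :: "'a normed_star" (structure)
begin

abbreviation C where "C \<equiv> cauchy_seqs A"
abbreviation cls where "cls \<equiv> cauchy_class A"
abbreviation \<C> where "\<C> \<equiv> completion A"

lemma C_carrier [simp]: "x \<in> C \<Longrightarrow> x k \<in> carrier A"
  by (simp add: cauchy_seqs_def)

lemma C_cauchy: "x \<in> C \<Longrightarrow> 0 < e \<Longrightarrow> \<exists>N. \<forall>m\<ge>N. \<forall>k\<ge>N. \<parallel>x m \<ominus> x k\<parallel> < e"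
  unfolding cauchy_seqs_def by blast

lemma C_I:
  assumes "\<And>k. x k \<in> carrier A" "\<And>e. 0 < e \<Longrightarrow> \<exists>N. \<forall>m\<ge>N. \<forall>k\<ge>N. \<parallel>x m \<ominus> x k\<parallel> < e"
  shows "x \<in> C"
  using assms unfolding cauchy_seqs_def by blast

lemma C_const: "x \<in> carrier A \<Longrightarrow> (\<lambda>k. x) \<in> C"
  by (rule C_I) (auto simp: minus_eq r_neg)

lemma C_convergent_nrm: assumes "x \<in> C" shows "convergent (\<lambda>k. \<parallel>x k\<parallel>)"
proof (rule Cauchy_convergent, rule CauchyI')
  fix e :: real assume "0 < e"
  then obtain N where N: "\<And>m k. m \<ge> N \<Longrightarrow> k \<ge> N \<Longrightarrow> \<parallel>x m \<ominus> x k\<parallel> < e"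
    using C_cauchy[OF assms] by blast
  have "dist \<parallel>x m\<parallel> \<parallel>x k\<parallel> < e" if "m \<ge> N" "k > m" for m k
    using N[of m k] p_diff_abs[of "x m" "x k"] that assms by (simp add: dist_real_def)
  then show "\<exists>M. \<forall>m\<ge>M. \<forall>n>m. dist \<parallel>x m\<parallel> \<parallel>x n\<parallel> < e" by blast
qed

lemma C_bounded: assumes "x \<in> C" obtains B where "0 < B" "\<And>k. \<parallel>x k\<parallel> \<le> B"
proof -
  have "Bseq (\<lambda>k. \<parallel>x k\<parallel>)" using C_convergent_nrm[OF assms] by (rule convergent_imp_Bseq)
  then obtain B where "0 < B" "\<And>k. norm \<parallel>x k\<parallel> \<le> B" unfolding Bseq_def by blast
  then show thesis using that[of B] by (metis abs_le_D1 real_norm_def)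
qed

lemma C_add: assumes "x \<in> C" "y \<in> C" shows "(\<lambda>k. x k \<oplus> y k) \<in> C"
proof (rule C_I)
  fix e :: real assume "0 < e"
  then have "0 < e/2" by simp
  from C_cauchy[OF assms(1) this] C_cauchy[OF assms(2) this]
  obtain N M where N: "\<And>m k. m \<ge> N \<Longrightarrow> k \<ge> N \<Longrightarrow> \<parallel>x m \<ominus> x k\<parallel> < e/2"
    and M: "\<And>m k. m \<ge> M \<Longrightarrow> k \<ge> M \<Longrightarrow> \<parallel>y m \<ominus> y k\<parallel> < e/2" by blast
  have "\<parallel>(x m \<oplus> y m) \<ominus> (x k \<oplus> y k)\<parallel> < e" if "m \<ge> max N M" "k \<ge> max N M" for m k
    using N[of m k] M[of m k] that assms p_add[of "x m \<ominus> x k" "y m \<ominus> y k"]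
    by (simp add: add_diff)
  then show "\<exists>N. \<forall>m\<ge>N. \<forall>k\<ge>N. \<parallel>(x m \<oplus> y m) \<ominus> (x k \<oplus> y k)\<parallel> < e" by blast
qed (use assms in auto)

lemma mult_diff_bound:
  assumes "x \<in> carrier A" "y \<in> carrier A" "x' \<in> carrier A" "y' \<in> carrier A"
    "\<parallel>y\<parallel> \<le> B" "\<parallel>x'\<parallel> \<le> B"
  shows "\<parallel>x \<otimes> y \<ominus> x' \<otimes> y'\<parallel> \<le> B * (\<parallel>x \<ominus> x'\<parallel> + \<parallel>y \<ominus> y'\<parallel>)"
proof -
  have "\<parallel>x \<otimes> y \<ominus> x' \<otimes> y'\<parallel> \<le> \<parallel>x \<ominus> x'\<parallel> * \<parallel>y\<parallel> + \<parallel>x'\<parallel> * \<parallel>y \<ominus> y'\<parallel>"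
    using assms p_add[of "(x \<ominus> x') \<otimes> y" "x' \<otimes> (y \<ominus> y')"] p_mult[of "x \<ominus> x'" y]
      p_mult[of x' "y \<ominus> y'"] by (simp add: mult_diff)
  also have "\<dots> \<le> \<parallel>x \<ominus> x'\<parallel> * B + B * \<parallel>y \<ominus> y'\<parallel>"
    using assms by (intro add_mono mult_left_mono mult_right_mono) auto
  finally show ?thesis by (simp add: algebra_simps)
qed

lemma C_mult: assumes "x \<in> C" "y \<in> C" shows "(\<lambda>k. x k \<otimes> y k) \<in> C"
proof (rule C_I)
  obtain B1 B2 where B: "0 < B1" "\<And>k. \<parallel>x k\<parallel> \<le> B1" "0 < B2" "\<And>k. \<parallel>y k\<parallel> \<le> B2"
    using C_bounded assms by metis
  define D where "D = max B1 B2"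
  have D: "0 < D" "\<And>k. \<parallel>x k\<parallel> \<le> D" "\<And>k. \<parallel>y k\<parallel> \<le> D"
    using B by (auto simp: D_def intro: le_max_iff_disj[THEN iffD2])
  fix e :: real assume "0 < e"
  then have "0 < e/(2*D)" using D by simp
  from C_cauchy[OF assms(1) this] C_cauchy[OF assms(2) this]
  obtain N M where N: "\<And>m k. m \<ge> N \<Longrightarrow> k \<ge> N \<Longrightarrow> \<parallel>x m \<ominus> x k\<parallel> < e/(2*D)"
    and M: "\<And>m k. m \<ge> M \<Longrightarrow> k \<ge> M \<Longrightarrow> \<parallel>y m \<ominus> y k\<parallel> < e/(2*D)" by blast
  have "\<parallel>(x m \<otimes> y m) \<ominus> (x k \<otimes> y k)\<parallel> < e" if "m \<ge> max N M" "k \<ge> max N M" for m k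
  proof -
    have "\<parallel>(x m \<otimes> y m) \<ominus> (x k \<otimes> y k)\<parallel> \<le> D * (\<parallel>x m \<ominus> x k\<parallel> + \<parallel>y m \<ominus> y k\<parallel>)"
      using assms D by (intro mult_diff_bound) auto
    also have "\<dots> < D * (e/(2*D) + e/(2*D))"
      using N[of m k] M[of m k] that D by (intro mult_strict_left_mono add_strict_mono) auto
    also have "\<dots> = e" using D by (simp add: field_simps)
    finally show ?thesis .
  qed
  then show "\<exists>N. \<forall>m\<ge>N. \<forall>k\<ge>N. \<parallel>(x m \<otimes> y m) \<ominus> (x k \<otimes> y k)\<parallel> < e" by blast
qed (use assms in auto)

lemma C_smult: assumes "x \<in> C" shows "(\<lambda>k. c \<odot> x k) \<in> C"
proof (rule C_I)
  fix e :: real assume "0 < e"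
  have c: "0 < cmod c + 1" by (smt (verit) norm_ge_zero)
  with \<open>0 < e\<close> have "0 < e / (cmod c + 1)" by simp
  from C_cauchy[OF assms this] obtain N
    where N: "\<And>m k. m \<ge> N \<Longrightarrow> k \<ge> N \<Longrightarrow> \<parallel>x m \<ominus> x k\<parallel> < e / (cmod c + 1)" by blast
  have "\<parallel>c \<odot> x m \<ominus> c \<odot> x k\<parallel> < e" if "m \<ge> N" "k \<ge> N" for m k
  proof -
    have "\<parallel>c \<odot> x m \<ominus> c \<odot> x k\<parallel> \<le> (cmod c + 1) * \<parallel>x m \<ominus> x k\<parallel>"
      using assms by (simp add: smult_diff p_smult algebra_simps)
    also have "\<dots> < (cmod c + 1) * (e / (cmod c + 1))"
      using N[OF that] c by (intro mult_strict_left_mono) auto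
    finally show ?thesis using c by simp
  qed
  then show "\<exists>N. \<forall>m\<ge>N. \<forall>k\<ge>N. \<parallel>c \<odot> x m \<ominus> c \<odot> x k\<parallel> < e" by blast
qed (use assms in auto)

lemma C_star: "x \<in> C \<Longrightarrow> (\<lambda>k. \<star>(x k)) \<in> C"
  by (rule C_I) (simp_all add: star_diff C_cauchy)

lemma cls_eqI:
  assumes "x \<in> C" "y \<in> C" "(\<lambda>k. \<parallel>x k \<ominus> y k\<parallel>) \<longlonglongrightarrow> 0"
  shows "cls x = cls y"
proof -
  have *: "(\<lambda>k. \<parallel>v k \<ominus> z k\<parallel>) \<longlonglongrightarrow> 0"
    if "u \<in> C" "v \<in> C" "z \<in> C" "(\<lambda>k. \<parallel>u k \<ominus> v k\<parallel>) \<longlonglongrightarrow> 0" "(\<lambda>k. \<parallel>u k \<ominus> z k\<parallel>) \<longlonglongrightarrow> 0"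
    for u v z
  proof (rule tendsto_sandwich[OF _ _ tendsto_const])
    show "\<forall>\<^sub>F k in sequentially. \<parallel>v k \<ominus> z k\<parallel> \<le> \<parallel>u k \<ominus> v k\<parallel> + \<parallel>u k \<ominus> z k\<parallel>"
    proof (intro always_eventually allI)
      fix k
      show "\<parallel>v k \<ominus> z k\<parallel> \<le> \<parallel>u k \<ominus> v k\<parallel> + \<parallel>u k \<ominus> z k\<parallel>"
        using that p_triangle[of "v k" "u k" "z k"] p_minus_commute[of "u k" "v k"] by simp
    qed
    show "(\<lambda>k. \<parallel>u k \<ominus> v k\<parallel> + \<parallel>u k \<ominus> z k\<parallel>) \<longlonglongrightarrow> 0"
      using tendsto_add[OF that(4,5)] by simp
  qed (use that in auto)
  have sym: "(\<lambda>k. \<parallel>y k \<ominus> x k\<parallel>) \<longlonglongrightarrow> 0"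
    using assms(3) p_minus_commute[OF C_carrier[OF assms(1)] C_carrier[OF assms(2)]] by simp
  show ?thesis
    using *[of x y] *[of y x] assms sym by (auto simp: cauchy_class_def)
qed

lemma cls_self: "x \<in> C \<Longrightarrow> x \<in> cls x"
  by (simp add: cauchy_class_def)

lemma cls_eqD: assumes "x \<in> C" "y \<in> C" "cls x = cls y" shows "(\<lambda>k. \<parallel>x k \<ominus> y k\<parallel>) \<longlonglongrightarrow> 0"
proof -
  have "y \<in> cls x" using cls_self[OF assms(2)] assms(3) by simp
  then show ?thesis by (simp add: cauchy_class_def)
qed

lemma rep:
  assumes "x \<in> C"
  shows rep_C: "cauchy_rep (cls x) \<in> C"
    and rep_lim: "(\<lambda>k. \<parallel>x k \<ominus> cauchy_rep (cls x) k\<parallel>) \<longlonglongrightarrow> 0"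
    and rep_lim': "(\<lambda>k. \<parallel>cauchy_rep (cls x) k \<ominus> x k\<parallel>) \<longlonglongrightarrow> 0"
    and cls_rep: "cls (cauchy_rep (cls x)) = cls x"
proof -
  have "cauchy_rep (cls x) \<in> cls x"
    unfolding cauchy_rep_def using cls_self[OF assms] by (rule someI [of "\<lambda>z. z \<in> cls x"])
  then show 1: "cauchy_rep (cls x) \<in> C"
    and 2: "(\<lambda>k. \<parallel>x k \<ominus> cauchy_rep (cls x) k\<parallel>) \<longlonglongrightarrow> 0"
    by (auto simp: cauchy_class_def)
  show "cls (cauchy_rep (cls x)) = cls x" using cls_eqI[OF assms 1 2] ..
  then show "(\<lambda>k. \<parallel>cauchy_rep (cls x) k \<ominus> x k\<parallel>) \<longlonglongrightarrow> 0"
    using 1 assms cls_eqD by blast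
qed

lemma completion_carrier: "carrier \<C> = cls ` C"
  by (simp add: completion_def)

lemma completion_one: "\<one>\<^bsub>\<C>\<^esub> = cls (\<lambda>k. \<one>)" and completion_zero: "\<zero>\<^bsub>\<C>\<^esub> = cls (\<lambda>k. \<zero>)"
  by (simp_all add: completion_def)

lemma completion_add:
  assumes "x \<in> C" "y \<in> C" shows "cls x \<oplus>\<^bsub>\<C>\<^esub> cls y = cls (\<lambda>k. x k \<oplus> y k)"
proof -
  let ?x = "cauchy_rep (cls x)" and ?y = "cauchy_rep (cls y)"
  have "(\<lambda>k. \<parallel>(?x k \<oplus> ?y k) \<ominus> (x k \<oplus> y k)\<parallel>) \<longlonglongrightarrow> 0"
  proof (rule tendsto_sandwich[OF _ _ tendsto_const])
    show "\<forall>\<^sub>F k in sequentially.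
        \<parallel>(?x k \<oplus> ?y k) \<ominus> (x k \<oplus> y k)\<parallel> \<le> \<parallel>?x k \<ominus> x k\<parallel> + \<parallel>?y k \<ominus> y k\<parallel>"
      using assms by (simp add: add_diff p_add rep_C)
    show "(\<lambda>k. \<parallel>?x k \<ominus> x k\<parallel> + \<parallel>?y k \<ominus> y k\<parallel>) \<longlonglongrightarrow> 0"
      using tendsto_add[OF rep_lim'[OF assms(1)] rep_lim'[OF assms(2)]] by simp
  qed (use assms rep_C in auto)
  then have "cls (\<lambda>k. ?x k \<oplus> ?y k) = cls (\<lambda>k. x k \<oplus> y k)"
    by (intro cls_eqI C_add rep_C assms)
  then show ?thesis by (simp add: completion_def)
qed

lemma completion_mult:
  assumes "x \<in> C" "y \<in> C" shows "cls x \<otimes>\<^bsub>\<C>\<^esub> cls y = cls (\<lambda>k. x k \<otimes> y k)"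
proof -
  let ?x = "cauchy_rep (cls x)" and ?y = "cauchy_rep (cls y)"
  obtain B1 B2 where B: "0 < B1" "\<And>k. \<parallel>x k\<parallel> \<le> B1" "0 < B2" "\<And>k. \<parallel>?y k\<parallel> \<le> B2"
    using C_bounded assms rep_C by metis
  define D where "D = max B1 B2"
  have D: "0 < D" "\<And>k. \<parallel>x k\<parallel> \<le> D" "\<And>k. \<parallel>?y k\<parallel> \<le> D"
    using B by (auto simp: D_def intro: le_max_iff_disj[THEN iffD2])
  have "(\<lambda>k. \<parallel>(?x k \<otimes> ?y k) \<ominus> (x k \<otimes> y k)\<parallel>) \<longlonglongrightarrow> 0"
  proof (rule tendsto_sandwich[OF _ _ tendsto_const])
    show "\<forall>\<^sub>F k in sequentially.
        \<parallel>(?x k \<otimes> ?y k) \<ominus> (x k \<otimes> y k)\<parallel> \<le> D * (\<parallel>?x k \<ominus> x k\<parallel> + \<parallel>?y k \<ominus> y k\<parallel>)"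
      using assms D by (intro always_eventually allI mult_diff_bound) (auto simp: rep_C)
    show "(\<lambda>k. D * (\<parallel>?x k \<ominus> x k\<parallel> + \<parallel>?y k \<ominus> y k\<parallel>)) \<longlonglongrightarrow> 0"
      using tendsto_mult_right_zero[OF tendsto_add_zero[OF rep_lim'[OF assms(1)] rep_lim'[OF assms(2)]]] .
  qed (use assms rep_C in auto)
  then have "cls (\<lambda>k. ?x k \<otimes> ?y k) = cls (\<lambda>k. x k \<otimes> y k)"
    by (intro cls_eqI C_mult rep_C assms)
  then show ?thesis by (simp add: completion_def)
qed

lemma completion_smult:
  assumes "x \<in> C" shows "c \<odot>\<^bsub>\<C>\<^esub> cls x = cls (\<lambda>k. c \<odot> x k)"
proof -
  let ?x = "cauchy_rep (cls x)"
  have "(\<lambda>k. \<parallel>c \<odot> ?x k \<ominus> c \<odot> x k\<parallel>) \<longlonglongrightarrow> 0"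
    using tendsto_mult_right_zero[OF rep_lim'[OF assms], of "cmod c"] assms
    by (simp add: smult_diff p_smult rep_C)
  then have "cls (\<lambda>k. c \<odot> ?x k) = cls (\<lambda>k. c \<odot> x k)"
    by (intro cls_eqI C_smult rep_C assms)
  then show ?thesis by (simp add: completion_def)
qed

lemma completion_star:
  assumes "x \<in> C" shows "\<star>\<^bsub>\<C>\<^esub>(cls x) = cls (\<lambda>k. \<star>(x k))"
proof -
  let ?x = "cauchy_rep (cls x)"
  have "(\<lambda>k. \<parallel>\<star>(?x k) \<ominus> \<star>(x k)\<parallel>) \<longlonglongrightarrow> 0"
    using rep_lim'[OF assms] assms by (simp add: star_diff rep_C)
  then have "cls (\<lambda>k. \<star>(?x k)) = cls (\<lambda>k. \<star>(x k))"
    by (intro cls_eqI C_star rep_C assms)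
  then show ?thesis by (simp add: completion_def)
qed

lemma completion_nrm:
  assumes "x \<in> C" shows "(\<lambda>k. \<parallel>x k\<parallel>) \<longlonglongrightarrow> \<parallel>cls x\<parallel>\<^bsub>\<C>\<^esub>"
proof -
  let ?x = "cauchy_rep (cls x)"
  have 1: "(\<lambda>k. \<parallel>?x k\<parallel>) \<longlonglongrightarrow> \<parallel>cls x\<parallel>\<^bsub>\<C>\<^esub>"
    using C_convergent_nrm[OF rep_C[OF assms]] by (simp add: completion_def convergent_LIMSEQ_iff)
  have "(\<lambda>k. \<parallel>x k\<parallel> - \<parallel>?x k\<parallel>) \<longlonglongrightarrow> 0"
    by (rule Lim_null_comparison[OF _ rep_lim[OF assms]])
      (use assms in \<open>simp add: p_diff_abs rep_C\<close>)
  from tendsto_add[OF this 1] show ?thesis by simp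
qed

lemma completion_cases: assumes "X \<in> carrier \<C>" obtains x where "x \<in> C" "X = cls x"
  using assms by (auto simp: completion_carrier)

lemmas completion_ops = completion_add completion_mult completion_smult completion_star
  completion_one completion_zero
lemmas C_ops = C_add C_mult C_smult C_star C_const

lemma completion_ring: "ring \<C>"
proof (rule ringI)
  show "abelian_group \<C>"
  proof (rule abelian_groupI)
    fix X Y Z assume "X \<in> carrier \<C>" "Y \<in> carrier \<C>" "Z \<in> carrier \<C>"
    then obtain x y z where "x \<in> C" "y \<in> C" "z \<in> C" "X = cls x" "Y = cls y" "Z = cls z"
      by (metis completion_cases)
    then show "X \<oplus>\<^bsub>\<C>\<^esub> Y \<oplus>\<^bsub>\<C>\<^esub> Z = X \<oplus>\<^bsub>\<C>\<^esub> (Y \<oplus>\<^bsub>\<C>\<^esub> Z)"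
      by (simp add: completion_ops C_ops a_assoc)
  next
    fix X Y assume "X \<in> carrier \<C>" "Y \<in> carrier \<C>"
    then obtain x y where xy: "x \<in> C" "y \<in> C" "X = cls x" "Y = cls y"
      by (metis completion_cases)
    then show "X \<oplus>\<^bsub>\<C>\<^esub> Y \<in> carrier \<C>"
      by (simp add: completion_ops C_ops completion_carrier)
    from xy show "X \<oplus>\<^bsub>\<C>\<^esub> Y = Y \<oplus>\<^bsub>\<C>\<^esub> X"
      by (simp add: completion_ops C_ops a_comm)
  next
    fix X assume "X \<in> carrier \<C>"
    then obtain x where x: "x \<in> C" "X = cls x" by (metis completion_cases)
    then show "\<zero>\<^bsub>\<C>\<^esub> \<oplus>\<^bsub>\<C>\<^esub> X = X" by (simp add: completion_ops C_ops)
    have "cls (\<lambda>k. (- 1) \<odot> x k) \<oplus>\<^bsub>\<C>\<^esub> X = cls (\<lambda>k. (- 1) \<odot> x k \<oplus> x k)"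
      using x completion_add C_smult by blast
    also have "\<dots> = \<zero>\<^bsub>\<C>\<^esub>"
      using x by (simp add: completion_zero smult_minus_one l_neg)
    finally have "cls (\<lambda>k. (- 1) \<odot> x k) \<oplus>\<^bsub>\<C>\<^esub> X = \<zero>\<^bsub>\<C>\<^esub>" .
    then show "\<exists>Y\<in>carrier \<C>. Y \<oplus>\<^bsub>\<C>\<^esub> X = \<zero>\<^bsub>\<C>\<^esub>"
      using x C_smult completion_carrier by blast
  next
    show "\<zero>\<^bsub>\<C>\<^esub> \<in> carrier \<C>" by (simp add: completion_zero completion_carrier C_ops)
  qed
  show "monoid \<C>"
  proof (rule monoidI)
    fix X Y Z assume "X \<in> carrier \<C>" "Y \<in> carrier \<C>" "Z \<in> carrier \<C>"
    then obtain x y z where "x \<in> C" "y \<in> C" "z \<in> C" "X = cls x" "Y = cls y" "Z = cls z"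
      by (metis completion_cases)
    then show "X \<otimes>\<^bsub>\<C>\<^esub> Y \<otimes>\<^bsub>\<C>\<^esub> Z = X \<otimes>\<^bsub>\<C>\<^esub> (Y \<otimes>\<^bsub>\<C>\<^esub> Z)"
      by (simp add: completion_ops C_ops m_assoc)
  next
    fix X Y assume "X \<in> carrier \<C>" "Y \<in> carrier \<C>"
    then obtain x y where xy: "x \<in> C" "y \<in> C" "X = cls x" "Y = cls y"
      by (metis completion_cases)
    then show "X \<otimes>\<^bsub>\<C>\<^esub> Y \<in> carrier \<C>"
      by (simp add: completion_ops C_ops completion_carrier)
  next
    fix X assume "X \<in> carrier \<C>"
    then obtain x where x: "x \<in> C" "X = cls x" by (metis completion_cases)
    then show "\<one>\<^bsub>\<C>\<^esub> \<otimes>\<^bsub>\<C>\<^esub> X = X" "X \<otimes>\<^bsub>\<C>\<^esub> \<one>\<^bsub>\<C>\<^esub> = X" by (simp_all add: completion_ops C_ops)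
  next
    show "\<one>\<^bsub>\<C>\<^esub> \<in> carrier \<C>" by (simp add: completion_one completion_carrier C_ops)
  qed
  fix X Y Z assume "X \<in> carrier \<C>" "Y \<in> carrier \<C>" "Z \<in> carrier \<C>"
  then obtain x y z where "x \<in> C" "y \<in> C" "z \<in> C" "X = cls x" "Y = cls y" "Z = cls z"
    by (metis completion_cases)
  then show "(X \<oplus>\<^bsub>\<C>\<^esub> Y) \<otimes>\<^bsub>\<C>\<^esub> Z = X \<otimes>\<^bsub>\<C>\<^esub> Z \<oplus>\<^bsub>\<C>\<^esub> Y \<otimes>\<^bsub>\<C>\<^esub> Z"
    "Z \<otimes>\<^bsub>\<C>\<^esub> (X \<oplus>\<^bsub>\<C>\<^esub> Y) = Z \<otimes>\<^bsub>\<C>\<^esub> X \<oplus>\<^bsub>\<C>\<^esub> Z \<otimes>\<^bsub>\<C>\<^esub> Y"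
    by (simp_all add: completion_ops C_ops l_distr r_distr)
qed

lemma completion_star_algebra: "star_algebra \<C>"
proof (intro star_algebra.intro completion_ring star_algebra_axioms.intro)
  fix X Y c d assume "X \<in> carrier \<C>" "Y \<in> carrier \<C>"
  then obtain x y where xy: "x \<in> C" "y \<in> C" "X = cls x" "Y = cls y"
    by (metis completion_cases)
  note s = completion_ops C_ops
  show "c \<odot>\<^bsub>\<C>\<^esub> (X \<oplus>\<^bsub>\<C>\<^esub> Y) = c \<odot>\<^bsub>\<C>\<^esub> X \<oplus>\<^bsub>\<C>\<^esub> c \<odot>\<^bsub>\<C>\<^esub> Y"
    using xy by (simp add: s smult_r_distr)
  show "(c \<odot>\<^bsub>\<C>\<^esub> X) \<otimes>\<^bsub>\<C>\<^esub> Y = c \<odot>\<^bsub>\<C>\<^esub> (X \<otimes>\<^bsub>\<C>\<^esub> Y)"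
    using xy by (simp add: s smult_mult_left)
  show "X \<otimes>\<^bsub>\<C>\<^esub> (c \<odot>\<^bsub>\<C>\<^esub> Y) = c \<odot>\<^bsub>\<C>\<^esub> (X \<otimes>\<^bsub>\<C>\<^esub> Y)"
    using xy by (simp add: s smult_mult_right)
  show "\<star>\<^bsub>\<C>\<^esub>(X \<oplus>\<^bsub>\<C>\<^esub> Y) = \<star>\<^bsub>\<C>\<^esub>X \<oplus>\<^bsub>\<C>\<^esub> \<star>\<^bsub>\<C>\<^esub>Y"
    using xy by (simp add: s star_add)
  show "\<star>\<^bsub>\<C>\<^esub>(X \<otimes>\<^bsub>\<C>\<^esub> Y) = \<star>\<^bsub>\<C>\<^esub>Y \<otimes>\<^bsub>\<C>\<^esub> \<star>\<^bsub>\<C>\<^esub>X"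
    using xy by (simp add: s star_mult)
next
  fix X c d assume "X \<in> carrier \<C>"
  then obtain x where x: "x \<in> C" "X = cls x" by (metis completion_cases)
  note s = completion_ops C_ops
  show "c \<odot>\<^bsub>\<C>\<^esub> X \<in> carrier \<C>" "\<star>\<^bsub>\<C>\<^esub>X \<in> carrier \<C>"
    using x by (simp_all add: s completion_carrier)
  show "(c + d) \<odot>\<^bsub>\<C>\<^esub> X = c \<odot>\<^bsub>\<C>\<^esub> X \<oplus>\<^bsub>\<C>\<^esub> d \<odot>\<^bsub>\<C>\<^esub> X"
    using x by (simp add: s smult_l_distr)
  show "(c * d) \<odot>\<^bsub>\<C>\<^esub> X = c \<odot>\<^bsub>\<C>\<^esub> (d \<odot>\<^bsub>\<C>\<^esub> X)"
    using x by (simp add: s smult_assoc)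
  show "1 \<odot>\<^bsub>\<C>\<^esub> X = X" "\<star>\<^bsub>\<C>\<^esub>(\<star>\<^bsub>\<C>\<^esub>X) = X" "\<star>\<^bsub>\<C>\<^esub>(c \<odot>\<^bsub>\<C>\<^esub> X) = cnj c \<odot>\<^bsub>\<C>\<^esub> \<star>\<^bsub>\<C>\<^esub>X"
    using x by (simp_all add: s star_smult)
qed

lemma completion_seminorm: "cstar_seminorm \<C> (nrm \<C>)"
  unfolding cstar_seminorm_def
proof (intro conjI ballI allI)
  fix X c assume "X \<in> carrier \<C>"
  then obtain x where x: "x \<in> C" "X = cls x" by (metis completion_cases)
  show "0 \<le> \<parallel>X\<parallel>\<^bsub>\<C>\<^esub>"
    using LIMSEQ_le_const[OF completion_nrm[OF x(1)], of 0] x by auto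
  show "\<parallel>c \<odot>\<^bsub>\<C>\<^esub> X\<parallel>\<^bsub>\<C>\<^esub> = cmod c * \<parallel>X\<parallel>\<^bsub>\<C>\<^esub>"
    using LIMSEQ_unique[OF completion_nrm[OF C_smult[OF x(1), of c]]
        , of "cmod c * \<parallel>X\<parallel>\<^bsub>\<C>\<^esub>"] tendsto_mult_left[OF completion_nrm[OF x(1)], of "cmod c"] x
    by (simp add: p_smult completion_ops)
  show "\<parallel>\<star>\<^bsub>\<C>\<^esub>X \<otimes>\<^bsub>\<C>\<^esub> X\<parallel>\<^bsub>\<C>\<^esub> = (\<parallel>X\<parallel>\<^bsub>\<C>\<^esub>)\<^sup>2"
    using LIMSEQ_unique[OF completion_nrm[OF C_mult[OF C_star[OF x(1)] x(1)]]
        , of "(\<parallel>X\<parallel>\<^bsub>\<C>\<^esub>)\<^sup>2"] tendsto_power[OF completion_nrm[OF x(1)], of 2] x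
    by (simp add: p_star_mult completion_ops C_ops)
next
  fix X Y assume "X \<in> carrier \<C>" "Y \<in> carrier \<C>"
  then obtain x y where xy: "x \<in> C" "y \<in> C" "X = cls x" "Y = cls y"
    by (metis completion_cases)
  show "\<parallel>X \<oplus>\<^bsub>\<C>\<^esub> Y\<parallel>\<^bsub>\<C>\<^esub> \<le> \<parallel>X\<parallel>\<^bsub>\<C>\<^esub> + \<parallel>Y\<parallel>\<^bsub>\<C>\<^esub>"
    using LIMSEQ_le[OF completion_nrm[OF C_add[OF xy(1,2)]]
        tendsto_add[OF completion_nrm[OF xy(1)] completion_nrm[OF xy(2)]]] xy
    by (auto simp: p_add completion_ops)
  show "\<parallel>X \<otimes>\<^bsub>\<C>\<^esub> Y\<parallel>\<^bsub>\<C>\<^esub> \<le> \<parallel>X\<parallel>\<^bsub>\<C>\<^esub> * \<parallel>Y\<parallel>\<^bsub>\<C>\<^esub>"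
    using LIMSEQ_le[OF completion_nrm[OF C_mult[OF xy(1,2)]]
        tendsto_mult[OF completion_nrm[OF xy(1)] completion_nrm[OF xy(2)]]] xy
    by (auto simp: p_mult completion_ops)
qed

lemma completion_pre: "pre_cstar_algebra \<C>"
  by (simp add: pre_cstar_algebra_def completion_star_algebra
      pre_cstar_algebra_axioms_def completion_seminorm)

lemma completion_diff:
  assumes "x \<in> C" "y \<in> C" shows "cls x \<ominus>\<^bsub>\<C>\<^esub> cls y = cls (\<lambda>k. x k \<ominus> y k)"
  using assms
  by (simp add: star_algebra.minus_eq_smult[OF completion_star_algebra] completion_carrier
      completion_ops C_ops minus_eq_smult)

lemma C_diff: "\<lbrakk>x \<in> C; y \<in> C\<rbrakk> \<Longrightarrow> (\<lambda>k. x k \<ominus> y k) \<in> C"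
  by (simp add: minus_eq_smult C_ops)

lemma embed_closed: "x \<in> carrier A \<Longrightarrow> completion_embed A x \<in> carrier \<C>"
  by (simp add: completion_embed_def completion_carrier C_const)

lemma embed_nrm: "x \<in> carrier A \<Longrightarrow> \<parallel>completion_embed A x\<parallel>\<^bsub>\<C>\<^esub> = \<parallel>x\<parallel>"
  using LIMSEQ_unique[OF completion_nrm[OF C_const[of x]]] by (simp add: completion_embed_def)

lemma embed_hom: "completion_embed A \<in> star_hom A \<C>"
  unfolding star_hom_def ring_hom_def
  by (auto simp: embed_closed) (simp_all add: completion_embed_def completion_ops C_const)

lemma embed_diff:
  "\<lbrakk>x \<in> carrier A; y \<in> carrier A\<rbrakk> \<Longrightarrow>
    completion_embed A x \<ominus>\<^bsub>\<C>\<^esub> completion_embed A y = completion_embed A (x \<ominus> y)"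
  by (simp add: completion_embed_def completion_diff C_const)

lemma embed_lim:
  assumes "x \<in> C" shows "(\<lambda>m. \<parallel>completion_embed A (x m) \<ominus>\<^bsub>\<C>\<^esub> cls x\<parallel>\<^bsub>\<C>\<^esub>) \<longlonglongrightarrow> 0"
proof (rule LIMSEQ_I)
  fix e :: real assume "0 < e"
  then have "0 < e/2" by simp
  then obtain N where N: "\<And>m k. m \<ge> N \<Longrightarrow> k \<ge> N \<Longrightarrow> \<parallel>x m \<ominus> x k\<parallel> < e/2"
    using C_cauchy[OF assms] by blast
  have "\<bar>\<parallel>completion_embed A (x m) \<ominus>\<^bsub>\<C>\<^esub> cls x\<parallel>\<^bsub>\<C>\<^esub>\<bar> < e" if "m \<ge> N" for m
  proof -
    have d: "(\<lambda>k. x m \<ominus> x k) \<in> C" using assms by (simp add: C_diff C_const)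
    have "\<parallel>completion_embed A (x m) \<ominus>\<^bsub>\<C>\<^esub> cls x\<parallel>\<^bsub>\<C>\<^esub> = \<parallel>cls (\<lambda>k. x m \<ominus> x k)\<parallel>\<^bsub>\<C>\<^esub>"
      using assms by (simp add: completion_embed_def completion_diff C_const)
    moreover have "\<parallel>cls (\<lambda>k. x m \<ominus> x k)\<parallel>\<^bsub>\<C>\<^esub> \<le> e/2"
      by (rule LIMSEQ_le_const2[OF completion_nrm[OF d]]) (use N that less_imp_le in blast)
    moreover have "0 \<le> \<parallel>cls (\<lambda>k. x m \<ominus> x k)\<parallel>\<^bsub>\<C>\<^esub>"
      by (rule LIMSEQ_le_const[OF completion_nrm[OF d]]) (use assms in auto)
    ultimately show ?thesis using \<open>0 < e\<close> by simp
  qed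
  then show "\<exists>N. \<forall>m\<ge>N. norm (\<parallel>completion_embed A (x m) \<ominus>\<^bsub>\<C>\<^esub> cls x\<parallel>\<^bsub>\<C>\<^esub> - 0) < e" by auto
qed

lemma embed_dense:
  assumes "X \<in> carrier \<C>" "0 < e"
  obtains x where "x \<in> carrier A" "\<parallel>completion_embed A x \<ominus>\<^bsub>\<C>\<^esub> X\<parallel>\<^bsub>\<C>\<^esub> < e"
proof -
  obtain x where x: "x \<in> C" "X = cls x" using assms completion_cases by metis
  from LIMSEQ_D[OF embed_lim[OF x(1)] assms(2)] obtain m
    where "norm (\<parallel>completion_embed A (x m) \<ominus>\<^bsub>\<C>\<^esub> cls x\<parallel>\<^bsub>\<C>\<^esub> - 0) < e" by blast
  then show thesis using that[of "x m"] x by auto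
qed

lemma completion_nrm_eq_0: assumes "X \<in> carrier \<C>" "\<parallel>X\<parallel>\<^bsub>\<C>\<^esub> = 0" shows "X = \<zero>\<^bsub>\<C>\<^esub>"
proof -
  obtain x where x: "x \<in> C" "X = cls x" using assms completion_cases by metis
  have "(\<lambda>k. \<parallel>x k \<ominus> \<zero>\<parallel>) \<longlonglongrightarrow> 0"
    using completion_nrm[OF x(1)] assms x by (simp add: minus_eq)
  then show ?thesis using x cls_eqI[of x "\<lambda>k. \<zero>"] by (simp add: completion_zero C_const)
qed

lemma completion_complete:
  assumes X: "\<And>k. X k \<in> carrier \<C>"
    and cau: "\<And>e. 0 < e \<Longrightarrow> \<exists>N. \<forall>m\<ge>N. \<forall>k\<ge>N. \<parallel>X m \<ominus>\<^bsub>\<C>\<^esub> X k\<parallel>\<^bsub>\<C>\<^esub> < e"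
  obtains L where "L \<in> carrier \<C>" "(\<lambda>k. \<parallel>X k \<ominus>\<^bsub>\<C>\<^esub> L\<parallel>\<^bsub>\<C>\<^esub>) \<longlonglongrightarrow> 0"
proof -
  interpret CC: pre_cstar_algebra \<C> by (rule completion_pre)
  have "\<forall>k. \<exists>y. y \<in> carrier A \<and> \<parallel>completion_embed A y \<ominus>\<^bsub>\<C>\<^esub> X k\<parallel>\<^bsub>\<C>\<^esub> < 1 / real (Suc k)"
    using embed_dense[OF X] by (metis of_nat_0_less_iff zero_less_Suc zero_less_divide_1_iff)
  then obtain y where y: "\<And>k. y k \<in> carrier A"
    and yX: "\<And>k. \<parallel>completion_embed A (y k) \<ominus>\<^bsub>\<C>\<^esub> X k\<parallel>\<^bsub>\<C>\<^esub> < 1 / real (Suc k)" by metis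
  let ?y = "\<lambda>k. completion_embed A (y k)"
  have yc: "?y k \<in> carrier \<C>" for k using y embed_closed by simp
  have inv: "(\<lambda>k. 1 / real (Suc k)) \<longlonglongrightarrow> 0" using LIMSEQ_inverse_real_of_nat by (simp add: inverse_eq_divide)
  have yC: "y \<in> C"
  proof (rule C_I)
    fix e :: real assume "0 < e"
    then have e3: "0 < e/3" by simp
    obtain N where N: "\<And>m k. m \<ge> N \<Longrightarrow> k \<ge> N \<Longrightarrow> \<parallel>X m \<ominus>\<^bsub>\<C>\<^esub> X k\<parallel>\<^bsub>\<C>\<^esub> < e/3" using cau[OF e3] by blast
    obtain M where M: "\<And>k. k \<ge> M \<Longrightarrow> 1 / real (Suc k) < e/3"
      using LIMSEQ_D[OF inv e3] by auto
    have "\<parallel>y m \<ominus> y k\<parallel> < e" if "m \<ge> max N M" "k \<ge> max N M" for m k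
    proof -
      have "\<parallel>y m \<ominus> y k\<parallel> = \<parallel>?y m \<ominus>\<^bsub>\<C>\<^esub> ?y k\<parallel>\<^bsub>\<C>\<^esub>" using y by (simp add: embed_diff embed_nrm)
      also have "\<dots> \<le> \<parallel>?y m \<ominus>\<^bsub>\<C>\<^esub> X m\<parallel>\<^bsub>\<C>\<^esub> + \<parallel>X m \<ominus>\<^bsub>\<C>\<^esub> ?y k\<parallel>\<^bsub>\<C>\<^esub>"
        using yc X by (intro CC.p_triangle)
      also have "\<parallel>X m \<ominus>\<^bsub>\<C>\<^esub> ?y k\<parallel>\<^bsub>\<C>\<^esub> \<le> \<parallel>X m \<ominus>\<^bsub>\<C>\<^esub> X k\<parallel>\<^bsub>\<C>\<^esub> + \<parallel>X k \<ominus>\<^bsub>\<C>\<^esub> ?y k\<parallel>\<^bsub>\<C>\<^esub>"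
        using yc X by (intro CC.p_triangle)
      also have "\<parallel>X k \<ominus>\<^bsub>\<C>\<^esub> ?y k\<parallel>\<^bsub>\<C>\<^esub> = \<parallel>?y k \<ominus>\<^bsub>\<C>\<^esub> X k\<parallel>\<^bsub>\<C>\<^esub>"
        using yc X by (intro CC.p_minus_commute)
      finally show ?thesis
        using N[of m k] M[of m] M[of k] yX[of m] yX[of k] that by simp
    qed
    then show "\<exists>N. \<forall>m\<ge>N. \<forall>k\<ge>N. \<parallel>y m \<ominus> y k\<parallel> < e" by blast
  qed (rule y)
  have L: "cls y \<in> carrier \<C>" using yC by (simp add: completion_carrier)
  have "(\<lambda>k. \<parallel>X k \<ominus>\<^bsub>\<C>\<^esub> cls y\<parallel>\<^bsub>\<C>\<^esub>) \<longlonglongrightarrow> 0"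
  proof (rule tendsto_sandwich[OF _ _ tendsto_const])
    show "\<forall>\<^sub>F k in sequentially.
        \<parallel>X k \<ominus>\<^bsub>\<C>\<^esub> cls y\<parallel>\<^bsub>\<C>\<^esub> \<le> 1 / real (Suc k) + \<parallel>?y k \<ominus>\<^bsub>\<C>\<^esub> cls y\<parallel>\<^bsub>\<C>\<^esub>"
    proof (intro always_eventually allI)
      fix k
      have "\<parallel>X k \<ominus>\<^bsub>\<C>\<^esub> cls y\<parallel>\<^bsub>\<C>\<^esub> \<le> \<parallel>X k \<ominus>\<^bsub>\<C>\<^esub> ?y k\<parallel>\<^bsub>\<C>\<^esub> + \<parallel>?y k \<ominus>\<^bsub>\<C>\<^esub> cls y\<parallel>\<^bsub>\<C>\<^esub>"
        using yc X L by (intro CC.p_triangle)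
      then show "\<parallel>X k \<ominus>\<^bsub>\<C>\<^esub> cls y\<parallel>\<^bsub>\<C>\<^esub> \<le> 1 / real (Suc k) + \<parallel>?y k \<ominus>\<^bsub>\<C>\<^esub> cls y\<parallel>\<^bsub>\<C>\<^esub>"
        using yX[of k] CC.p_minus_commute[OF X yc, of k k] by linarith
    qed
    show "(\<lambda>k. 1 / real (Suc k) + \<parallel>?y k \<ominus>\<^bsub>\<C>\<^esub> cls y\<parallel>\<^bsub>\<C>\<^esub>) \<longlonglongrightarrow> 0"
      using tendsto_add[OF inv embed_lim[OF yC]] by simp
  qed (use X L in auto)
  with L show thesis by (rule that)
qed

end

lemma mcomplete_iff_sequences:
  assumes "pre_cstar_algebra A" "\<And>x. x \<in> carrier A \<Longrightarrow> \<parallel>x\<parallel>\<^bsub>A\<^esub> = 0 \<Longrightarrow> x = \<zero>\<^bsub>A\<^esub>"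
  shows "Metric_space.mcomplete (carrier A) (nrm_dist A) \<longleftrightarrow>
    (\<forall>x. x \<in> cauchy_seqs A \<longrightarrow> (\<exists>l\<in>carrier A. (\<lambda>k. \<parallel>x k \<ominus>\<^bsub>A\<^esub> l\<parallel>\<^bsub>A\<^esub>) \<longlonglongrightarrow> 0))"
proof -
  interpret pre_cstar_algebra A by fact
  interpret M: Metric_space "carrier A" "nrm_dist A"
  proof
    show "0 \<le> nrm_dist A x y" for x y by (simp add: nrm_dist_def)
    show "nrm_dist A x y = nrm_dist A y x" for x y
      using p_minus_commute[of x y] by (simp add: nrm_dist_def)
    show "(nrm_dist A x y = 0) = (x = y)" if "x \<in> carrier A" "y \<in> carrier A" for x y
      using that assms(2)[of "x \<ominus>\<^bsub>A\<^esub> y"] minus_eq_zero_iff[OF that]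
      by (auto simp: nrm_dist_def)
    show "nrm_dist A x z \<le> nrm_dist A x y + nrm_dist A y z"
      if "x \<in> carrier A" "y \<in> carrier A" "z \<in> carrier A" for x y z
      using that p_triangle[of x y z] by (simp add: nrm_dist_def)
  qed
  have 1: "M.MCauchy x \<longleftrightarrow> x \<in> cauchy_seqs A" for x
    unfolding M.MCauchy_def cauchy_seqs_def
    by (auto simp: nrm_dist_def image_subset_iff; meson)
  have 2: "limitin M.mtopology x l sequentially \<longleftrightarrow>
      l \<in> carrier A \<and> (\<lambda>k. \<parallel>x k \<ominus>\<^bsub>A\<^esub> l\<parallel>\<^bsub>A\<^esub>) \<longlonglongrightarrow> 0" if "x \<in> cauchy_seqs A" for x l
  proof -
    have "x k \<in> carrier A" for k using that by (simp add: cauchy_seqs_def)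
    then show ?thesis
      by (auto simp: M.limit_metric_sequentially LIMSEQ_iff nrm_dist_def)
  qed
  show ?thesis unfolding M.mcomplete_def using 1 2 by blast
qed

lemma (in completing) completion_cstar_algebra: "cstar_algebra \<C>"
proof (intro cstar_algebra.intro completion_pre cstar_algebra_axioms.intro completion_nrm_eq_0)
  show "Metric_space.mcomplete (carrier \<C>) (nrm_dist \<C>)"
  proof (rule mcomplete_iff_sequences[OF completion_pre, THEN iffD2], rule completion_nrm_eq_0, assumption+, intro allI impI)
    fix X assume "X \<in> cauchy_seqs \<C>"
    then have "\<And>k. X k \<in> carrier \<C>"
      "\<And>e. 0 < e \<Longrightarrow> \<exists>N. \<forall>m\<ge>N. \<forall>k\<ge>N. \<parallel>X m \<ominus>\<^bsub>\<C>\<^esub> X k\<parallel>\<^bsub>\<C>\<^esub> < e"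
      unfolding cauchy_seqs_def by blast+
    then show "\<exists>l\<in>carrier \<C>. (\<lambda>k. \<parallel>X k \<ominus>\<^bsub>\<C>\<^esub> l\<parallel>\<^bsub>\<C>\<^esub>) \<longlonglongrightarrow> 0"
      using completion_complete by metis
  qed
qed

section \<open>Enveloping \<open>C\<^sup>*\<close>-algebra\<close>

text \<open>The completion of a \<open>*\<close>-algebra with respect to its largest \<open>C\<^sup>*\<close>-seminorm. The norm already
  present in the record is ignored.\<close>

definition envelope_norm :: "('a, 'm) normed_star_scheme \<Rightarrow> 'a \<Rightarrow> real" where
  "envelope_norm A x = (SUP p\<in>{p. cstar_seminorm A p}. p x)"

definition cstar_envelope :: "'a normed_star \<Rightarrow> (nat \<Rightarrow> 'a) set normed_star" where
  "cstar_envelope A = completion (A\<lparr>nrm := envelope_norm A\<rparr>)"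

definition envelope_embed :: "'a normed_star \<Rightarrow> 'a \<Rightarrow> (nat \<Rightarrow> 'a) set" where
  "envelope_embed A = completion_embed (A\<lparr>nrm := envelope_norm A\<rparr>)"

lemma ring_nrm_update: "ring A \<Longrightarrow> ring (A\<lparr>nrm := q\<rparr>)"
proof -
  assume "ring A"
  then interpret ring A .
  show ?thesis
  proof (rule ringI)
    show "abelian_group (A\<lparr>nrm := q\<rparr>)"
      by (rule abelian_groupI) (auto simp: a_ac intro: l_neg)
    show "monoid (A\<lparr>nrm := q\<rparr>)"
      by (rule monoidI) (auto simp: m_assoc)
  qed (auto simp: l_distr r_distr)
qed

lemma star_algebra_nrm_update: "star_algebra A \<Longrightarrow> star_algebra (A\<lparr>nrm := q\<rparr>)"
proof -
  assume "star_algebra A"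
  then interpret star_algebra A .
  show ?thesis
    by (intro star_algebra.intro ring_nrm_update ring_axioms star_algebra_axioms.intro)
      (auto simp: smult_l_distr smult_r_distr smult_assoc smult_mult_left smult_mult_right
        star_add star_smult star_mult)
qed

lemma cstar_seminorm_nrm_update [simp]: "cstar_seminorm (A\<lparr>nrm := q\<rparr>) = cstar_seminorm A"
  by (simp add: fun_eq_iff cstar_seminorm_def)

lemma star_hom_nrm_update [simp]: "star_hom (A\<lparr>nrm := q\<rparr>) B = star_hom A B"
  by (simp add: star_hom_def ring_hom_def)

lemma star_hom_pullback:
  assumes "\<phi> \<in> star_hom A B" "cstar_seminorm B p" "star_algebra A"
  shows "cstar_seminorm A (\<lambda>x. p (\<phi> x))"
proof -
  interpret star_algebra A by fact
  have cl: "\<And>x. x \<in> carrier A \<Longrightarrow> \<phi> x \<in> carrier B"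
    using assms by (auto simp: star_hom_def ring_hom_def)
  show ?thesis
    using assms(1,2) cl
    by (auto simp: cstar_seminorm_def star_hom_def ring_hom_add ring_hom_mult)
qed

locale enveloping = star_algebra A for A :: "'a normed_star" (structure) +
  assumes bounded: "x \<in> carrier A \<Longrightarrow> \<exists>b. \<forall>p. cstar_seminorm A p \<longrightarrow> p x \<le> b"
begin

lemma zero_seminorm: "cstar_seminorm A (\<lambda>x. 0)"
  by (simp add: cstar_seminorm_def)

lemma seminorm_le: "cstar_seminorm A p \<Longrightarrow> x \<in> carrier A \<Longrightarrow> p x \<le> envelope_norm A x"
  unfolding envelope_norm_def
  by (rule cSUP_upper) (use bounded in \<open>auto simp: bdd_above_def\<close>)

lemma envelope_le:
  "(\<And>p. cstar_seminorm A p \<Longrightarrow> p x \<le> b) \<Longrightarrow> envelope_norm A x \<le> b"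
  unfolding envelope_norm_def by (rule cSUP_least) (use zero_seminorm in auto)

lemma envelope_seminorm: "cstar_seminorm A (envelope_norm A)"
  unfolding cstar_seminorm_def
proof (intro conjI ballI allI)
  let ?N = "envelope_norm A"
  fix x assume x: "x \<in> carrier A"
  show N0: "0 \<le> ?N x" using seminorm_le[OF zero_seminorm x] .
  show "?N (c \<odot> x) = cmod c * ?N x" for c
  proof (rule antisym)
    show "?N (c \<odot> x) \<le> cmod c * ?N x"
      by (rule envelope_le) (use x seminorm_le in \<open>auto simp: cstar_seminorm_def mult_left_mono\<close>)
    show "cmod c * ?N x \<le> ?N (c \<odot> x)"
    proof (cases "c = 0")
      case True
      then show ?thesis using seminorm_le[OF zero_seminorm, of "c \<odot> x"] x by simp
    next
      case False
      have "?N x \<le> ?N (c \<odot> x) / cmod c"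
      proof (rule envelope_le)
        fix p assume p: "cstar_seminorm A p"
        then have "cmod c * p x = p (c \<odot> x)" using x by (simp add: cstar_seminorm_def)
        also have "\<dots> \<le> ?N (c \<odot> x)" using p x by (simp add: seminorm_le)
        finally show "p x \<le> ?N (c \<odot> x) / cmod c" using False by (simp add: field_simps)
      qed
      then show ?thesis using False by (simp add: field_simps)
    qed
  qed
  show "?N (\<star>x \<otimes> x) = (?N x)\<^sup>2"
  proof (rule antisym)
    show "?N (\<star>x \<otimes> x) \<le> (?N x)\<^sup>2"
      by (rule envelope_le) (use x seminorm_le in \<open>auto simp: cstar_seminorm_def power_mono\<close>)
    have "?N x \<le> sqrt (?N (\<star>x \<otimes> x))"
    proof (rule envelope_le)
      fix p assume p: "cstar_seminorm A p"
      then have "(p x)\<^sup>2 = p (\<star>x \<otimes> x)" using x by (simp add: cstar_seminorm_def)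
      also have "\<dots> \<le> ?N (\<star>x \<otimes> x)" using p x by (simp add: seminorm_le)
      finally show "p x \<le> sqrt (?N (\<star>x \<otimes> x))" by (rule real_le_rsqrt)
    qed
    then have "(?N x)\<^sup>2 \<le> (sqrt (?N (\<star>x \<otimes> x)))\<^sup>2" using N0 by (rule power_mono)
    also have "\<dots> = ?N (\<star>x \<otimes> x)"
      using seminorm_le[OF zero_seminorm, of "\<star>x \<otimes> x"] x by simp
    finally show "(?N x)\<^sup>2 \<le> ?N (\<star>x \<otimes> x)" .
  qed
next
  let ?N = "envelope_norm A"
  fix x y assume xy: "x \<in> carrier A" "y \<in> carrier A"
  have N0: "0 \<le> ?N x" "0 \<le> ?N y" using seminorm_le[OF zero_seminorm] xy by auto
  show "?N (x \<oplus> y) \<le> ?N x + ?N y"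
  proof (rule envelope_le)
    fix p assume p: "cstar_seminorm A p"
    then have "p (x \<oplus> y) \<le> p x + p y" using xy by (simp add: cstar_seminorm_def)
    then show "p (x \<oplus> y) \<le> ?N x + ?N y"
      using seminorm_le[OF p xy(1)] seminorm_le[OF p xy(2)] by linarith
  qed
  show "?N (x \<otimes> y) \<le> ?N x * ?N y"
  proof (rule envelope_le)
    fix p assume p: "cstar_seminorm A p"
    then have "p (x \<otimes> y) \<le> p x * p y" using xy by (simp add: cstar_seminorm_def)
    also have "\<dots> \<le> ?N x * ?N y"
      using p xy seminorm_le[OF p] N0 by (intro mult_mono) (auto simp: cstar_seminorm_def)
    finally show "p (x \<otimes> y) \<le> ?N x * ?N y" .
  qed
qed

abbreviation A' where "A' \<equiv> A\<lparr>nrm := envelope_norm A\<rparr>"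

sublocale E: completing "A'"
  by (intro completing.intro pre_cstar_algebra.intro star_algebra_nrm_update star_algebra_axioms
      pre_cstar_algebra_axioms.intro)
    (simp add: envelope_seminorm)

lemma envelope_cstar_algebra: "cstar_algebra (cstar_envelope A)"
  unfolding cstar_envelope_def by (rule E.completion_cstar_algebra)

lemma envelope_embed_hom: "envelope_embed A \<in> star_hom A (cstar_envelope A)"
  using E.embed_hom by (simp add: envelope_embed_def cstar_envelope_def)

lemma envelope_embed_nrm:
  "x \<in> carrier A \<Longrightarrow> \<parallel>envelope_embed A x\<parallel>\<^bsub>cstar_envelope A\<^esub> = envelope_norm A x"
  using E.embed_nrm[of x] by (simp add: envelope_embed_def cstar_envelope_def)

lemma envelope_embed_dense:
  assumes "X \<in> carrier (cstar_envelope A)" "0 < e"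
  obtains x where "x \<in> carrier A"
    "\<parallel>envelope_embed A x \<ominus>\<^bsub>cstar_envelope A\<^esub> X\<parallel>\<^bsub>cstar_envelope A\<^esub> < e"
  using E.embed_dense[of X e] assms by (auto simp: envelope_embed_def cstar_envelope_def)

lemma envelope_extend:
  fixes B :: "'b normed_star"
  assumes "cstar_algebra B" "\<pi> \<in> star_hom A B"
  obtains \<phi> where "\<phi> \<in> star_hom (cstar_envelope A) B"
    "\<And>x. x \<in> carrier A \<Longrightarrow> \<phi> (envelope_embed A x) = \<pi> x"
proof -
  interpret B: cstar_algebra B by fact
  interpret BC: completing B by unfold_locales
  interpret BCC: pre_cstar_algebra "completion B" by (rule BC.completion_pre)
  have pcl: "\<pi> x \<in> carrier B" if "x \<in> carrier A" for x
    using assms(2) that by (auto simp: star_hom_def ring_hom_def)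
  have padd: "\<pi> (x \<oplus> y) = \<pi> x \<oplus>\<^bsub>B\<^esub> \<pi> y" and pmult: "\<pi> (x \<otimes> y) = \<pi> x \<otimes>\<^bsub>B\<^esub> \<pi> y"
    if "x \<in> carrier A" "y \<in> carrier A" for x y
    using assms(2) that by (auto simp: star_hom_def ring_hom_def)
  have psm: "\<pi> (c \<odot> x) = c \<odot>\<^bsub>B\<^esub> \<pi> x" and pst: "\<pi> (\<star>x) = \<star>\<^bsub>B\<^esub>(\<pi> x)"
    if "x \<in> carrier A" for c x
    using assms(2) that by (auto simp: star_hom_def)
  have pone: "\<pi> \<one> = \<one>\<^bsub>B\<^esub>" using assms(2) by (auto simp: star_hom_def ring_hom_def)
  have pdiff: "\<pi> x \<ominus>\<^bsub>B\<^esub> \<pi> y = \<pi> (x \<oplus> (- 1) \<odot> y)" if "x \<in> carrier A" "y \<in> carrier A" for x y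
    using that by (simp add: padd psm B.minus_eq_smult pcl)
  have ple: "\<parallel>\<pi> x\<parallel>\<^bsub>B\<^esub> \<le> envelope_norm A x" if "x \<in> carrier A" for x
    by (rule seminorm_le[OF star_hom_pullback[OF assms(2) B.seminorm star_algebra_axioms] that])
  have dle: "\<parallel>\<pi> x \<ominus>\<^bsub>B\<^esub> \<pi> y\<parallel>\<^bsub>B\<^esub> \<le> \<parallel>x \<ominus>\<^bsub>A'\<^esub> y\<parallel>\<^bsub>A'\<^esub>"
    if "x \<in> carrier A" "y \<in> carrier A" for x y
    using that ple[of "x \<oplus> (- 1) \<odot> y"] E.minus_eq_smult[of x y] by (simp add: pdiff)
  have car: "x k \<in> carrier A" if "x \<in> E.C" for x k using E.C_carrier[OF that] by simp
  have pC: "(\<lambda>k. \<pi> (x k)) \<in> BC.C" if "x \<in> E.C" for x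
  proof (rule BC.C_I)
    fix e :: real assume "0 < e"
    then obtain N where N: "\<And>m k. m \<ge> N \<Longrightarrow> k \<ge> N \<Longrightarrow> \<parallel>x m \<ominus>\<^bsub>A'\<^esub> x k\<parallel>\<^bsub>A'\<^esub> < e"
      using E.C_cauchy[OF \<open>x \<in> E.C\<close>] by blast
    have "\<parallel>\<pi> (x m) \<ominus>\<^bsub>B\<^esub> \<pi> (x k)\<parallel>\<^bsub>B\<^esub> < e" if "m \<ge> N" "k \<ge> N" for m k
      using dle[of "x m" "x k"] N[OF that] car[OF \<open>x \<in> E.C\<close>] by fastforce
    then show "\<exists>N. \<forall>m\<ge>N. \<forall>k\<ge>N. \<parallel>\<pi> (x m) \<ominus>\<^bsub>B\<^esub> \<pi> (x k)\<parallel>\<^bsub>B\<^esub> < e" by blast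
  qed (use that pcl car in auto)
  have wd: "BC.cls (\<lambda>k. \<pi> (x k)) = BC.cls (\<lambda>k. \<pi> (y k))"
    if "x \<in> E.C" "y \<in> E.C" "E.cls x = E.cls y" for x y
  proof (rule BC.cls_eqI[OF pC pC])
    show "(\<lambda>k. \<parallel>\<pi> (x k) \<ominus>\<^bsub>B\<^esub> \<pi> (y k)\<parallel>\<^bsub>B\<^esub>) \<longlonglongrightarrow> 0"
    proof (rule tendsto_sandwich[OF _ _ tendsto_const E.cls_eqD[OF that]])
      show "\<forall>\<^sub>F k in sequentially. \<parallel>\<pi> (x k) \<ominus>\<^bsub>B\<^esub> \<pi> (y k)\<parallel>\<^bsub>B\<^esub> \<le> \<parallel>x k \<ominus>\<^bsub>A'\<^esub> y k\<parallel>\<^bsub>A'\<^esub>"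
        using dle car that by (intro always_eventually allI) blast
    qed (use car pcl that in auto)
  qed fact+
  have surj: "\<exists>l\<in>carrier B. completion_embed B l = BC.cls y" if y: "y \<in> BC.C" for y
  proof -
    obtain l where l: "l \<in> carrier B" "(\<lambda>k. \<parallel>y k \<ominus>\<^bsub>B\<^esub> l\<parallel>\<^bsub>B\<^esub>) \<longlonglongrightarrow> 0"
      using B.complete y mcomplete_iff_sequences[OF B.pre_cstar_algebra_axioms B.nrm_eq_0] by blast
    then have "BC.cls y = BC.cls (\<lambda>k. l)" using y BC.C_const by (intro BC.cls_eqI) auto
    then show ?thesis using l by (auto simp: completion_embed_def)
  qed
  have inj: "x = y"
    if "x \<in> carrier B" "y \<in> carrier B" "completion_embed B x = completion_embed B y" for x y
  proof -
    have "completion_embed B (x \<ominus>\<^bsub>B\<^esub> y) = \<zero>\<^bsub>completion B\<^esub>"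
      using that BC.embed_diff[of x y] BC.embed_closed[of y] by simp
    then have "\<parallel>x \<ominus>\<^bsub>B\<^esub> y\<parallel>\<^bsub>B\<^esub> = 0" using BC.embed_nrm[of "x \<ominus>\<^bsub>B\<^esub> y"] that BCC.p_zero by simp
    then show ?thesis
      using B.nrm_eq_0[OF B.minus_closed[OF that(1,2)]] B.minus_eq_zero_iff[OF that(1,2)] by simp
  qed
  define \<phi> where "\<phi> X =
    (SOME l. l \<in> carrier B \<and> completion_embed B l = BC.cls (\<lambda>k. \<pi> (cauchy_rep X k)))" for X
  have phi: "\<phi> (E.cls x) \<in> carrier B \<and> completion_embed B (\<phi> (E.cls x)) = BC.cls (\<lambda>k. \<pi> (x k))"
    if x: "x \<in> E.C" for x
  proof -
    have "\<phi> (E.cls x) \<in> carrier B \<and>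
        completion_embed B (\<phi> (E.cls x)) = BC.cls (\<lambda>k. \<pi> (cauchy_rep (E.cls x) k))"
      unfolding \<phi>_def by (rule someI_ex) (use surj[OF pC[OF E.rep_C[OF x]]] in blast)
    then show ?thesis using wd[OF E.rep_C[OF x] x E.cls_rep[OF x]] by simp
  qed
  note emb = BC.embed_hom[unfolded star_hom_def ring_hom_def, simplified]
  have phiI: "\<phi> (E.cls x) = l"
    if "x \<in> E.C" "l \<in> carrier B" "completion_embed B l = BC.cls (\<lambda>k. \<pi> (x k))" for x l
    using phi[OF that(1)] that inj by simp
  have hom: "\<phi> \<in> star_hom E.\<C> B"
    unfolding star_hom_def ring_hom_def
  proof (intro CollectI conjI ballI allI funcsetI impI; (elim conjE)?)
    show "\<phi> \<one>\<^bsub>E.\<C>\<^esub> = \<one>\<^bsub>B\<^esub>"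
      unfolding E.completion_one
      by (rule phiI) (use E.C_const[of \<one>] in \<open>auto simp: pone completion_embed_def\<close>)
  next
    fix X c assume "X \<in> carrier E.\<C>"
    then obtain x where x: "x \<in> E.C" "X = E.cls x" by (metis E.completion_cases)
    then show "\<phi> X \<in> carrier B" using phi by simp
    show "\<phi> (c \<odot>\<^bsub>E.\<C>\<^esub> X) = c \<odot>\<^bsub>B\<^esub> \<phi> X"
      unfolding x(2) E.completion_smult[OF x(1)]
    proof (rule phiI[OF E.C_smult[OF x(1)]])
      show "completion_embed B (c \<odot>\<^bsub>B\<^esub> \<phi> (E.cls x)) = BC.cls (\<lambda>k. \<pi> (c \<odot>\<^bsub>A'\<^esub> x k))"
        using emb phi[OF x(1)] BC.completion_smult[OF pC[OF x(1)]] car[OF x(1)] by (simp add: psm)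
    qed (use phi x in auto)
    show "\<phi> (\<star>\<^bsub>E.\<C>\<^esub>X) = \<star>\<^bsub>B\<^esub>(\<phi> X)"
      unfolding x(2) E.completion_star[OF x(1)]
    proof (rule phiI[OF E.C_star[OF x(1)]])
      show "completion_embed B (\<star>\<^bsub>B\<^esub>(\<phi> (E.cls x))) = BC.cls (\<lambda>k. \<pi> (\<star>\<^bsub>A'\<^esub>(x k)))"
        using emb phi[OF x(1)] BC.completion_star[OF pC[OF x(1)]] car[OF x(1)] by (simp add: pst)
    qed (use phi x in auto)
  next
    fix X Y assume "X \<in> carrier E.\<C>" "Y \<in> carrier E.\<C>"
    then obtain x y where xy: "x \<in> E.C" "y \<in> E.C" "X = E.cls x" "Y = E.cls y"
      by (metis E.completion_cases)
    show "\<phi> (X \<otimes>\<^bsub>E.\<C>\<^esub> Y) = \<phi> X \<otimes>\<^bsub>B\<^esub> \<phi> Y"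
      unfolding xy(3,4) E.completion_mult[OF xy(1,2)]
    proof (rule phiI[OF E.C_mult[OF xy(1,2)]])
      show "completion_embed B (\<phi> (E.cls x) \<otimes>\<^bsub>B\<^esub> \<phi> (E.cls y)) = BC.cls (\<lambda>k. \<pi> (x k \<otimes>\<^bsub>A'\<^esub> y k))"
        using emb phi[OF xy(1)] phi[OF xy(2)] BC.completion_mult[OF pC[OF xy(1)] pC[OF xy(2)]]
          car[OF xy(1)] car[OF xy(2)] by (simp add: pmult)
    qed (use phi xy in auto)
    show "\<phi> (X \<oplus>\<^bsub>E.\<C>\<^esub> Y) = \<phi> X \<oplus>\<^bsub>B\<^esub> \<phi> Y"
      unfolding xy(3,4) E.completion_add[OF xy(1,2)]
    proof (rule phiI[OF E.C_add[OF xy(1,2)]])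
      show "completion_embed B (\<phi> (E.cls x) \<oplus>\<^bsub>B\<^esub> \<phi> (E.cls y)) = BC.cls (\<lambda>k. \<pi> (x k \<oplus>\<^bsub>A'\<^esub> y k))"
        using emb phi[OF xy(1)] phi[OF xy(2)] BC.completion_add[OF pC[OF xy(1)] pC[OF xy(2)]]
          car[OF xy(1)] car[OF xy(2)] by (simp add: padd)
    qed (use phi xy in auto)
  qed
  have "\<phi> (envelope_embed A x) = \<pi> x" if "x \<in> carrier A" for x
    unfolding envelope_embed_def completion_embed_def
    by (rule phiI) (use that E.C_const[of x] pcl in \<open>auto simp: completion_embed_def\<close>)
  then show thesis using hom that by (simp add: cstar_envelope_def)
qed

end

section \<open>Full twisted group \<open>C\<^sup>*\<close>-algebras\<close>

definition two_cocycle :: "('g, 'm) monoid_scheme \<Rightarrow> ('g \<Rightarrow> 'g \<Rightarrow> complex) \<Rightarrow> bool" where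
  "two_cocycle G \<sigma> \<longleftrightarrow>
     (\<forall>r\<in>carrier G. \<forall>s\<in>carrier G. cmod (\<sigma> r s) = 1) \<and>
     (\<forall>r\<in>carrier G. \<forall>s\<in>carrier G. \<forall>t\<in>carrier G.
        \<sigma> r s * \<sigma> (r \<otimes>\<^bsub>G\<^esub> s) t = \<sigma> r (s \<otimes>\<^bsub>G\<^esub> t) * \<sigma> s t) \<and>
     (\<forall>r\<in>carrier G. \<sigma> r \<one>\<^bsub>G\<^esub> = 1 \<and> \<sigma> \<one>\<^bsub>G\<^esub> r = 1)"

text \<open>Finitely supported functions with twisted convolution and involution, so that
  \<open>\<delta>\<^sub>r\<delta>\<^sub>s = \<sigma>(r,s)\<delta>\<^sub>r\<^sub>s\<close> and \<open>\<delta>\<^sub>r\<close> is unitary. The norm is the \<open>\<ell>\<^sup>1\<close>-norm; the enveloping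
  \<open>C\<^sup>*\<close>-algebra does not depend on it.\<close>

definition twisted_group_algebra ::
  "('g, 'm) monoid_scheme \<Rightarrow> ('g \<Rightarrow> 'g \<Rightarrow> complex) \<Rightarrow> ('g \<Rightarrow> complex) normed_star" where
  "twisted_group_algebra G \<sigma> = \<lparr>
     carrier = {f. finite {r. f r \<noteq> 0} \<and> {r. f r \<noteq> 0} \<subseteq> carrier G},
     monoid.mult = (\<lambda>f h t. if t \<in> carrier G then
       (\<Sum>r | f r \<noteq> 0. f r * h (inv\<^bsub>G\<^esub> r \<otimes>\<^bsub>G\<^esub> t) * \<sigma> r (inv\<^bsub>G\<^esub> r \<otimes>\<^bsub>G\<^esub> t)) else 0),
     one = (\<lambda>t. if t = \<one>\<^bsub>G\<^esub> then 1 else 0),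
     zero = (\<lambda>t. 0),
     add = (\<lambda>f h t. f t + h t),
     smult = (\<lambda>c f t. c * f t),
     star = (\<lambda>f t. if t \<in> carrier G then cnj (f (inv\<^bsub>G\<^esub> t) * \<sigma> (inv\<^bsub>G\<^esub> t) t) else 0),
     nrm = (\<lambda>f. \<Sum>r | f r \<noteq> 0. cmod (f r))\<rparr>"

text \<open>The universal \<open>C\<^sup>*\<close>-algebra generated by unitaries \<open>i r\<close> with
  \<open>i r i s = \<sigma>(r,s) i(rs)\<close>: see \<open>twisted_cstar_algebra\<close>, \<open>twisted_unitary_unitary\<close>,
  \<open>twisted_unitary_mult\<close>, \<open>twisted_unitary_generate\<close> and \<open>twisted_group_cstar_universal\<close> below.\<close>

definition twisted_group_cstar ::
  "('g, 'm) monoid_scheme \<Rightarrow> ('g \<Rightarrow> 'g \<Rightarrow> complex) \<Rightarrow> (nat \<Rightarrow> 'g \<Rightarrow> complex) set normed_star" where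
  "twisted_group_cstar G \<sigma> = cstar_envelope (twisted_group_algebra G \<sigma>)"

definition delta :: "'g \<Rightarrow> 'g \<Rightarrow> complex" where
  "delta r t = (if t = r then 1 else 0)"

definition twisted_unitary ::
  "('g, 'm) monoid_scheme \<Rightarrow> ('g \<Rightarrow> 'g \<Rightarrow> complex) \<Rightarrow> 'g \<Rightarrow> (nat \<Rightarrow> 'g \<Rightarrow> complex) set" where
  "twisted_unitary G \<sigma> r = envelope_embed (twisted_group_algebra G \<sigma>) (delta r)"

locale twisted_group = group G for G :: "('g, 'm) monoid_scheme" (structure) +
  fixes \<sigma> :: "'g \<Rightarrow> 'g \<Rightarrow> complex"
  assumes cocycle: "two_cocycle G \<sigma>"
begin

lemma sigma_norm: "r \<in> carrier G \<Longrightarrow> s \<in> carrier G \<Longrightarrow> cmod (\<sigma> r s) = 1"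
  and sigma_assoc: "r \<in> carrier G \<Longrightarrow> s \<in> carrier G \<Longrightarrow> t \<in> carrier G \<Longrightarrow>
        \<sigma> r s * \<sigma> (r \<otimes> s) t = \<sigma> r (s \<otimes> t) * \<sigma> s t"
  and sigma_one_right [simp]: "r \<in> carrier G \<Longrightarrow> \<sigma> r \<one> = 1"
  and sigma_one_left [simp]: "r \<in> carrier G \<Longrightarrow> \<sigma> \<one> r = 1"
  using cocycle by (auto simp: two_cocycle_def)

lemma sigma_cnj: "r \<in> carrier G \<Longrightarrow> s \<in> carrier G \<Longrightarrow> \<sigma> r s * cnj (\<sigma> r s) = 1"
  using sigma_norm[of r s] by (simp add: complex_norm_square[symmetric])

lemma sigma_inv_commute: "t \<in> carrier G \<Longrightarrow> \<sigma> t (inv t) = \<sigma> (inv t) t"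
  using sigma_assoc[of t "inv t" t] by simp

abbreviation T where "T \<equiv> twisted_group_algebra G \<sigma>"
abbreviation supp where "supp f \<equiv> {r. f r \<noteq> (0::complex)}"

lemma T_carrier: "f \<in> carrier T \<longleftrightarrow> finite (supp f) \<and> supp f \<subseteq> carrier G"
  by (simp add: twisted_group_algebra_def)

lemma T_out: "f \<in> carrier T \<Longrightarrow> t \<notin> carrier G \<Longrightarrow> f t = 0"
  by (auto simp: T_carrier)

lemma T_I: "finite S \<Longrightarrow> S \<subseteq> carrier G \<Longrightarrow> (\<And>t. t \<notin> S \<Longrightarrow> f t = 0) \<Longrightarrow> f \<in> carrier T"
  unfolding T_carrier by (auto intro: finite_subset[of _ S])

lemma T_ops:
  "\<zero>\<^bsub>T\<^esub> = (\<lambda>t. 0)" "f \<oplus>\<^bsub>T\<^esub> h = (\<lambda>t. f t + h t)" "c \<odot>\<^bsub>T\<^esub> f = (\<lambda>t. c * f t)" "\<one>\<^bsub>T\<^esub> = delta \<one>"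
  by (auto simp: twisted_group_algebra_def delta_def fun_eq_iff)

lemma T_star:
  "(\<star>\<^bsub>T\<^esub>f) t = (if t \<in> carrier G then cnj (f (inv t)) * cnj (\<sigma> (inv t) t) else 0)"
  by (simp add: twisted_group_algebra_def)

lemma T_mult_out: "t \<notin> carrier G \<Longrightarrow> (f \<otimes>\<^bsub>T\<^esub> h) t = 0"
  by (simp add: twisted_group_algebra_def)

lemma T_mult:
  assumes "finite S" "supp f \<subseteq> S" "t \<in> carrier G"
  shows "(f \<otimes>\<^bsub>T\<^esub> h) t = (\<Sum>r\<in>S. f r * h (inv r \<otimes> t) * \<sigma> r (inv r \<otimes> t))"
  using assms by (auto simp: twisted_group_algebra_def intro!: sum.mono_neutral_left)

lemma T_zero_closed: "\<zero>\<^bsub>T\<^esub> \<in> carrier T" by (simp add: T_ops T_carrier)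

lemma delta_closed: "r \<in> carrier G \<Longrightarrow> delta r \<in> carrier T"
  by (rule T_I[of "{r}"]) (auto simp: delta_def)

lemma T_add_closed: "f \<in> carrier T \<Longrightarrow> h \<in> carrier T \<Longrightarrow> f \<oplus>\<^bsub>T\<^esub> h \<in> carrier T"
  by (rule T_I[of "supp f \<union> supp h"]) (auto simp: T_carrier T_ops)

lemma T_smult_closed: "f \<in> carrier T \<Longrightarrow> c \<odot>\<^bsub>T\<^esub> f \<in> carrier T"
  by (rule T_I[of "supp f"]) (auto simp: T_carrier T_ops)

lemma T_star_closed: "f \<in> carrier T \<Longrightarrow> \<star>\<^bsub>T\<^esub>f \<in> carrier T"
proof (rule T_I[of "m_inv G ` supp f"])
  fix t assume t: "t \<notin> m_inv G ` supp f"
  have "f (inv t) = 0" if "t \<in> carrier G"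
  proof (rule ccontr)
    assume "f (inv t) \<noteq> 0"
    then have "inv (inv t) \<in> m_inv G ` supp f" by blast
    then show False using t that by simp
  qed
  then show "(\<star>\<^bsub>T\<^esub>f) t = 0" by (simp add: T_star)
qed (auto simp: T_carrier)

lemma T_mult_closed:
  assumes "f \<in> carrier T" "h \<in> carrier T" shows "f \<otimes>\<^bsub>T\<^esub> h \<in> carrier T"
proof (rule T_I[of "(\<lambda>(r, s). r \<otimes> s) ` (supp f \<times> supp h)"])
  show "finite ((\<lambda>(r, s). r \<otimes> s) ` (supp f \<times> supp h))" using assms by (simp add: T_carrier)
  show "(\<lambda>(r, s). r \<otimes> s) ` (supp f \<times> supp h) \<subseteq> carrier G" using assms by (auto simp: T_carrier)
  fix t assume t: "t \<notin> (\<lambda>(r, s). r \<otimes> s) ` (supp f \<times> supp h)"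
  show "(f \<otimes>\<^bsub>T\<^esub> h) t = 0"
  proof (cases "t \<in> carrier G")
    case True
    have "h (inv r \<otimes> t) = 0" if r: "r \<in> supp f" for r
    proof (rule ccontr)
      assume "h (inv r \<otimes> t) \<noteq> 0"
      moreover have "t = r \<otimes> (inv r \<otimes> t)"
        using r True assms(1) by (auto simp: T_carrier m_assoc[symmetric])
      ultimately show False using t r by (auto simp: image_iff)
    qed
    then show ?thesis
      using True assms(1) by (subst T_mult[of "supp f"]) (auto simp: T_carrier intro!: sum.neutral)
  qed (simp add: T_mult_out)
qed

lemma T_mult_add_left:
  assumes "f \<in> carrier T" "f' \<in> carrier T"
  shows "(f \<oplus>\<^bsub>T\<^esub> f') \<otimes>\<^bsub>T\<^esub> h = f \<otimes>\<^bsub>T\<^esub> h \<oplus>\<^bsub>T\<^esub> f' \<otimes>\<^bsub>T\<^esub> h"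
proof
  fix t
  let ?S = "supp f \<union> supp f'"
  have S: "finite ?S" "supp f \<subseteq> ?S" "supp f' \<subseteq> ?S" "supp (f \<oplus>\<^bsub>T\<^esub> f') \<subseteq> ?S"
    using assms by (auto simp: T_carrier T_ops)
  show "((f \<oplus>\<^bsub>T\<^esub> f') \<otimes>\<^bsub>T\<^esub> h) t = (f \<otimes>\<^bsub>T\<^esub> h \<oplus>\<^bsub>T\<^esub> f' \<otimes>\<^bsub>T\<^esub> h) t"
  proof (cases "t \<in> carrier G")
    case True
    have *: "(f \<otimes>\<^bsub>T\<^esub> h \<oplus>\<^bsub>T\<^esub> f' \<otimes>\<^bsub>T\<^esub> h) t = (f \<otimes>\<^bsub>T\<^esub> h) t + (f' \<otimes>\<^bsub>T\<^esub> h) t"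
      by (simp only: T_ops)
    show ?thesis
      unfolding * T_mult[OF S(1,2) True] T_mult[OF S(1,3) True] T_mult[OF S(1,4) True]
      by (simp add: T_ops algebra_simps sum.distrib)
  qed (simp add: T_mult_out, simp add: T_ops T_mult_out)
qed

lemma T_mult_smult_left:
  assumes "f \<in> carrier T" shows "(c \<odot>\<^bsub>T\<^esub> f) \<otimes>\<^bsub>T\<^esub> h = c \<odot>\<^bsub>T\<^esub> (f \<otimes>\<^bsub>T\<^esub> h)"
proof
  fix t
  have S: "finite (supp f)" "supp f \<subseteq> supp f" "supp (c \<odot>\<^bsub>T\<^esub> f) \<subseteq> supp f"
    using assms by (auto simp: T_carrier T_ops)
  show "((c \<odot>\<^bsub>T\<^esub> f) \<otimes>\<^bsub>T\<^esub> h) t = (c \<odot>\<^bsub>T\<^esub> (f \<otimes>\<^bsub>T\<^esub> h)) t"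
  proof (cases "t \<in> carrier G")
    case True
    have *: "(c \<odot>\<^bsub>T\<^esub> (f \<otimes>\<^bsub>T\<^esub> h)) t = c * (f \<otimes>\<^bsub>T\<^esub> h) t"
      by (simp only: T_ops)
    show ?thesis
      unfolding * T_mult[OF S(1,2) True] T_mult[OF S(1,3) True]
      by (simp add: T_ops algebra_simps sum_distrib_left)
  qed (simp add: T_mult_out, simp add: T_ops T_mult_out)
qed

lemma T_mult_right:
  assumes "f \<in> carrier T"
  shows "f \<otimes>\<^bsub>T\<^esub> (h \<oplus>\<^bsub>T\<^esub> h') = f \<otimes>\<^bsub>T\<^esub> h \<oplus>\<^bsub>T\<^esub> f \<otimes>\<^bsub>T\<^esub> h'"
    and "f \<otimes>\<^bsub>T\<^esub> (c \<odot>\<^bsub>T\<^esub> h) = c \<odot>\<^bsub>T\<^esub> (f \<otimes>\<^bsub>T\<^esub> h)"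
  by (simp_all add: twisted_group_algebra_def fun_eq_iff algebra_simps sum.distrib
      sum_distrib_left)

lemma delta_mult_apply:
  assumes "r \<in> carrier G" "t \<in> carrier G"
  shows "(delta r \<otimes>\<^bsub>T\<^esub> h) t = h (inv r \<otimes> t) * \<sigma> r (inv r \<otimes> t)"
  by (subst T_mult[of "{r}"]) (auto simp: delta_def assms)

lemma delta_mult:
  assumes "r \<in> carrier G" "s \<in> carrier G"
  shows "delta r \<otimes>\<^bsub>T\<^esub> delta s = \<sigma> r s \<odot>\<^bsub>T\<^esub> delta (r \<otimes> s)"
proof
  fix t
  show "(delta r \<otimes>\<^bsub>T\<^esub> delta s) t = (\<sigma> r s \<odot>\<^bsub>T\<^esub> delta (r \<otimes> s)) t"
  proof (cases "t \<in> carrier G")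
    case True
    then have "s = inv r \<otimes> t \<longleftrightarrow> t = r \<otimes> s" by (intro inv_solve_left assms)
    then have "delta s (inv r \<otimes> t) = delta (r \<otimes> s) t"
      and "t = r \<otimes> s \<Longrightarrow> inv r \<otimes> t = s" by (auto simp: delta_def)
    then show ?thesis
      unfolding delta_mult_apply[OF assms(1) True] T_ops by (cases "t = r \<otimes> s") (auto simp: delta_def)
  next
    case False
    then have "t \<noteq> r \<otimes> s" using assms by auto
    then show ?thesis using False by (simp add: T_mult_out) (simp add: T_ops delta_def)
  qed
qed

lemma delta_star:
  assumes "r \<in> carrier G"
  shows "\<star>\<^bsub>T\<^esub>(delta r) = cnj (\<sigma> r (inv r)) \<odot>\<^bsub>T\<^esub> delta (inv r)"
proof
  fix t
  show "(\<star>\<^bsub>T\<^esub>(delta r)) t = (cnj (\<sigma> r (inv r)) \<odot>\<^bsub>T\<^esub> delta (inv r)) t"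
    using assms by (auto simp: T_star) (auto simp: T_ops delta_def)
qed

lemma T_induct [consumes 1, case_names zero step]:
  assumes f: "f \<in> carrier T" and zero: "P \<zero>\<^bsub>T\<^esub>"
    and step: "\<And>h c r. h \<in> carrier T \<Longrightarrow> r \<in> carrier G \<Longrightarrow> P h \<Longrightarrow> P (h \<oplus>\<^bsub>T\<^esub> c \<odot>\<^bsub>T\<^esub> delta r)"
  shows "P f"
proof -
  have "\<forall>f. supp f \<subseteq> S \<longrightarrow> P f" if "finite S" "S \<subseteq> carrier G" for S
    using that
  proof (induction S rule: finite_induct)
    case empty
    have "f = \<zero>\<^bsub>T\<^esub>" if "supp f \<subseteq> {}" for f using that by (auto simp: T_ops)
    then show ?case using zero by auto
  next
    case (insert r S)
    show ?case
    proof (intro allI impI)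
      fix f assume f: "supp f \<subseteq> insert r S"
      let ?h = "f(r := 0)"
      have s: "supp ?h \<subseteq> S" using f by auto
      then have "?h \<in> carrier T"
        using insert by (intro T_I[of S]) (auto simp del: fun_upd_apply)
      moreover have "P ?h" using insert s by blast
      moreover have "f = ?h \<oplus>\<^bsub>T\<^esub> f r \<odot>\<^bsub>T\<^esub> delta r" by (auto simp: T_ops delta_def)
      ultimately show "P f" using step[of ?h r "f r"] insert by simp
    qed
  qed
  then show ?thesis using f by (auto simp: T_carrier)
qed

lemmas T_closed = T_zero_closed delta_closed T_add_closed T_smult_closed T_star_closed T_mult_closed

lemma T_module:
  "f \<oplus>\<^bsub>T\<^esub> h = h \<oplus>\<^bsub>T\<^esub> f" "f \<oplus>\<^bsub>T\<^esub> h \<oplus>\<^bsub>T\<^esub> k = f \<oplus>\<^bsub>T\<^esub> (h \<oplus>\<^bsub>T\<^esub> k)" "\<zero>\<^bsub>T\<^esub> \<oplus>\<^bsub>T\<^esub> f = f"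
  "c \<odot>\<^bsub>T\<^esub> (f \<oplus>\<^bsub>T\<^esub> h) = c \<odot>\<^bsub>T\<^esub> f \<oplus>\<^bsub>T\<^esub> c \<odot>\<^bsub>T\<^esub> h"
  "(c + d) \<odot>\<^bsub>T\<^esub> f = c \<odot>\<^bsub>T\<^esub> f \<oplus>\<^bsub>T\<^esub> d \<odot>\<^bsub>T\<^esub> f" "c \<odot>\<^bsub>T\<^esub> (d \<odot>\<^bsub>T\<^esub> f) = (c * d) \<odot>\<^bsub>T\<^esub> f"
  "1 \<odot>\<^bsub>T\<^esub> f = f" "0 \<odot>\<^bsub>T\<^esub> f = \<zero>\<^bsub>T\<^esub>" "c \<odot>\<^bsub>T\<^esub> \<zero>\<^bsub>T\<^esub> = \<zero>\<^bsub>T\<^esub>" "f \<oplus>\<^bsub>T\<^esub> \<zero>\<^bsub>T\<^esub> = f"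
  by (simp_all add: T_ops algebra_simps)

lemma T_zero_mult: "\<zero>\<^bsub>T\<^esub> \<otimes>\<^bsub>T\<^esub> f = \<zero>\<^bsub>T\<^esub>" "f \<otimes>\<^bsub>T\<^esub> \<zero>\<^bsub>T\<^esub> = \<zero>\<^bsub>T\<^esub>"
  by (simp_all add: twisted_group_algebra_def fun_eq_iff)

lemma T_star_linear:
  "\<star>\<^bsub>T\<^esub>(f \<oplus>\<^bsub>T\<^esub> h) = \<star>\<^bsub>T\<^esub>f \<oplus>\<^bsub>T\<^esub> \<star>\<^bsub>T\<^esub>h" "\<star>\<^bsub>T\<^esub>(c \<odot>\<^bsub>T\<^esub> f) = cnj c \<odot>\<^bsub>T\<^esub> \<star>\<^bsub>T\<^esub>f" "\<star>\<^bsub>T\<^esub>\<zero>\<^bsub>T\<^esub> = \<zero>\<^bsub>T\<^esub>"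
  by (simp_all add: twisted_group_algebra_def fun_eq_iff algebra_simps)

lemmas T_distribs = T_mult_add_left T_mult_smult_left T_mult_right T_zero_mult T_star_linear

lemma T_assoc:
  assumes "f \<in> carrier T" "h \<in> carrier T" "k \<in> carrier T"
  shows "f \<otimes>\<^bsub>T\<^esub> h \<otimes>\<^bsub>T\<^esub> k = f \<otimes>\<^bsub>T\<^esub> (h \<otimes>\<^bsub>T\<^esub> k)"
  using assms(1)
proof (induction f rule: T_induct)
  case (step f c r)
  have "delta r \<otimes>\<^bsub>T\<^esub> h \<otimes>\<^bsub>T\<^esub> k = delta r \<otimes>\<^bsub>T\<^esub> (h \<otimes>\<^bsub>T\<^esub> k)"
    using assms(2)
  proof (induction h rule: T_induct)
    case (step h d s)
    have "delta r \<otimes>\<^bsub>T\<^esub> delta s \<otimes>\<^bsub>T\<^esub> k = delta r \<otimes>\<^bsub>T\<^esub> (delta s \<otimes>\<^bsub>T\<^esub> k)"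
      using assms(3)
    proof (induction k rule: T_induct)
      case (step k e t)
      then show ?case
        using \<open>r \<in> carrier G\<close> \<open>s \<in> carrier G\<close> sigma_assoc[of r s t]
        by (simp add: T_distribs T_closed delta_mult m_assoc T_module mult_ac)
    qed (simp add: T_distribs)
    then show ?case using step \<open>r \<in> carrier G\<close> by (simp add: T_distribs T_closed)
  qed (simp add: T_distribs)
  then show ?case using step assms by (simp add: T_distribs T_closed)
qed (simp add: T_distribs)

lemma T_one: assumes "f \<in> carrier T" shows "\<one>\<^bsub>T\<^esub> \<otimes>\<^bsub>T\<^esub> f = f" "f \<otimes>\<^bsub>T\<^esub> \<one>\<^bsub>T\<^esub> = f"
  using assms
  by (induction f rule: T_induct)
    (simp_all add: T_distribs T_closed T_ops(4) delta_mult T_module)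

lemma T_ring: "ring T"
proof (rule ringI)
  show "abelian_group T"
  proof (rule abelian_groupI)
    fix f assume "f \<in> carrier T"
    moreover have "(- 1) \<odot>\<^bsub>T\<^esub> f \<oplus>\<^bsub>T\<^esub> f = \<zero>\<^bsub>T\<^esub>" by (simp add: T_ops)
    ultimately show "\<exists>h\<in>carrier T. h \<oplus>\<^bsub>T\<^esub> f = \<zero>\<^bsub>T\<^esub>" using T_smult_closed by blast
  qed (simp_all add: T_closed T_module(2,3), simp add: T_ops add.commute)
  show "monoid T"
    by (rule monoidI) (simp_all add: T_closed T_assoc T_one, simp add: T_ops(4) T_closed)
qed (simp_all add: T_distribs)

lemma delta_star_mult:
  assumes "r \<in> carrier G" "s \<in> carrier G"
  shows "\<star>\<^bsub>T\<^esub>(delta r \<otimes>\<^bsub>T\<^esub> delta s) = \<star>\<^bsub>T\<^esub>(delta s) \<otimes>\<^bsub>T\<^esub> \<star>\<^bsub>T\<^esub>(delta r)"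
proof -
  let ?a = "\<sigma> r s" and ?b = "\<sigma> (r \<otimes> s) (inv s \<otimes> inv r)" and ?c = "\<sigma> s (inv s)"
    and ?d = "\<sigma> r (inv r)" and ?e = "\<sigma> (inv s) (inv r)" and ?x = "\<sigma> s (inv s \<otimes> inv r)"
  have i: "inv s \<otimes> inv r \<in> carrier G" "s \<otimes> (inv s \<otimes> inv r) = inv r"
    using assms by (simp_all add: m_assoc[symmetric])
  have 1: "?a * ?b = ?d * ?x" using sigma_assoc[of r s "inv s \<otimes> inv r"] assms i by simp
  have 2: "?c = ?x * ?e" using sigma_assoc[of s "inv s" "inv r"] assms by simp
  have 3: "?e * cnj ?e = 1" "?x * cnj ?x = 1" using assms by (simp_all add: sigma_cnj)
  have "cnj ?a * cnj ?b = cnj ?d * cnj ?x" using arg_cong[OF 1, of cnj] by simp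
  also have "\<dots> = cnj ?c * cnj ?d * ?e" using 2 3(1) by (simp add: mult_ac)
  finally have "cnj ?a * cnj ?b = cnj ?c * cnj ?d * ?e" .
  then show ?thesis
    using assms
    by (simp add: delta_mult delta_star T_distribs T_closed T_module inv_mult_group mult_ac)
qed

lemma T_star_mult:
  assumes "f \<in> carrier T" "h \<in> carrier T"
  shows "\<star>\<^bsub>T\<^esub>(f \<otimes>\<^bsub>T\<^esub> h) = \<star>\<^bsub>T\<^esub>h \<otimes>\<^bsub>T\<^esub> \<star>\<^bsub>T\<^esub>f"
  using assms(1)
proof (induction f rule: T_induct)
  case (step f c r)
  have "\<star>\<^bsub>T\<^esub>(delta r \<otimes>\<^bsub>T\<^esub> h) = \<star>\<^bsub>T\<^esub>h \<otimes>\<^bsub>T\<^esub> \<star>\<^bsub>T\<^esub>(delta r)"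
    using assms(2)
  proof (induction h rule: T_induct)
    case (step h d s)
    then show ?case using \<open>r \<in> carrier G\<close> by (simp add: T_distribs T_closed delta_star_mult)
  qed (simp add: T_distribs)
  then show ?case using step assms by (simp add: T_distribs T_closed)
qed (simp add: T_distribs)

lemma T_star_star: assumes "f \<in> carrier T" shows "\<star>\<^bsub>T\<^esub>(\<star>\<^bsub>T\<^esub>f) = f"
proof
  fix t show "(\<star>\<^bsub>T\<^esub>(\<star>\<^bsub>T\<^esub>f)) t = f t"
    using sigma_inv_commute[of t] sigma_cnj[of "inv t" t] T_out[OF assms, of t]
    by (auto simp: T_star mult_ac)
qed

lemma T_star_algebra: "star_algebra T"
  by (intro star_algebra.intro T_ring star_algebra_axioms.intro)
    (simp_all add: T_closed T_distribs T_star_mult T_star_star T_module(4-7))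

lemma delta_unitary: "r \<in> carrier G \<Longrightarrow> unitary_elem T (delta r)"
  using sigma_cnj[of r "inv r"] sigma_inv_commute[of r]
  by (simp add: unitary_elem_def delta_star T_distribs T_closed delta_mult T_module T_ops(4)
      mult.commute)

sublocale enveloping T
proof (intro enveloping.intro T_star_algebra enveloping_axioms.intro)
  interpret star_algebra T by (rule T_star_algebra)
  fix f assume "f \<in> carrier T"
  then show "\<exists>b. \<forall>p. cstar_seminorm T p \<longrightarrow> p f \<le> b"
  proof (induction f rule: T_induct)
    case zero
    have "p \<zero>\<^bsub>T\<^esub> \<le> 0" if "cstar_seminorm T p" for p
    proof -
      interpret star_seminorm T p by unfold_locales (rule that)
      show ?thesis by simp
    qed
    then show ?case by blast
  next
    case (step h c r)
    then obtain b where b: "\<And>p. cstar_seminorm T p \<Longrightarrow> p h \<le> b" by blast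
    have "p (h \<oplus>\<^bsub>T\<^esub> c \<odot>\<^bsub>T\<^esub> delta r) \<le> b + cmod c" if "cstar_seminorm T p" for p
    proof -
      interpret star_seminorm T p by unfold_locales (rule that)
      have "p (h \<oplus>\<^bsub>T\<^esub> c \<odot>\<^bsub>T\<^esub> delta r) \<le> p h + cmod c * p (delta r)"
        using step by (metis p_add p_smult smult_closed delta_closed)
      moreover have "cmod c * p (delta r) \<le> cmod c * 1"
        using step by (intro mult_left_mono p_unitary delta_unitary) auto
      ultimately show ?thesis using b[OF that] by simp
    qed
    then show ?case by blast
  qed
qed

abbreviation "CG \<equiv> twisted_group_cstar G \<sigma>"
abbreviation "u \<equiv> twisted_unitary G \<sigma>"

theorem twisted_cstar_algebra: "cstar_algebra CG"
  unfolding twisted_group_cstar_def by (rule envelope_cstar_algebra)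

lemma embed_hom: "envelope_embed T \<in> star_hom T CG"
  using envelope_embed_hom by (simp add: twisted_group_cstar_def)

theorem twisted_unitary_unitary: "r \<in> carrier G \<Longrightarrow> unitary_elem CG (u r)"
  unfolding twisted_unitary_def
  by (rule star_algebra.star_hom_unitary[OF T_star_algebra embed_hom delta_unitary])

theorem twisted_unitary_mult:
  assumes "r \<in> carrier G" "s \<in> carrier G"
  shows "u r \<otimes>\<^bsub>CG\<^esub> u s = \<sigma> r s \<odot>\<^bsub>CG\<^esub> u (r \<otimes> s)"
proof -
  note h = star_algebra.star_homD[OF T_star_algebra embed_hom]
  have "u r \<otimes>\<^bsub>CG\<^esub> u s = envelope_embed T (delta r \<otimes>\<^bsub>T\<^esub> delta s)"
    using assms by (simp add: twisted_unitary_def h(6) delta_closed)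
  also have "\<dots> = \<sigma> r s \<odot>\<^bsub>CG\<^esub> u (r \<otimes> s)"
    using assms by (simp add: twisted_unitary_def h(2) delta_closed delta_mult)
  finally show ?thesis .
qed

text \<open>The closed linear span of the canonical unitaries is the whole algebra.\<close>

theorem twisted_unitary_generate:
  assumes S: "closedin (Metric_space.mtopology (carrier CG) (nrm_dist CG)) S"
    and u: "\<And>r. r \<in> carrier G \<Longrightarrow> u r \<in> S" and zero: "\<zero>\<^bsub>CG\<^esub> \<in> S"
    and add: "\<And>x y. x \<in> S \<Longrightarrow> y \<in> S \<Longrightarrow> x \<oplus>\<^bsub>CG\<^esub> y \<in> S"
    and smult: "\<And>c x. x \<in> S \<Longrightarrow> c \<odot>\<^bsub>CG\<^esub> x \<in> S"
  shows "S = carrier CG"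
proof
  interpret CG: cstar_algebra CG by (rule twisted_cstar_algebra)
  show "S \<subseteq> carrier CG" using S CG.metric_closedin_iff_sequentially_closed by blast
  note hom = star_algebra.star_homD[OF T_star_algebra embed_hom]
  have z: "envelope_embed T \<zero>\<^bsub>T\<^esub> = \<zero>\<^bsub>CG\<^esub>"
    using hom(1)[OF T_zero_closed] hom(2)[OF T_zero_closed, of 0] by (simp add: T_module)
  have alg: "envelope_embed T f \<in> S" if "f \<in> carrier T" for f
    using that
  proof (induction f rule: T_induct)
    case zero then show ?case using z \<open>\<zero>\<^bsub>CG\<^esub> \<in> S\<close> by simp
  next
    case (step h c r)
    then show ?case using add smult u by (simp add: twisted_unitary_def hom T_closed)
  qed
  show "carrier CG \<subseteq> S"
  proof
    fix X assume X: "X \<in> carrier CG"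
    have "\<forall>k. \<exists>f. f \<in> carrier T \<and> \<parallel>envelope_embed T f \<ominus>\<^bsub>CG\<^esub> X\<parallel>\<^bsub>CG\<^esub> < inverse (real (Suc k))"
      using envelope_embed_dense X unfolding twisted_group_cstar_def
      by (metis inverse_positive_iff_positive of_nat_0_less_iff zero_less_Suc)
    then obtain f where f: "\<And>k. f k \<in> carrier T"
      "\<And>k. \<parallel>envelope_embed T (f k) \<ominus>\<^bsub>CG\<^esub> X\<parallel>\<^bsub>CG\<^esub> < inverse (real (Suc k))" by metis
    have cl: "envelope_embed T (f k) \<in> carrier CG" for k using hom(1) f(1) by blast
    have "limitin CG.mtopology (\<lambda>k. envelope_embed T (f k)) X sequentially"
      unfolding CG.limit_metric_sequentially
    proof (intro conjI allI impI)
      fix e :: real assume "0 < e"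
      then obtain N where N: "inverse (real (Suc N)) < e" using reals_Archimedean by blast
      have "nrm_dist CG (envelope_embed T (f k)) X < e" if "N \<le> k" for k
      proof -
        have "nrm_dist CG (envelope_embed T (f k)) X < inverse (real (Suc k))"
          using f(2)[of k] cl X by (simp add: nrm_dist_def)
        also have "\<dots> \<le> inverse (real (Suc N))" using that by (simp add: inverse_eq_divide frac_le)
        finally show ?thesis using N by simp
      qed
      then show "\<exists>N. \<forall>n\<ge>N. envelope_embed T (f n) \<in> carrier CG \<and>
          nrm_dist CG (envelope_embed T (f n)) X < e" using cl by blast
    qed fact
    moreover have "range (\<lambda>k. envelope_embed T (f k)) \<subseteq> S" using alg f(1) by blast
    ultimately show "X \<in> S" using S CG.metric_closedin_iff_sequentially_closed by blast
  qed
qed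

text \<open>The universal property, for \<open>C\<^sup>*\<close>-algebras \<open>B\<close> over an arbitrary type.\<close>

theorem twisted_group_cstar_universal:
  fixes B :: "'b normed_star"
  assumes B: "cstar_algebra B"
    and j: "\<And>r. r \<in> carrier G \<Longrightarrow> unitary_elem B (j r)"
    and j_mult: "\<And>r s. r \<in> carrier G \<Longrightarrow> s \<in> carrier G \<Longrightarrow>
      j r \<otimes>\<^bsub>B\<^esub> j s = \<sigma> r s \<odot>\<^bsub>B\<^esub> j (r \<otimes> s)"
  obtains \<phi> where "\<phi> \<in> star_hom CG B" "\<And>r. r \<in> carrier G \<Longrightarrow> \<phi> (u r) = j r"
proof -
  interpret B: cstar_algebra B by fact
  have jc: "j r \<in> carrier B" if "r \<in> carrier G" for r using j[OF that] by (simp add: unitary_elem_def)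
  define \<pi> where "\<pi> f = finsum B (\<lambda>r. f r \<odot>\<^bsub>B\<^esub> j r) (supp f)" for f
  have pS: "\<pi> f = finsum B (\<lambda>r. f r \<odot>\<^bsub>B\<^esub> j r) S"
    if "finite S" "supp f \<subseteq> S" "S \<subseteq> carrier G" for f S
    unfolding \<pi>_def using that jc by (intro B.add.finprod_mono_neutral_cong_left) auto
  have pcl: "\<pi> f \<in> carrier B" if "f \<in> carrier T" for f
    unfolding \<pi>_def using that jc by (intro B.finsum_closed) (auto simp: T_carrier)
  have padd: "\<pi> (f \<oplus>\<^bsub>T\<^esub> h) = \<pi> f \<oplus>\<^bsub>B\<^esub> \<pi> h" if "f \<in> carrier T" "h \<in> carrier T" for f h
  proof -
    let ?S = "supp f \<union> supp h"
    have S: "finite ?S" "supp f \<subseteq> ?S" "supp h \<subseteq> ?S" "supp (f \<oplus>\<^bsub>T\<^esub> h) \<subseteq> ?S" "?S \<subseteq> carrier G"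
      using that by (auto simp: T_carrier T_ops)
    have "\<pi> (f \<oplus>\<^bsub>T\<^esub> h) = finsum B (\<lambda>r. f r \<odot>\<^bsub>B\<^esub> j r \<oplus>\<^bsub>B\<^esub> h r \<odot>\<^bsub>B\<^esub> j r) ?S"
      unfolding pS[OF S(1,4,5)] using S(5) jc
      by (intro B.finsum_cong') (auto simp: T_ops B.smult_l_distr)
    also have "\<dots> = finsum B (\<lambda>r. f r \<odot>\<^bsub>B\<^esub> j r) ?S \<oplus>\<^bsub>B\<^esub> finsum B (\<lambda>r. h r \<odot>\<^bsub>B\<^esub> j r) ?S"
      using S(5) jc by (intro B.finsum_addf) auto
    finally show ?thesis unfolding pS[OF S(1,2,5)] pS[OF S(1,3,5)] .
  qed
  have pdelta: "\<pi> (c \<odot>\<^bsub>T\<^esub> delta r) = c \<odot>\<^bsub>B\<^esub> j r" if "r \<in> carrier G" for c r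
  proof -
    have "supp (c \<odot>\<^bsub>T\<^esub> delta r) \<subseteq> {r}" by (auto simp: T_ops delta_def)
    from pS[OF _ this] that jc show ?thesis by (simp add: T_ops delta_def)
  qed
  have pzero: "\<pi> \<zero>\<^bsub>T\<^esub> = \<zero>\<^bsub>B\<^esub>" by (simp add: \<pi>_def T_ops)
  have psmult: "\<pi> (c \<odot>\<^bsub>T\<^esub> f) = c \<odot>\<^bsub>B\<^esub> \<pi> f" if "f \<in> carrier T" for c f
    using that
    by (induction f rule: T_induct)
      (simp_all add: T_module T_closed pzero padd pdelta pcl jc B.smult_r_distr B.smult_assoc)
  have pd: "\<pi> (delta r) = j r" if "r \<in> carrier G" for r
    using pdelta[of r 1] that by (simp add: T_module jc)
  note p_simps = T_distribs T_closed pzero padd psmult pcl pd jc B.l_distr B.r_distr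
    B.smult_mult_left B.smult_mult_right
  have pmult: "\<pi> (f \<otimes>\<^bsub>T\<^esub> h) = \<pi> f \<otimes>\<^bsub>B\<^esub> \<pi> h" if "f \<in> carrier T" "h \<in> carrier T" for f h
    using that(1)
  proof (induction f rule: T_induct)
    case (step f c r)
    have "\<pi> (delta r \<otimes>\<^bsub>T\<^esub> h) = j r \<otimes>\<^bsub>B\<^esub> \<pi> h"
      using that(2)
    proof (induction h rule: T_induct)
      case (step h d s)
      then show ?case using \<open>r \<in> carrier G\<close> by (simp add: p_simps delta_mult j_mult)
    qed (use step in \<open>simp add: p_simps\<close>)
    then show ?case using step that by (simp add: p_simps)
  qed (use that in \<open>simp add: p_simps\<close>)
  have jone: "j \<one> = \<one>\<^bsub>B\<^esub>"
  proof -
    have jj: "j \<one> \<otimes>\<^bsub>B\<^esub> j \<one> = j \<one>" using j_mult[of \<one> \<one>] jc by simp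
    have u1: "\<star>\<^bsub>B\<^esub>(j \<one>) \<otimes>\<^bsub>B\<^esub> j \<one> = \<one>\<^bsub>B\<^esub>" using j[of \<one>] by (simp add: unitary_elem_def)
    have "j \<one> = (\<star>\<^bsub>B\<^esub>(j \<one>) \<otimes>\<^bsub>B\<^esub> j \<one>) \<otimes>\<^bsub>B\<^esub> j \<one>" using u1 jc by simp
    also have "\<dots> = \<star>\<^bsub>B\<^esub>(j \<one>) \<otimes>\<^bsub>B\<^esub> (j \<one> \<otimes>\<^bsub>B\<^esub> j \<one>)" using jc by (simp add: B.m_assoc)
    finally show ?thesis using jj u1 by simp
  qed
  have jstar: "\<star>\<^bsub>B\<^esub>(j r) = cnj (\<sigma> r (inv r)) \<odot>\<^bsub>B\<^esub> j (inv r)" if r: "r \<in> carrier G" for r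
  proof -
    have u: "\<star>\<^bsub>B\<^esub>(j r) \<otimes>\<^bsub>B\<^esub> j r = \<one>\<^bsub>B\<^esub>" using j[OF r] by (simp add: unitary_elem_def)
    have "\<star>\<^bsub>B\<^esub>(j r) \<otimes>\<^bsub>B\<^esub> (j r \<otimes>\<^bsub>B\<^esub> j (inv r)) = \<sigma> r (inv r) \<odot>\<^bsub>B\<^esub> \<star>\<^bsub>B\<^esub>(j r)"
      using j_mult[of r "inv r"] r jc by (simp add: jone B.smult_mult_right)
    moreover have "\<star>\<^bsub>B\<^esub>(j r) \<otimes>\<^bsub>B\<^esub> (j r \<otimes>\<^bsub>B\<^esub> j (inv r)) = j (inv r)"
      using u r jc by (simp add: B.m_assoc[symmetric])
    ultimately have "j (inv r) = \<sigma> r (inv r) \<odot>\<^bsub>B\<^esub> \<star>\<^bsub>B\<^esub>(j r)" by simp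
    then show ?thesis
      using sigma_cnj[of r "inv r"] r jc by (simp add: B.smult_assoc[symmetric] mult.commute)
  qed
  have pstar: "\<pi> (\<star>\<^bsub>T\<^esub>f) = \<star>\<^bsub>B\<^esub>(\<pi> f)" if "f \<in> carrier T" for f
    using that
  proof (induction f rule: T_induct)
    case zero
    have "\<star>\<^bsub>B\<^esub>\<zero>\<^bsub>B\<^esub> = \<zero>\<^bsub>B\<^esub>" using B.star_smult[of "\<zero>\<^bsub>B\<^esub>" 0] by simp
    then show ?case by (simp add: p_simps)
  next
    case (step f c r)
    then show ?case by (simp add: p_simps B.star_add B.star_smult delta_star jstar)
  qed
  have "\<pi> \<in> star_hom T B"
    unfolding star_hom_def ring_hom_def
    by (auto simp: pcl padd pmult psmult pstar T_ops(4) pd jone)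
  from envelope_extend[OF B this] obtain \<phi> where "\<phi> \<in> star_hom (cstar_envelope T) B"
    "\<And>f. f \<in> carrier T \<Longrightarrow> \<phi> (envelope_embed T f) = \<pi> f" by blast
  then show thesis
    using that[of \<phi>] by (simp add: twisted_group_cstar_def twisted_unitary_def T_closed pd)
qed

end

section \<open>The free nilpotent group of class 2 and its cocycles\<close>

definition index_pairs :: "nat \<Rightarrow> (nat \<times> nat) set" where
  "index_pairs n = {(j, k). 1 \<le> j \<and> j < k \<and> k \<le> n}"

definition index_triples :: "nat \<Rightarrow> (nat \<times> nat \<times> nat) set" where
  "index_triples n = {(i, j, k). 1 \<le> i \<and> i < j \<and> j < k \<and> k \<le> n}"

text \<open>A tuple is a pair of integer-valued functions on indices and on pairs of indices, extended
  by zero outside \<open>{1..n}\<close> and \<^term>\<open>index_pairs n\<close>.\<close>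

type_synonym nil2 = "(nat \<Rightarrow> int) \<times> (nat \<Rightarrow> nat \<Rightarrow> int)"

definition free_nil2 :: "nat \<Rightarrow> nil2 monoid" where
  "free_nil2 n = \<lparr>
     carrier = {(r, r2). (\<forall>i. i \<notin> {1..n} \<longrightarrow> r i = 0) \<and> (\<forall>j k. (j, k) \<notin> index_pairs n \<longrightarrow> r2 j k = 0)},
     monoid.mult = (\<lambda>(r, r2) (s, s2).
       (\<lambda>i. r i + s i,
        \<lambda>j k. if (j, k) \<in> index_pairs n then r2 j k + s2 j k + r j * s k else 0)),
     one = (\<lambda>i. 0, \<lambda>j k. 0)\<rparr>"

definition group_center :: "('g, 'm) monoid_scheme \<Rightarrow> 'g set" where
  "group_center G = {z \<in> carrier G. \<forall>x\<in>carrier G. x \<otimes>\<^bsub>G\<^esub> z = z \<otimes>\<^bsub>G\<^esub> x}"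

text \<open>Both integer divisions by 2 are exact. \<open>lam i j k\<close> stands for \<open>\<lambda>\<^bsub>i,jk\<^esub>\<close>.\<close>

definition nil2_cocycle :: "nat \<Rightarrow> (nat \<Rightarrow> nat \<Rightarrow> nat \<Rightarrow> complex) \<Rightarrow> nil2 \<Rightarrow> nil2 \<Rightarrow> complex" where
  "nil2_cocycle n lam = (\<lambda>(r, r2) (s, s2).
     (\<Prod>(i, j, k)\<in>index_triples n.
        lam i j k powi (s2 j k * r i + s k * r2 i j) *
        lam j i k powi (s2 i k * r j + s k * (r i * r j - r2 i j))) *
     (\<Prod>(j, k)\<in>index_pairs n.
        lam j j k powi (s2 j k * r j + s k * r j * (r j - 1) div 2) *
        lam k j k powi (r k * (s2 j k + r j * s k) + r j * s k * (s k - 1) div 2)))"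

lemma finite_index_pairs [simp]: "finite (index_pairs n)"
  by (rule finite_subset[of _ "{..n} \<times> {..n}"]) (auto simp: index_pairs_def)

lemma free_nil2_carrier:
  "(r, r2) \<in> carrier (free_nil2 n) \<longleftrightarrow>
    (\<forall>i. i \<notin> {1..n} \<longrightarrow> r i = 0) \<and> (\<forall>j k. (j, k) \<notin> index_pairs n \<longrightarrow> r2 j k = 0)"
  by (simp add: free_nil2_def)

lemma free_nil2_mult:
  "(r, r2) \<otimes>\<^bsub>free_nil2 n\<^esub> (s, s2) =
    (\<lambda>i. r i + s i, \<lambda>j k. if (j, k) \<in> index_pairs n then r2 j k + s2 j k + r j * s k else 0)"
  by (simp add: free_nil2_def)

lemma free_nil2_one: "\<one>\<^bsub>free_nil2 n\<^esub> = (\<lambda>i. 0, \<lambda>j k. 0)"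
  by (simp add: free_nil2_def)

lemma group_free_nil2: "group (free_nil2 n)"
proof (rule groupI)
  let ?G = "free_nil2 n"
  fix x y z assume xyz: "x \<in> carrier ?G" "y \<in> carrier ?G" "z \<in> carrier ?G"
  obtain r r2 s s2 t t2 where [simp]: "x = (r, r2)" "y = (s, s2)" "z = (t, t2)"
    by (metis surj_pair)
  show "x \<otimes>\<^bsub>?G\<^esub> y \<otimes>\<^bsub>?G\<^esub> z = x \<otimes>\<^bsub>?G\<^esub> (y \<otimes>\<^bsub>?G\<^esub> z)"
    by (auto simp: free_nil2_mult fun_eq_iff algebra_simps)
next
  let ?G = "free_nil2 n"
  fix x y assume "x \<in> carrier ?G" "y \<in> carrier ?G"
  then show "x \<otimes>\<^bsub>?G\<^esub> y \<in> carrier ?G"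
    by (cases x; cases y) (auto simp: free_nil2_mult free_nil2_carrier)
next
  let ?G = "free_nil2 n"
  fix x assume x: "x \<in> carrier ?G"
  obtain r r2 where xr [simp]: "x = (r, r2)" by (metis surj_pair)
  show "\<one>\<^bsub>?G\<^esub> \<otimes>\<^bsub>?G\<^esub> x = x"
    using x by (auto simp: free_nil2_mult free_nil2_one free_nil2_carrier fun_eq_iff)
  let ?y = "(\<lambda>i. - r i, \<lambda>j k. if (j, k) \<in> index_pairs n then r j * r k - r2 j k else 0)"
  have "?y \<in> carrier ?G" using x by (auto simp: free_nil2_carrier)
  moreover have "?y \<otimes>\<^bsub>?G\<^esub> x = \<one>\<^bsub>?G\<^esub>" by (auto simp: free_nil2_mult free_nil2_one fun_eq_iff)
  ultimately show "\<exists>y\<in>carrier ?G. y \<otimes>\<^bsub>?G\<^esub> x = \<one>\<^bsub>?G\<^esub>" by blast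
qed (auto simp: free_nil2_one free_nil2_carrier)

lemma group_center_free_nil2:
  assumes "2 \<le> n"
  shows "group_center (free_nil2 n) = {s \<in> carrier (free_nil2 n). fst s = (\<lambda>i. 0)}"
proof (intro equalityI subsetI)
  let ?G = "free_nil2 n"
  fix s assume s: "s \<in> group_center ?G"
  obtain r r2 where s_eq: "s = (r, r2)" by (metis surj_pair)
  have carr: "(r, r2) \<in> carrier ?G" using s s_eq by (simp add: group_center_def)
  have "r m = 0" for m
  proof (cases "m \<in> {1..n}")
    case True
    define l where "l = (if m = 1 then 2 else 1::nat)"
    define e where "e = (\<lambda>i. if i = l then 1 else 0::int)"
    have e: "(e, \<lambda>j k. 0) \<in> carrier ?G" using assms by (auto simp: free_nil2_carrier e_def l_def)
    have "(e, \<lambda>j k. 0) \<otimes>\<^bsub>?G\<^esub> (r, r2) = (r, r2) \<otimes>\<^bsub>?G\<^esub> (e, \<lambda>j k. 0)"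
      using s e unfolding s_eq group_center_def by blast
    then have eq: "(if (j, k) \<in> index_pairs n then 0 + r2 j k + e j * r k else 0) =
        (if (j, k) \<in> index_pairs n then r2 j k + 0 + r j * e k else 0)" for j k
      unfolding free_nil2_mult prod.inject fun_eq_iff by blast
    have step: "e j * r k = r j * e k" if "(j, k) \<in> index_pairs n" for j k
      using eq[of j k] that by simp
    show ?thesis
    proof (cases "m = 1")
      case True
      then show ?thesis using step[of 1 2] assms by (simp add: index_pairs_def e_def l_def)
    next
      case False
      then show ?thesis using step[of 1 m] \<open>m \<in> {1..n}\<close> by (simp add: index_pairs_def e_def l_def)
    qed
  qed (use carr in \<open>auto simp: free_nil2_carrier\<close>)
  then show "s \<in> {s \<in> carrier ?G. fst s = (\<lambda>i. 0)}" using s_eq carr by auto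
next
  fix s assume "s \<in> {s \<in> carrier (free_nil2 n). fst s = (\<lambda>i. 0)}"
  then show "s \<in> group_center (free_nil2 n)"
    by (cases s) (auto simp: group_center_def free_nil2_mult fun_eq_iff)
qed

lemma two_cocycle_nil2_cocycle:
  assumes "\<And>i j k. \<lbrakk>1 \<le> i; i \<le> k; 1 \<le> j; j < k; k \<le> n\<rbrakk> \<Longrightarrow> cmod (lam i j k) = 1"
  shows "two_cocycle (free_nil2 n) (nil2_cocycle n lam)"
  unfolding two_cocycle_def
proof (intro conjI ballI)
  let ?G = "free_nil2 n" and ?\<sigma> = "nil2_cocycle n lam"
  have nz: "lam i j k \<noteq> 0" if "1 \<le> i" "i \<le> k" "1 \<le> j" "j < k" "k \<le> n" for i j k
    using assms[OF that] by auto
  fix x y assume xy: "x \<in> carrier ?G" "y \<in> carrier ?G"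
  obtain r r2 s s2 where [simp]: "x = (r, r2)" "y = (s, s2)" by (metis surj_pair)
  show "cmod (?\<sigma> x y) = 1"
    by (auto simp: nil2_cocycle_def norm_mult prod_norm[symmetric] norm_power_int index_pairs_def
        index_triples_def assms case_prod_unfold intro!: prod.neutral
        intro: mult_eq_1_iff[THEN iffD2])
  show "?\<sigma> x \<one>\<^bsub>?G\<^esub> = 1" "?\<sigma> \<one>\<^bsub>?G\<^esub> x = 1"
    by (simp_all add: nil2_cocycle_def free_nil2_one)
  fix z assume z: "z \<in> carrier ?G"
  obtain t t2 where [simp]: "z = (t, t2)" by (metis surj_pair)
  define h where "h = (\<lambda>a b :: int. a * b * (b - 1) div 2)"
  have half: "a * b * (b - 1) div 2 = h a b" for a b by (simp add: h_def)
  have h2: "2 * h a b = a * b * (b - 1)" for a b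
  proof -
    have "2 dvd a * b * (b - 1)" by (cases "even b") auto
    then show ?thesis by (simp add: h_def)
  qed
  have hl: "h (a + b) c = h a c + h b c" for a b c
    using h2[of "a + b" c] h2[of a c] h2[of b c] by (simp add: algebra_simps)
  have hr: "h a (b + c) = h a b + h a c + a * b * c" for a b c
  proof -
    have "2 * h a (b + c) = 2 * (h a b + h a c + a * b * c)"
      using h2[of a "b + c"] h2[of a b] h2[of a c] by (simp add: algebra_simps)
    then show ?thesis by simp
  qed
  have pw: "w powi a * w powi b = w powi c * w powi d" if "w \<noteq> 0" "a + b = c + d"
    for w :: complex and a b c d :: int
    using that by (metis power_int_add)
  have 3: "(\<Prod>(i, j, k)\<in>index_triples n. f i j k) * (\<Prod>(i, j, k)\<in>index_triples n. f' i j k) =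
      (\<Prod>(i, j, k)\<in>index_triples n. h i j k) * (\<Prod>(i, j, k)\<in>index_triples n. h' i j k)"
    if "\<And>i j k. (i, j, k) \<in> index_triples n \<Longrightarrow> f i j k * f' i j k = h i j k * h' i j k"
    for f f' h h' :: "nat \<Rightarrow> nat \<Rightarrow> nat \<Rightarrow> complex"
    using that by (auto simp: prod.distrib[symmetric] case_prod_unfold intro!: prod.cong)
  have 2: "(\<Prod>(j, k)\<in>index_pairs n. f j k) * (\<Prod>(j, k)\<in>index_pairs n. f' j k) =
      (\<Prod>(j, k)\<in>index_pairs n. h j k) * (\<Prod>(j, k)\<in>index_pairs n. h' j k)"
    if "\<And>j k. (j, k) \<in> index_pairs n \<Longrightarrow> f j k * f' j k = h j k * h' j k"
    for f f' h h' :: "nat \<Rightarrow> nat \<Rightarrow> complex"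
    using that by (auto simp: prod.distrib[symmetric] case_prod_unfold intro!: prod.cong)
  have comb: "a * b * (a' * b') = c * d * (c' * d')" if "a * a' = c * c'" "b * b' = d * d'"
    for a b a' b' c d c' d' :: complex
    using that by (metis mult.assoc mult.left_commute)
  show "?\<sigma> x y * ?\<sigma> (x \<otimes>\<^bsub>?G\<^esub> y) z = ?\<sigma> x (y \<otimes>\<^bsub>?G\<^esub> z) * ?\<sigma> y z"
    unfolding nil2_cocycle_def \<open>x = _\<close> \<open>y = _\<close> \<open>z = _\<close> free_nil2_mult prod.case
  proof (rule comb[OF 3 2]; rule comb; rule pw)
    fix i j k assume "(i, j, k) \<in> index_triples n"
    then have ijk: "1 \<le> i" "i < j" "j < k" "k \<le> n" by (auto simp: index_triples_def)
    then have p: "(i, j) \<in> index_pairs n" "(j, k) \<in> index_pairs n" "(i, k) \<in> index_pairs n"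
      by (auto simp: index_pairs_def)
    show "lam i j k \<noteq> 0" "lam j i k \<noteq> 0" using ijk nz by simp_all
    show "s2 j k * r i + s k * r2 i j +
        (t2 j k * (r i + s i) + t k * (if (i, j) \<in> index_pairs n then r2 i j + s2 i j + r i * s j else 0)) =
      (if (j, k) \<in> index_pairs n then s2 j k + t2 j k + s j * t k else 0) * r i + (s k + t k) * r2 i j +
        (t2 j k * s i + t k * s2 i j)"
      using p by (simp add: algebra_simps)
    show "s2 i k * r j + s k * (r i * r j - r2 i j) +
        (t2 i k * (r j + s j) + t k * ((r i + s i) * (r j + s j) -
          (if (i, j) \<in> index_pairs n then r2 i j + s2 i j + r i * s j else 0))) =
      (if (i, k) \<in> index_pairs n then s2 i k + t2 i k + s i * t k else 0) * r j +
        (s k + t k) * (r i * r j - r2 i j) + (t2 i k * s j + t k * (s i * s j - s2 i j))"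
      using p by (simp add: algebra_simps)
  next
    fix j k assume p: "(j, k) \<in> index_pairs n"
    then have jk: "1 \<le> j" "j < k" "k \<le> n" by (auto simp: index_pairs_def)
    show "lam j j k \<noteq> 0" "lam k j k \<noteq> 0" using jk nz by simp_all
    show "s2 j k * r j + s k * r j * (r j - 1) div 2 +
        (t2 j k * (r j + s j) + t k * (r j + s j) * (r j + s j - 1) div 2) =
      (if (j, k) \<in> index_pairs n then s2 j k + t2 j k + s j * t k else 0) * r j +
        (s k + t k) * r j * (r j - 1) div 2 + (t2 j k * s j + t k * s j * (s j - 1) div 2)"
      using p unfolding half by (simp add: hl hr algebra_simps)
    show "r k * (s2 j k + r j * s k) + r j * s k * (s k - 1) div 2 +
        ((r k + s k) * (t2 j k + (r j + s j) * t k) + (r j + s j) * t k * (t k - 1) div 2) =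
      r k * ((if (j, k) \<in> index_pairs n then s2 j k + t2 j k + s j * t k else 0) + r j * (s k + t k)) +
        r j * (s k + t k) * (s k + t k - 1) div 2 +
        (s k * (t2 j k + s j * t k) + s j * t k * (t k - 1) div 2)"
      using p unfolding half by (simp add: hl hr algebra_simps)
  qed
qed

end

(* Let tau be the trace f |-> f(e) on the twisted group algebra, and let the regular representation
   define the reduced norm.  As G(n) grows polynomially, |supp (f* f)^(2^k)| grows at most
   exponentially in k; comparing the l1- and l2-norms of (f* f)^(2^k) shows that every C*-seminorm is
   dominated by the reduced norm, so tau is faithful on the full algebra.

   A central s commutes up to the scalar prod_i (prod_{j<k} lambda_{i,jk}^{s_jk})^{r_i} with the
   unitary of r.  If this character is trivial for some s different from e, the unitary w of s is
   central with tau(w^k) = 0 for all k > 0, and the closed ideal generated by w - 1 is proper and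
   nonzero.

   Otherwise averaging x |-> (x + u x u* )/2 over unitaries u of group elements shrinks every
   central unitary other than 1.  For noncentral s, conjugation multiplies the unitary of s by
   infinitely many central elements, so some averages Y of it have small 2-norm; Y Y* is supported
   in the center, hence can be averaged to nearly tau(Y Y* ) 1, and the Kadison-Schwarz inequality
   A(Y) A(Y)* <= A(Y Y* ) for averages A makes A(Y) small in norm.  Thus if X is a nonzero element of
   a closed ideal, averages of X* X approach the nonzero scalar tau(X* X) 1. *)

theory Submission
  imports Defs
begin

section \<open>Tracial algebras and the regular representation\<close>

text \<open>The obstacle is that the 2-norm, which averaging lowers by spreading coefficients over a
  support, does not bound the C*-norm. The conjugates of a noncentral unitary differ only by central
  unitaries, and an average of distinct central unitaries can keep norm 1, since they commute and
  the trivial character of the center sends all of them to 1. Spreading coefficients is therefore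
  not enough. Only the second round of averaging, which damps the central coefficients of
  \<open>Y \<otimes> \<star>Y\<close> through the cocycle, makes a norm small, and the
  Kadison-Schwarz inequality carries this back to \<open>Y\<close>.

  All estimates are made on the dense algebra \<open>A\<close>, which also serves as its own
  uncompleted Hilbert space: the reduced norm is an operator norm on \<open>A\<close>, operator
  inequalities are inequalities of quadratic forms on \<open>A\<close>, and the trace is never
  extended to the completion. The equality of full and reduced norm is what transports the averaging
  estimates to the completion.\<close>

locale tracial_algebra = star_algebra A for A :: "'a normed_star" (structure) +
  fixes tr :: "'a \<Rightarrow> complex"
  assumes tr_add: "\<lbrakk>x \<in> carrier A; y \<in> carrier A\<rbrakk> \<Longrightarrow> tr (x \<oplus> y) = tr x + tr y"
    and tr_smult: "x \<in> carrier A \<Longrightarrow> tr (c \<odot> x) = c * tr x"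
    and tr_star: "x \<in> carrier A \<Longrightarrow> tr (\<star>x) = cnj (tr x)"
    and tr_commute: "\<lbrakk>x \<in> carrier A; y \<in> carrier A\<rbrakk> \<Longrightarrow> tr (x \<otimes> y) = tr (y \<otimes> x)"
    and tr_one: "tr \<one> = 1"
    and tr_pos: "\<lbrakk>x \<in> carrier A; x \<noteq> \<zero>\<rbrakk> \<Longrightarrow> 0 < Re (tr (\<star>x \<otimes> x))"
begin

text \<open>The GNS inner product of the trace, linear in the first argument; left multiplication by
  \<open>x\<close> has left multiplication by \<open>\<star>x\<close> as its adjoint.\<close>

definition ip :: "'a \<Rightarrow> 'a \<Rightarrow> complex" where "ip x y = tr (\<star>y \<otimes> x)"

definition l2 :: "'a \<Rightarrow> real" where "l2 x = sqrt (Re (ip x x))"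

lemma tr_zero [simp]: "tr \<zero> = 0"
  using tr_smult[of \<zero> 0] by simp

lemma ip_add_left: "\<lbrakk>x \<in> carrier A; y \<in> carrier A; z \<in> carrier A\<rbrakk> \<Longrightarrow> ip (x \<oplus> y) z = ip x z + ip y z"
  by (simp add: ip_def r_distr tr_add)

lemma ip_add_right: "\<lbrakk>x \<in> carrier A; y \<in> carrier A; z \<in> carrier A\<rbrakk> \<Longrightarrow> ip z (x \<oplus> y) = ip z x + ip z y"
  by (simp add: ip_def l_distr star_add tr_add)

lemma ip_smult_left: "\<lbrakk>x \<in> carrier A; y \<in> carrier A\<rbrakk> \<Longrightarrow> ip (c \<odot> x) y = c * ip x y"
  by (simp add: ip_def smult_mult_right tr_smult)

lemma ip_smult_right: "\<lbrakk>x \<in> carrier A; y \<in> carrier A\<rbrakk> \<Longrightarrow> ip x (c \<odot> y) = cnj c * ip x y"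
  by (simp add: ip_def star_smult smult_mult_left tr_smult)

lemma ip_commute: "\<lbrakk>x \<in> carrier A; y \<in> carrier A\<rbrakk> \<Longrightarrow> ip y x = cnj (ip x y)"
  using tr_star[of "\<star>y \<otimes> x"] by (simp add: ip_def star_mult)

lemma ip_mult_left:
  "\<lbrakk>x \<in> carrier A; y \<in> carrier A; z \<in> carrier A\<rbrakk> \<Longrightarrow> ip (x \<otimes> y) z = ip y (\<star>x \<otimes> z)"
  by (simp add: ip_def star_mult m_assoc)

lemma ip_self_nonneg: "x \<in> carrier A \<Longrightarrow> 0 \<le> Re (ip x x)"
  unfolding ip_def using tr_pos[of x] by (cases "x = \<zero>") auto

lemma l2_nonneg [simp]: "x \<in> carrier A \<Longrightarrow> 0 \<le> l2 x"
  by (simp add: l2_def ip_self_nonneg)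

lemma l2_power2: "x \<in> carrier A \<Longrightarrow> (l2 x)\<^sup>2 = Re (ip x x)"
  by (simp add: l2_def ip_self_nonneg)

lemma ip_self: assumes "x \<in> carrier A" shows "ip x x = of_real ((l2 x)\<^sup>2)"
proof -
  have "Im (ip x x) = 0" using ip_commute[OF assms assms] by (metis cnj.simps(2) neg_equal_zero)
  then show ?thesis by (simp add: l2_power2 assms complex_eq_iff)
qed

lemma l2_eq_0_iff: "x \<in> carrier A \<Longrightarrow> l2 x = 0 \<longleftrightarrow> x = \<zero>"
  unfolding l2_def ip_def using tr_pos[of x] by (cases "x = \<zero>") auto

lemma l2_pos: "\<lbrakk>x \<in> carrier A; x \<noteq> \<zero>\<rbrakk> \<Longrightarrow> 0 < l2 x"
  by (simp add: l2_def ip_def tr_pos)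

lemma l2_zero [simp]: "l2 \<zero> = 0"
  by (simp add: l2_def ip_def)

lemma l2_one: "l2 \<one> = 1"
  by (simp add: l2_def ip_def tr_one)

lemma l2_smult: assumes "x \<in> carrier A" shows "l2 (c \<odot> x) = cmod c * l2 x"
proof -
  have "ip (c \<odot> x) (c \<odot> x) = (c * cnj c) * ip x x"
    using assms by (simp add: ip_smult_left ip_smult_right mult_ac)
  also have "\<dots> = of_real ((cmod c * l2 x)\<^sup>2)"
    using assms by (simp only: complex_norm_square[symmetric] ip_self) (simp add: power_mult_distrib)
  finally have "(l2 (c \<odot> x))\<^sup>2 = (cmod c * l2 x)\<^sup>2" using assms by (simp add: l2_power2 del: of_real_power)
  then show ?thesis by (rule power2_eq_imp_eq) (use assms in simp_all)
qed

lemma l2_add_power2: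
  assumes "x \<in> carrier A" "y \<in> carrier A"
  shows "(l2 (x \<oplus> y))\<^sup>2 = (l2 x)\<^sup>2 + (l2 y)\<^sup>2 + 2 * Re (ip x y)"
  using assms ip_commute[of x y] by (simp add: l2_power2 ip_add_left ip_add_right)

lemma cauchy_schwarz:
  assumes "x \<in> carrier A" "y \<in> carrier A"
  shows "cmod (ip x y) \<le> l2 x * l2 y"
proof (cases "y = \<zero>")
  case True
  then show ?thesis using assms by (simp add: ip_def star_smult[of \<zero> 0, simplified])
next
  case False
  then have pos: "0 < l2 y" using assms l2_nonneg[of y] l2_eq_0_iff[of y] by linarith
  \<comment> \<open>The coefficient that minimizes
    \<open>l2 (x \<oplus> c \<odot> y)\<close>.\<close>
  define c where "c = - ip x y / of_real ((l2 y)\<^sup>2)"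
  have "0 \<le> (l2 (x \<oplus> c \<odot> y))\<^sup>2" by simp
  also have "\<dots> = (l2 x)\<^sup>2 + (cmod c * l2 y)\<^sup>2 + 2 * Re (cnj c * ip x y)"
    using assms by (simp add: l2_add_power2 l2_smult ip_smult_right)
  also have "Re (cnj c * ip x y) = - ((cmod (ip x y))\<^sup>2 / (l2 y)\<^sup>2)"
  proof -
    have "cnj c * ip x y = - (ip x y * cnj (ip x y) / of_real ((l2 y)\<^sup>2))"
      by (simp add: c_def mult_ac)
    also have "\<dots> = - of_real ((cmod (ip x y))\<^sup>2 / (l2 y)\<^sup>2)"
      by (simp only: complex_norm_square[symmetric] of_real_divide)
    finally show ?thesis by simp
  qed
  also have "(cmod c * l2 y)\<^sup>2 = (cmod (ip x y))\<^sup>2 / (l2 y)\<^sup>2"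
    using pos by (simp add: c_def norm_divide power_mult_distrib power_divide field_simps norm_power)
  finally have "(cmod (ip x y))\<^sup>2 / (l2 y)\<^sup>2 \<le> (l2 x)\<^sup>2" by simp
  then have "(cmod (ip x y))\<^sup>2 \<le> (l2 x * l2 y)\<^sup>2"
    using pos by (simp add: field_simps power_mult_distrib)
  then show ?thesis by (rule power2_le_imp_le) (use assms in simp)
qed

lemma l2_add:
  assumes "x \<in> carrier A" "y \<in> carrier A"
  shows "l2 (x \<oplus> y) \<le> l2 x + l2 y"
proof (rule power2_le_imp_le)
  have "Re (ip x y) \<le> l2 x * l2 y"
    using cauchy_schwarz[OF assms] complex_Re_le_cmod order_trans by blast
  then show "(l2 (x \<oplus> y))\<^sup>2 \<le> (l2 x + l2 y)\<^sup>2"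
    using assms by (simp add: l2_add_power2 power2_sum)
qed (use assms in simp)

lemma l2_diff_commute: "\<lbrakk>x \<in> carrier A; y \<in> carrier A\<rbrakk> \<Longrightarrow> l2 (x \<ominus> y) = l2 (y \<ominus> x)"
proof -
  assume xy: "x \<in> carrier A" "y \<in> carrier A"
  have "x \<ominus> y = (- 1) \<odot> (y \<ominus> x)"
    using xy by (simp add: minus_eq_smult smult_r_distr a_comm flip: smult_assoc)
  then show ?thesis using xy by (simp add: l2_smult)
qed

lemma diff_add_cancel: "\<lbrakk>x \<in> carrier A; y \<in> carrier A\<rbrakk> \<Longrightarrow> (x \<ominus> y) \<oplus> y = x"
  by (simp add: minus_eq a_assoc l_neg)

lemma l2_diff_ge:
  assumes "x \<in> carrier A" "y \<in> carrier A" shows "l2 x - l2 y \<le> l2 (x \<ominus> y)"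
  using l2_add[of "x \<ominus> y" y] assms by (simp add: diff_add_cancel)

lemma l2_unitary_mult_left:
  assumes "unitary_elem A w" "x \<in> carrier A" shows "l2 (w \<otimes> x) = l2 x"
  using assms by (simp add: l2_def ip_def unitary_elem_def star_mult m_assoc)
     (metis m_assoc star_closed l_one)

lemma l2_star: "x \<in> carrier A \<Longrightarrow> l2 (\<star>x) = l2 x"
  by (simp add: l2_def ip_def tr_commute[of x "\<star>x"])

lemma unitary_star: "unitary_elem A w \<Longrightarrow> unitary_elem A (\<star>w)"
  by (simp add: unitary_elem_def)

lemma l2_unitary_mult_right:
  assumes "unitary_elem A w" "x \<in> carrier A" shows "l2 (x \<otimes> w) = l2 x"
proof -
  have w: "w \<in> carrier A" using assms by (simp add: unitary_elem_def)
  have "l2 (x \<otimes> w) = l2 (\<star>w \<otimes> \<star>x)" using assms(2) w l2_star[of "x \<otimes> w"] by (simp add: star_mult)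
  also have "\<dots> = l2 x" using assms unitary_star by (simp add: l2_unitary_mult_left l2_star)
  finally show ?thesis .
qed

end

section \<open>The reduced norm\<close>

locale bounded_tracial_algebra = tracial_algebra +
  assumes left_bounded: "x \<in> carrier A \<Longrightarrow> \<exists>b. \<forall>h\<in>carrier A. l2 (x \<otimes> h) \<le> b * l2 h"
begin

text \<open>The operator norm of left multiplication on the pre-Hilbert space \<open>A\<close>. The
  vector \<open>\<zero>\<close> contributes 0 / 0 = 0, so the supremum may run over the whole
  carrier.\<close>

definition red :: "'a \<Rightarrow> real" where "red x = (SUP h\<in>carrier A. l2 (x \<otimes> h) / l2 h)"

lemma red_bound:
  assumes x: "x \<in> carrier A" and h: "h \<in> carrier A" shows "l2 (x \<otimes> h) \<le> red x * l2 h"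
proof (cases "h = \<zero>")
  case False
  then have pos: "0 < l2 h" using h l2_nonneg[of h] l2_eq_0_iff[of h] by linarith
  obtain b where b: "\<And>h. h \<in> carrier A \<Longrightarrow> l2 (x \<otimes> h) \<le> b * l2 h"
    using left_bounded[OF x] by blast
  have "bdd_above ((\<lambda>h. l2 (x \<otimes> h) / l2 h) ` carrier A)"
  proof (rule bdd_aboveI2)
    fix k assume "k \<in> carrier A"
    then show "l2 (x \<otimes> k) / l2 k \<le> \<bar>b\<bar>"
      using b[of k] l2_pos[of k] order_trans[OF b[of k] mult_right_mono[OF abs_ge_self, of "l2 k" b]]
      by (cases "k = \<zero>") (auto simp: pos_divide_le_eq)
  qed
  then have "l2 (x \<otimes> h) / l2 h \<le> red x" unfolding red_def using h by (intro cSUP_upper)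
  then show ?thesis using pos by (simp add: field_simps)
qed (use x in simp)

lemma red_le:
  assumes "0 \<le> b" "\<And>h. h \<in> carrier A \<Longrightarrow> l2 (x \<otimes> h) \<le> b * l2 h" shows "red x \<le> b"
  unfolding red_def
proof (rule cSUP_least)
  fix h assume h: "h \<in> carrier A"
  then show "l2 (x \<otimes> h) / l2 h \<le> b"
    using assms(1) assms(2)[OF h] l2_pos[OF h] by (cases "h = \<zero>") (auto simp: pos_divide_le_eq)
qed auto

lemma l2_le_red: "x \<in> carrier A \<Longrightarrow> l2 x \<le> red x"
  using red_bound[of x \<one>] by (simp add: l2_one)

lemma red_nonneg [simp]: "x \<in> carrier A \<Longrightarrow> 0 \<le> red x"
  using l2_le_red[of x] l2_nonneg[of x] by linarith

lemma red_mult: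
  assumes "x \<in> carrier A" "y \<in> carrier A" shows "red (x \<otimes> y) \<le> red x * red y"
proof (rule red_le)
  fix h assume h: "h \<in> carrier A"
  have "l2 (x \<otimes> y \<otimes> h) \<le> red x * l2 (y \<otimes> h)" using assms h by (simp add: m_assoc red_bound)
  also have "\<dots> \<le> red x * (red y * l2 h)" using assms h by (intro mult_left_mono red_bound) auto
  finally show "l2 (x \<otimes> y \<otimes> h) \<le> red x * red y * l2 h" by (simp add: mult.assoc)
qed (use assms in simp)

lemma red_ip: "\<lbrakk>x \<in> carrier A; h \<in> carrier A\<rbrakk> \<Longrightarrow> Re (ip (x \<otimes> h) h) \<le> red x * (l2 h)\<^sup>2"
proof -
  assume *: "x \<in> carrier A" "h \<in> carrier A"
  have "Re (ip (x \<otimes> h) h) \<le> cmod (ip (x \<otimes> h) h)" by (rule complex_Re_le_cmod)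
  also have "\<dots> \<le> l2 (x \<otimes> h) * l2 h" using * by (intro cauchy_schwarz) auto
  also have "\<dots> \<le> red x * l2 h * l2 h" using * by (intro mult_right_mono red_bound) auto
  finally show ?thesis by (simp add: power2_eq_square mult.assoc)
qed

lemma l2_mult_power2:
  "\<lbrakk>x \<in> carrier A; h \<in> carrier A\<rbrakk> \<Longrightarrow> (l2 (x \<otimes> h))\<^sup>2 = Re (ip (\<star>x \<otimes> x \<otimes> h) h)"
  by (simp add: l2_power2 ip_def star_mult m_assoc)

lemma red_power2_le:
  assumes "0 \<le> b" "x \<in> carrier A" "\<And>h. h \<in> carrier A \<Longrightarrow> (l2 (x \<otimes> h))\<^sup>2 \<le> b * (l2 h)\<^sup>2"
  shows "(red x)\<^sup>2 \<le> b"
proof -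
  have "red x \<le> sqrt b"
  proof (rule red_le)
    fix h assume h: "h \<in> carrier A"
    have "l2 (x \<otimes> h) = sqrt ((l2 (x \<otimes> h))\<^sup>2)" using h assms(2) by simp
    also have "\<dots> \<le> sqrt (b * (l2 h)\<^sup>2)" using assms(3)[OF h] by (rule real_sqrt_le_mono)
    also have "\<dots> = sqrt b * l2 h" using h by (simp add: real_sqrt_mult)
    finally show "l2 (x \<otimes> h) \<le> sqrt b * l2 h" .
  qed (use assms in simp)
  then have "(red x)\<^sup>2 \<le> (sqrt b)\<^sup>2" using assms(2) by (intro power_mono) auto
  then show ?thesis using assms(1) by simp
qed

text \<open>This half of the C*-identity suffices: together with \<open>red_mult\<close> it gives
  \<open>red_star_le\<close> by cancelling a factor \<open>red x\<close>, and that yields the other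
  half.\<close>

lemma red_power2_le_star_mult: "x \<in> carrier A \<Longrightarrow> (red x)\<^sup>2 \<le> red (\<star>x \<otimes> x)"
  by (rule red_power2_le) (auto simp: l2_mult_power2 intro!: red_ip)

lemma red_star_le: assumes "x \<in> carrier A" shows "red x \<le> red (\<star>x)"
proof (cases "red x = 0")
  case False
  then have "0 < red x" using red_nonneg[OF assms] by linarith
  moreover have "red x * red x \<le> red (\<star>x) * red x"
    using red_power2_le_star_mult[OF assms] red_mult[of "\<star>x" x] assms by (simp add: power2_eq_square)
  ultimately show ?thesis by simp
qed (use assms in simp)

lemma cstar_seminorm_red: "cstar_seminorm A red"
  unfolding cstar_seminorm_def
proof (intro conjI ballI allI)
  fix x y c assume x: "x \<in> carrier A"
  have le: "red (c \<odot> x) \<le> cmod c * red x" if "x \<in> carrier A" for c x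
  proof (rule red_le)
    fix h assume h: "h \<in> carrier A"
    then have "l2 (c \<odot> x \<otimes> h) = cmod c * l2 (x \<otimes> h)"
      using that by (simp add: smult_mult_left l2_smult)
    also have "\<dots> \<le> cmod c * (red x * l2 h)" using that h by (intro mult_left_mono red_bound) auto
    finally show "l2 (c \<odot> x \<otimes> h) \<le> cmod c * red x * l2 h" by (simp add: mult.assoc)
  qed (use that in simp)
  show "red (c \<odot> x) = cmod c * red x"
  proof (cases "c = 0")
    case True
    then show ?thesis using le[OF x, of 0] red_nonneg[of \<zero>] x by (simp del: red_nonneg)
  next
    case False
    have "red (inverse c \<odot> (c \<odot> x)) \<le> cmod (inverse c) * red (c \<odot> x)" using x by (intro le) auto
    moreover have "inverse c \<odot> (c \<odot> x) = x" using False x by (simp flip: smult_assoc)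
    ultimately have "cmod c * red x \<le> red (c \<odot> x)"
      using False by (simp add: norm_inverse norm_divide pos_le_divide_eq inverse_eq_divide mult.commute)
    then show ?thesis using le[OF x, of c] by simp
  qed
  show "red (\<star>x \<otimes> x) = (red x)\<^sup>2"
  proof (rule antisym)
    have "red (\<star>x \<otimes> x) \<le> red (\<star>x) * red x" using x by (intro red_mult) auto
    also have "\<dots> \<le> red x * red x" using red_star_le[of "\<star>x"] x by (intro mult_right_mono) auto
    finally show "red (\<star>x \<otimes> x) \<le> (red x)\<^sup>2" by (simp add: power2_eq_square)
  qed (rule red_power2_le_star_mult[OF x])
next
  fix x y assume xy: "x \<in> carrier A" "y \<in> carrier A"
  show "red (x \<oplus> y) \<le> red x + red y"
  proof (rule red_le)
    fix h assume h: "h \<in> carrier A"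
    have "l2 ((x \<oplus> y) \<otimes> h) \<le> l2 (x \<otimes> h) + l2 (y \<otimes> h)" using xy h by (simp add: l_distr l2_add)
    also have "\<dots> \<le> red x * l2 h + red y * l2 h" using xy h by (intro add_mono red_bound)
    finally show "l2 ((x \<oplus> y) \<otimes> h) \<le> (red x + red y) * l2 h" by (simp add: algebra_simps)
  qed (use xy in simp)
  show "red (x \<otimes> y) \<le> red x * red y" using xy by (rule red_mult)
qed simp

end

section \<open>Averaging over unitaries\<close>

context star_algebra
begin

definition half_avg :: "'a \<Rightarrow> 'a \<Rightarrow> 'a" where
  "half_avg w x = (1/2) \<odot> (x \<oplus> w \<otimes> x \<otimes> \<star>w)"

text \<open>The last entry of the list acts first, so a list put in front averages further.\<close>

definition avg :: "'a list \<Rightarrow> 'a \<Rightarrow> 'a" where "avg ws = foldr half_avg ws"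

lemma avg_Nil [simp]: "avg [] x = x"
  and avg_Cons [simp]: "avg (w # ws) x = half_avg w (avg ws x)"
  and avg_append: "avg (vs @ ws) x = avg vs (avg ws x)"
  by (simp_all add: avg_def)

lemma unitary_closed [simp]: "unitary_elem A w \<Longrightarrow> w \<in> carrier A"
  by (simp add: unitary_elem_def)

lemma half_avg_closed [simp]: "\<lbrakk>w \<in> carrier A; x \<in> carrier A\<rbrakk> \<Longrightarrow> half_avg w x \<in> carrier A"
  by (simp add: half_avg_def)

lemma avg_closed [simp]: "\<lbrakk>set ws \<subseteq> carrier A; x \<in> carrier A\<rbrakk> \<Longrightarrow> avg ws x \<in> carrier A"
  by (induction ws) auto

lemma half_avg_add:
  "\<lbrakk>w \<in> carrier A; x \<in> carrier A; y \<in> carrier A\<rbrakk> \<Longrightarrow> half_avg w (x \<oplus> y) = half_avg w x \<oplus> half_avg w y"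
  by (simp add: half_avg_def l_distr r_distr smult_r_distr a_ac)

lemma half_avg_smult:
  "\<lbrakk>w \<in> carrier A; x \<in> carrier A\<rbrakk> \<Longrightarrow> half_avg w (c \<odot> x) = c \<odot> half_avg w x"
  by (simp add: half_avg_def smult_mult_left smult_mult_right smult_r_distr mult.commute flip: smult_assoc)

lemma avg_add:
  "\<lbrakk>set ws \<subseteq> carrier A; x \<in> carrier A; y \<in> carrier A\<rbrakk> \<Longrightarrow> avg ws (x \<oplus> y) = avg ws x \<oplus> avg ws y"
  by (induction ws) (auto simp: half_avg_add)

lemma avg_smult:
  "\<lbrakk>set ws \<subseteq> carrier A; x \<in> carrier A\<rbrakk> \<Longrightarrow> avg ws (c \<odot> x) = c \<odot> avg ws x"
  by (induction ws) (auto simp: half_avg_smult)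

lemma avg_diff:
  "\<lbrakk>set ws \<subseteq> carrier A; x \<in> carrier A; y \<in> carrier A\<rbrakk> \<Longrightarrow> avg ws (x \<ominus> y) = avg ws x \<ominus> avg ws y"
  by (simp add: minus_eq_smult avg_add avg_smult)

lemma half_avg_one: "unitary_elem A w \<Longrightarrow> half_avg w \<one> = \<one>"
proof -
  have "\<one> \<oplus> \<one> = 2 \<odot> \<one>" using smult_l_distr[of \<one> 1 1] by simp
  then show "unitary_elem A w \<Longrightarrow> half_avg w \<one> = \<one>"
    by (simp add: half_avg_def unitary_elem_def flip: smult_assoc)
qed

lemma avg_one: "set ws \<subseteq> Collect (unitary_elem A) \<Longrightarrow> avg ws \<one> = \<one>"
  by (induction ws) (auto simp: half_avg_one)

lemma unitaries_closed: "set ws \<subseteq> Collect (unitary_elem A) \<Longrightarrow> set ws \<subseteq> carrier A"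
  by auto

end

text \<open>An average is a convex combination of unitary conjugates, and unitaries have seminorm at
  most 1. This serves both \<open>red\<close> on \<open>A\<close> and the norm of the enveloping
  algebra.\<close>

lemma (in star_seminorm) p_avg_le:
  assumes "set ws \<subseteq> Collect (unitary_elem A)" "x \<in> carrier A"
  shows "p (avg ws x) \<le> p x"
  using assms(1)
proof (induction ws)
  case (Cons w ws)
  let ?y = "avg ws x"
  have w: "unitary_elem A w" "w \<in> carrier A" and y: "?y \<in> carrier A"
    using Cons.prems assms(2) unitaries_closed[of ws] by auto
  have "p (w \<otimes> ?y \<otimes> \<star>w) \<le> p w * p ?y * p w"
    using w y p_mult[of "w \<otimes> ?y" "\<star>w"] p_mult[of w ?y] mult_right_mono[of "p (w \<otimes> ?y)" "p w * p ?y" "p w"]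
    by simp
  also have "\<dots> \<le> 1 * p ?y * 1"
    using w y p_unitary[of w] by (intro mult_mono) auto
  finally have "p (w \<otimes> ?y \<otimes> \<star>w) \<le> p ?y" by simp
  then have "p (?y \<oplus> w \<otimes> ?y \<otimes> \<star>w) \<le> 2 * p ?y"
    using w y p_add[of ?y "w \<otimes> ?y \<otimes> \<star>w"] by simp
  then have "p (half_avg w ?y) \<le> p ?y" using w y by (simp add: half_avg_def p_smult)
  then show ?case using Cons by simp
qed (use assms in simp)

section \<open>Kadison-Schwarz inequality; elements that average to zero\<close>

context bounded_tracial_algebra
begin

lemma red_seminorm: "star_seminorm A red"
  by (simp add: star_seminorm_def star_seminorm_axioms_def star_algebra_axioms cstar_seminorm_red)

interpretation red: star_seminorm A red by (rule red_seminorm)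

text \<open>Hypothesis \<open>dom\<close> is the operator inequality
  \<open>Y \<otimes> \<star>Y\<close> \<le> \<open>P\<close>, put as an inequality of quadratic
  forms so that positivity of elements need not be defined. It passes to averages by convexity of
  the square: |a + b|^2 \<le> 2 (|a|^2 + |b|^2).\<close>

lemma kadison_schwarz_step:
  assumes w: "unitary_elem A w" and Y: "Y \<in> carrier A" and P: "P \<in> carrier A"
    and dom: "\<And>h. h \<in> carrier A \<Longrightarrow> (l2 (\<star>Y \<otimes> h))\<^sup>2 \<le> Re (ip (P \<otimes> h) h)"
    and h: "h \<in> carrier A"
  shows "(l2 (\<star>(half_avg w Y) \<otimes> h))\<^sup>2 \<le> Re (ip (half_avg w P \<otimes> h) h)"
proof -
  have wc: "w \<in> carrier A" using w by simp
  \<comment> \<open>Twice the adjoint of \<open>half_avg w Y\<close> sends \<open>h\<close> to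
    \<open>a \<oplus> b\<close>; since \<open>w\<close> is unitary, the norm of \<open>b\<close> is
    that of \<open>\<star>Y\<close> applied to \<open>k\<close>.\<close>
  define k where "k = \<star>w \<otimes> h"
  define a where "a = \<star>Y \<otimes> h"
  define b where "b = w \<otimes> (\<star>Y \<otimes> k)"
  have k: "k \<in> carrier A" and a: "a \<in> carrier A" and b: "b \<in> carrier A"
    using wc Y h by (auto simp: k_def a_def b_def)
  have eq: "\<star>(half_avg w Y) \<otimes> h = (1/2) \<odot> (a \<oplus> b)"
    using wc Y h by (simp add: half_avg_def star_smult star_add star_mult a_def b_def k_def
        smult_mult_left l_distr m_assoc)
  have "(l2 (a \<oplus> b))\<^sup>2 \<le> (l2 a + l2 b)\<^sup>2" using a b by (intro power_mono l2_add) auto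
  also have "\<dots> \<le> 2 * ((l2 a)\<^sup>2 + (l2 b)\<^sup>2)" using zero_le_power2[of "l2 a - l2 b"]
    by (simp add: power2_eq_square algebra_simps)
  also have "\<dots> \<le> 2 * (Re (ip (P \<otimes> h) h) + Re (ip (P \<otimes> k) k))"
    using dom[OF h] dom[OF k] Y k w by (simp add: a_def b_def l2_unitary_mult_left)
  also have "ip (P \<otimes> k) k = ip (w \<otimes> P \<otimes> \<star>w \<otimes> h) h"
    using wc P h by (simp add: k_def m_assoc ip_mult_left[of w])
  also have "2 * (Re (ip (P \<otimes> h) h) + Re (ip (w \<otimes> P \<otimes> \<star>w \<otimes> h) h)) = 4 * Re (ip (half_avg w P \<otimes> h) h)"
    using wc P h by (simp add: half_avg_def smult_mult_left l_distr ip_smult_left ip_add_left)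
  finally show ?thesis
    unfolding eq using a b by (simp add: l2_smult power_mult_distrib power2_eq_square)
qed

text \<open>For the empty list the form inequality with \<open>P = Y \<otimes> \<star>Y\<close> is
  an equality, and each further unitary preserves it. Taking the supremum over \<open>h\<close>
  turns it into an inequality of norms.\<close>

lemma kadison_schwarz:
  assumes ws: "set ws \<subseteq> Collect (unitary_elem A)" and Y: "Y \<in> carrier A"
  shows "(red (avg ws Y))\<^sup>2 \<le> red (avg ws (Y \<otimes> \<star>Y))"
proof -
  let ?P = "Y \<otimes> \<star>Y"
  have "(l2 (\<star>(avg ws Y) \<otimes> h))\<^sup>2 \<le> Re (ip (avg ws ?P \<otimes> h) h)" if "h \<in> carrier A" for h
    using ws that
  proof (induction ws arbitrary: h)
    case Nil
    then show ?case using Y by (simp add: l2_mult_power2)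
  next
    case (Cons w ws)
    then show ?case
      using Y unitaries_closed[of ws] unfolding avg_Cons by (intro kadison_schwarz_step) auto
  qed
  moreover have "avg ws Y \<in> carrier A" "avg ws ?P \<in> carrier A"
    using Y unitaries_closed[OF ws] by auto
  ultimately have "(red (\<star>(avg ws Y)))\<^sup>2 \<le> red (avg ws ?P)"
    using red_ip[of "avg ws ?P"] by (intro red_power2_le) (auto intro: order_trans)
  then show ?thesis using \<open>avg ws Y \<in> carrier A\<close> by simp
qed

text \<open>Quantifying over all further averages makes this property additive.\<close>

definition null :: "'a set \<Rightarrow> 'a \<Rightarrow> bool" where
  "null U x \<longleftrightarrow> (\<forall>us\<in>lists U. \<forall>e>0. \<exists>vs\<in>lists U. red (avg vs (avg us x)) \<le> e)"

lemma nullD: assumes "null U x" "us \<in> lists U" "0 < e"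
  obtains vs where "vs \<in> lists U" "red (avg vs (avg us x)) \<le> e"
  using assms unfolding null_def by blast

text \<open>After \<open>us\<close>, choose \<open>vs\<close> making \<open>x\<close> small; then
  choose \<open>ws\<close> for \<open>y\<close> after \<open>vs @ us\<close>, which the quantifier
  over earlier averages allows. Averages are contractive, so \<open>ws\<close> does not spoil the
  estimate for \<open>x\<close>.\<close>

lemma null_add:
  assumes U: "U \<subseteq> Collect (unitary_elem A)" and x: "x \<in> carrier A" "null U x"
    and y: "y \<in> carrier A" "null U y"
  shows "null U (x \<oplus> y)"
  unfolding null_def
proof (intro ballI allI impI)
  fix us and e :: real assume us: "us \<in> lists U" and "0 < e"
  then have e: "0 < e/2" by simp
  obtain vs where vs: "vs \<in> lists U" "red (avg vs (avg us x)) \<le> e/2"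
    using nullD[OF x(2) us e] .
  have "vs @ us \<in> lists U" using vs us by simp
  from nullD[OF y(2) this e] obtain ws
    where ws: "ws \<in> lists U" "red (avg ws (avg (vs @ us) y)) \<le> e/2" .
  have set: "set us \<subseteq> Collect (unitary_elem A)" "set vs \<subseteq> Collect (unitary_elem A)"
    "set ws \<subseteq> Collect (unitary_elem A)" using us vs ws U by auto
  note cl = unitaries_closed[OF set(1)] unitaries_closed[OF set(2)] unitaries_closed[OF set(3)]
  have "avg ws (avg vs (avg us (x \<oplus> y)))
      = avg ws (avg vs (avg us x)) \<oplus> avg ws (avg vs (avg us y))"
    using cl x y by (simp add: avg_add)
  moreover have "red (avg ws (avg vs (avg us x))) \<le> e/2"
    using red.p_avg_le[OF set(3), of "avg vs (avg us x)"] vs(2) cl x by simp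
  ultimately have "red (avg (ws @ vs) (avg us (x \<oplus> y))) \<le> e"
    using ws(2) cl x y red.p_add[of "avg ws (avg vs (avg us x))" "avg ws (avg vs (avg us y))"]
    by (simp add: avg_append)
  then show "\<exists>vs\<in>lists U. red (avg vs (avg us (x \<oplus> y))) \<le> e" using vs ws by (metis append_in_lists_conv)
qed

lemma null_zero: assumes "U \<subseteq> Collect (unitary_elem A)" shows "null U \<zero>"
  unfolding null_def
proof (intro ballI allI impI)
  fix us and e :: real assume us: "us \<in> lists U" "0 < e"
  then have "avg us (0 \<odot> \<zero>) = 0 \<odot> avg us \<zero>"
    using assms by (intro avg_smult) auto
  moreover have "avg us \<zero> \<in> carrier A" using us assms by (intro avg_closed) auto
  ultimately have "avg us \<zero> = \<zero>" by simp
  then show "\<exists>vs\<in>lists U. red (avg vs (avg us \<zero>)) \<le> e" using us by (intro bexI[of _ "[]"]) auto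
qed

text \<open>Right multiplication is conjugate under the star to a left multiplication, and
  traciality makes the star isometric for \<open>l2\<close>. This is how a lower bound on
  \<open>l2 (f \<otimes> h)\<close> becomes one on \<open>l2 f\<close>.\<close>

lemma l2_mult_right_le: "\<lbrakk>x \<in> carrier A; h \<in> carrier A\<rbrakk> \<Longrightarrow> l2 (x \<otimes> h) \<le> l2 x * red h"
  using red_bound[of "\<star>h" "\<star>x"] l2_star[of "x \<otimes> h"] l2_star[of x]
  by (simp add: star_mult mult.commute)

end

section \<open>Simplicity of the enveloping algebra\<close>

lemma (in cstar_algebra) closedin_nrm_iff:
  "closedin mtopology I \<longleftrightarrow>
    I \<subseteq> carrier A \<and> (\<forall>X\<in>carrier A. (\<forall>e>0. \<exists>Y\<in>I. \<parallel>Y \<ominus> X\<parallel> < e) \<longrightarrow> X \<in> I)"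
proof (cases "I \<subseteq> carrier A")
  case True
  have "disjnt I (mball X e) \<longleftrightarrow> \<not> (\<exists>Y\<in>I. \<parallel>Y \<ominus> X\<parallel> < e)" if "X \<in> carrier A" for X e
    using that True p_minus_commute[of X] by (auto simp: disjnt_iff nrm_dist_def)
  then show ?thesis unfolding closedin_metric using True by blast
qed (auto simp: closedin_metric)

lemma (in star_algebra) unitary_mult:
  assumes "unitary_elem A x" "unitary_elem A y" shows "unitary_elem A (x \<otimes> y)"
proof -
  have xy: "x \<in> carrier A" "y \<in> carrier A" using assms by auto
  have "\<star>(x \<otimes> y) \<otimes> (x \<otimes> y) = \<star>y \<otimes> (\<star>x \<otimes> x) \<otimes> y" "(x \<otimes> y) \<otimes> \<star>(x \<otimes> y) = x \<otimes> (y \<otimes> \<star>y) \<otimes> \<star>x"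
    using xy by (simp_all add: star_mult m_assoc)
  then show ?thesis using assms xy by (simp add: unitary_elem_def)
qed

locale tracial_enveloping = bounded_tracial_algebra A tr + enveloping A
  for A :: "'a normed_star" (structure) and tr
begin

abbreviation "EA \<equiv> cstar_envelope A"
abbreviation "emb \<equiv> envelope_embed A"

interpretation red: star_seminorm A red by (rule red_seminorm)
interpretation EA: cstar_algebra EA by (rule envelope_cstar_algebra)

lemmas emb_simps = star_homD[OF envelope_embed_hom] envelope_embed_nrm

lemma emb_diff:
  "\<lbrakk>x \<in> carrier A; y \<in> carrier A\<rbrakk> \<Longrightarrow> emb (x \<ominus> y) = emb x \<ominus>\<^bsub>EA\<^esub> emb y"
  by (simp add: minus_eq_smult EA.minus_eq_smult emb_simps)

lemma red_le_envelope: "x \<in> carrier A \<Longrightarrow> red x \<le> envelope_norm A x"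
  by (rule seminorm_le[OF cstar_seminorm_red])

lemma emb_unitary: "unitary_elem A w \<Longrightarrow> unitary_elem EA (emb w)"
  by (rule star_hom_unitary[OF envelope_embed_hom])

lemma emb_avg:
  "\<lbrakk>set ws \<subseteq> carrier A; x \<in> carrier A\<rbrakk> \<Longrightarrow> emb (avg ws x) = EA.avg (map emb ws) (emb x)"
  by (induction ws) (auto simp: half_avg_def EA.half_avg_def emb_simps)

lemma ideal_avg:
  assumes I: "ideal I EA" and ws: "set ws \<subseteq> carrier EA" and x: "x \<in> I"
  shows "EA.avg ws x \<in> I"
proof -
  interpret I: ideal I EA by fact
  \<comment> \<open>A ring ideal is closed under scalars because \<open>c \<odot> \<one>\<close>
    belongs to the algebra.\<close>
  have sm: "c \<odot>\<^bsub>EA\<^esub> y \<in> I" if "y \<in> I" for c y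
  proof -
    have "c \<odot>\<^bsub>EA\<^esub> y = (c \<odot>\<^bsub>EA\<^esub> \<one>\<^bsub>EA\<^esub>) \<otimes>\<^bsub>EA\<^esub> y"
      using I.Icarr[OF that] by (simp add: EA.smult_mult_left)
    then show ?thesis using I.I_l_closed[OF that, of "c \<odot>\<^bsub>EA\<^esub> \<one>\<^bsub>EA\<^esub>"] by simp
  qed
  show ?thesis using ws
  proof (induction ws)
    case (Cons w ws)
    let ?y = "EA.avg ws x"
    have w: "w \<in> carrier EA" and y: "?y \<in> I" using Cons by auto
    have "w \<otimes>\<^bsub>EA\<^esub> ?y \<otimes>\<^bsub>EA\<^esub> \<star>\<^bsub>EA\<^esub>w \<in> I"
      using I.I_r_closed[OF I.I_l_closed[OF y w]] w by simp
    then show ?case using y by (simp add: EA.half_avg_def sm I.a_closed)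
  qed (use x in simp)
qed

lemma envelope_one_neq_zero: "\<one>\<^bsub>EA\<^esub> \<noteq> \<zero>\<^bsub>EA\<^esub>"
proof
  assume "\<one>\<^bsub>EA\<^esub> = \<zero>\<^bsub>EA\<^esub>"
  then have "envelope_norm A \<one> = 0"
    using emb_simps(4,7)[of \<one>] EA.p_zero by (metis one_closed)
  then show False using red_le_envelope[of \<one>] l2_le_red[of \<one>] by (simp add: l2_one)
qed

text \<open>The scalar approached by averages of \<open>\<star>X \<otimes> X\<close> should be its
  trace, but the trace is defined on \<open>A\<close> only. It is replaced by the trace of
  \<open>\<star>f \<otimes> f\<close> for \<open>f\<close> near \<open>X\<close>; a lower bound on
  \<open>l2 f\<close>, uniform in such \<open>f\<close>, allows dividing by it. By
  \<open>amenable\<close> the norm of \<open>emb x\<close> equals \<open>red x\<close>, so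
  \<open>null\<close> gives smallness in the enveloping algebra.\<close>

theorem simple_envelope:
  assumes U: "U \<subseteq> Collect (unitary_elem A)"
    and amenable: "\<And>x. x \<in> carrier A \<Longrightarrow> envelope_norm A x \<le> red x"
    and null: "\<And>x. x \<in> carrier A \<Longrightarrow> null U (x \<ominus> tr x \<odot> \<one>)"
  shows "cstar_simple EA"
  unfolding cstar_simple_def
proof (intro conjI allI impI)
  show "carrier EA \<noteq> {\<zero>\<^bsub>EA\<^esub>}" using envelope_one_neq_zero EA.one_closed by blast
  fix I assume I: "closed_ideal I EA"
  then interpret I: ideal I EA by (simp add: closed_ideal_def)
  have cl: "X \<in> I" if "X \<in> carrier EA" "\<And>e. 0 < e \<Longrightarrow> \<exists>Y\<in>I. \<parallel>Y \<ominus>\<^bsub>EA\<^esub> X\<parallel>\<^bsub>EA\<^esub> < e" for X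
    using I that unfolding closed_ideal_def EA.closedin_nrm_iff by blast
  have nrm: "\<parallel>emb x\<parallel>\<^bsub>EA\<^esub> = red x" if "x \<in> carrier A" for x
    using that amenable[OF that] red_le_envelope[OF that] by (simp add: emb_simps)
  have "\<one>\<^bsub>EA\<^esub> \<in> I" if XI: "X \<in> I" and X0: "X \<noteq> \<zero>\<^bsub>EA\<^esub>" for X
  proof -
    have X: "X \<in> carrier EA" using XI by (rule I.Icarr)
    \<comment> \<open>The norm of \<open>X\<close> is 4d. An approximant \<open>f0\<close> within d
      has norm above 3d, and every other \<open>f\<close> within d of \<open>X\<close> is at most 2d
      away from \<open>f0\<close>; a margin of d remains.\<close>
    define d where "d = \<parallel>X\<parallel>\<^bsub>EA\<^esub> / 4"
    have d: "0 < d" using EA.nrm_eq_0[OF X] X0 EA.p_nonneg[OF X] by (auto simp: d_def less_le)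
    obtain f0 where f0: "f0 \<in> carrier A" "\<parallel>emb f0 \<ominus>\<^bsub>EA\<^esub> X\<parallel>\<^bsub>EA\<^esub> < d"
      using envelope_embed_dense[OF X d] .
    have "3 * d < red f0"
      using EA.p_diff_abs[of "emb f0" X] f0 X nrm[OF f0(1)] by (simp add: emb_simps d_def)
    then obtain h where h: "h \<in> carrier A" "3 * d * l2 h < l2 (f0 \<otimes> h)"
      using red_le[of "3 * d" f0] d by (meson less_eq_real_def mult_nonneg_nonneg not_le zero_le_numeral)
    have h0: "0 < l2 h" using h f0 l2_pos[of h] by (cases "h = \<zero>") auto
    have rh: "0 < red h" using l2_le_red[OF h(1)] h0 by simp
    \<comment> \<open>Each \<open>f\<close> within d of \<open>X\<close> satisfies
      \<open>d * l2 h \<le> l2 (f \<otimes> h)\<close>, and the right side is at most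
      \<open>l2 f * red h\<close>.\<close>
    define \<eta> where "\<eta> = d * l2 h / red h"
    have \<eta>: "0 < \<eta>" using d h0 rh by (simp add: \<eta>_def)
    text \<open>The trace of \<open>X\<^sup>*X\<close> is positive: the 2-norm is bounded below near \<open>X\<close>.\<close>
    have lower: "\<eta> \<le> l2 f" if f: "f \<in> carrier A" "\<parallel>emb f \<ominus>\<^bsub>EA\<^esub> X\<parallel>\<^bsub>EA\<^esub> < d" for f
    proof -
      have "red (f0 \<ominus> f) \<le> \<parallel>emb f0 \<ominus>\<^bsub>EA\<^esub> X\<parallel>\<^bsub>EA\<^esub> + \<parallel>X \<ominus>\<^bsub>EA\<^esub> emb f\<parallel>\<^bsub>EA\<^esub>"
        using EA.p_triangle[of "emb f0" X "emb f"] f f0 X nrm[of "f0 \<ominus> f"]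
        by (simp add: emb_simps emb_diff)
      also have "\<dots> \<le> 2 * d" using f f0 X EA.p_minus_commute[of X "emb f"] by (simp add: emb_simps)
      finally have r: "red (f0 \<ominus> f) \<le> 2 * d" .
      have "f0 \<otimes> h \<ominus> f \<otimes> h = (f0 \<ominus> f) \<otimes> h"
        using f f0 h by (simp add: minus_eq l_distr l_minus)
      then have "l2 (f0 \<otimes> h) - l2 (f \<otimes> h) \<le> red (f0 \<ominus> f) * l2 h"
        using l2_diff_ge[of "f0 \<otimes> h" "f \<otimes> h"] red_bound[of "f0 \<ominus> f" h] f f0 h by simp
      also have "\<dots> \<le> 2 * d * l2 h" using r h0 by (intro mult_right_mono) auto
      finally have "d * l2 h \<le> l2 (f \<otimes> h)" using h(2) by simp
      also have "\<dots> \<le> l2 f * red h" using f h by (intro l2_mult_right_le)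
      finally show ?thesis using rh by (simp add: \<eta>_def pos_divide_le_eq)
    qed
    show ?thesis
    proof (rule cl)
      fix \<epsilon> :: real assume \<epsilon>: "0 < \<epsilon>"
      \<comment> \<open>Two errors of size \<tau> arise, one from replacing \<open>X\<close> by
        \<open>F\<close> and one from averaging. Divided by \<open>t\<close>, which is at least the
        square of \<eta>, they add up to at most \<epsilon> / 2.\<close>
      define \<tau> where "\<tau> = \<epsilon> * \<eta>\<^sup>2 / 4"
      have \<tau>: "0 < \<tau>" using \<epsilon> \<eta> by (simp add: \<tau>_def)
      \<comment> \<open>Bounds the sum of the norms of \<open>F\<close> and \<open>X\<close>, the
        factor by which the distance of \<open>F\<close> and \<open>X\<close> is multiplied when
        passing to \<open>\<star>F \<otimes> F\<close> and
        \<open>\<star>X \<otimes> X\<close>.\<close>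
      define B where "B = 2 * \<parallel>X\<parallel>\<^bsub>EA\<^esub> + d"
      have B: "0 < B" using d X by (simp add: B_def add_nonneg_pos)
      define e where "e = min d (\<tau> / B)"
      have "0 < e" "e \<le> d" "e \<le> \<tau> / B" using d \<tau> B by (auto simp: e_def)
      then have e: "0 < e" "e \<le> d" "e * B \<le> \<tau>" using B by (auto simp: pos_le_divide_eq)
      obtain f where f: "f \<in> carrier A" "\<parallel>emb f \<ominus>\<^bsub>EA\<^esub> X\<parallel>\<^bsub>EA\<^esub> < e"
        using envelope_embed_dense[OF X e(1)] .
      define F where "F = emb f"
      have F: "F \<in> carrier EA" "\<parallel>F \<ominus>\<^bsub>EA\<^esub> X\<parallel>\<^bsub>EA\<^esub> < e" using f by (auto simp: F_def emb_simps)
      define g where "g = \<star>f \<otimes> f"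
      have g: "g \<in> carrier A" using f by (simp add: g_def)
      define t where "t = (l2 f)\<^sup>2"
      have trg: "tr g = of_real t" using ip_self[OF f(1)] by (simp add: g_def ip_def t_def)
      have t: "\<eta>\<^sup>2 \<le> t" "0 < t"
      proof -
        have "\<eta> \<le> l2 f" using lower[of f] f e by simp
        then show "\<eta>\<^sup>2 \<le> t" unfolding t_def using \<eta> by (intro power_mono) auto
        then show "0 < t" using \<eta> by (meson less_le_trans zero_less_power)
      qed
      have XX: "\<star>\<^bsub>EA\<^esub>X \<otimes>\<^bsub>EA\<^esub> X \<in> I" using I.I_l_closed[OF XI, of "\<star>\<^bsub>EA\<^esub>X"] X by simp
      have "\<parallel>F\<parallel>\<^bsub>EA\<^esub> \<le> \<parallel>X\<parallel>\<^bsub>EA\<^esub> + d" using EA.p_diff_abs[OF F(1) X] F(2) e by simp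
      then have near: "\<parallel>\<star>\<^bsub>EA\<^esub>F \<otimes>\<^bsub>EA\<^esub> F \<ominus>\<^bsub>EA\<^esub> \<star>\<^bsub>EA\<^esub>X \<otimes>\<^bsub>EA\<^esub> X\<parallel>\<^bsub>EA\<^esub> \<le> \<tau>"
      proof -
        have "\<parallel>\<star>\<^bsub>EA\<^esub>F \<otimes>\<^bsub>EA\<^esub> F \<ominus>\<^bsub>EA\<^esub> \<star>\<^bsub>EA\<^esub>X \<otimes>\<^bsub>EA\<^esub> X\<parallel>\<^bsub>EA\<^esub> \<le>
            \<parallel>(\<star>\<^bsub>EA\<^esub>F \<ominus>\<^bsub>EA\<^esub> \<star>\<^bsub>EA\<^esub>X) \<otimes>\<^bsub>EA\<^esub> F\<parallel>\<^bsub>EA\<^esub> + \<parallel>\<star>\<^bsub>EA\<^esub>X \<otimes>\<^bsub>EA\<^esub> (F \<ominus>\<^bsub>EA\<^esub> X)\<parallel>\<^bsub>EA\<^esub>"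
          using F X by (subst EA.mult_diff) (auto intro!: EA.p_add)
        also have "\<dots> \<le> \<parallel>\<star>\<^bsub>EA\<^esub>F \<ominus>\<^bsub>EA\<^esub> \<star>\<^bsub>EA\<^esub>X\<parallel>\<^bsub>EA\<^esub> * \<parallel>F\<parallel>\<^bsub>EA\<^esub> + \<parallel>\<star>\<^bsub>EA\<^esub>X\<parallel>\<^bsub>EA\<^esub> * \<parallel>F \<ominus>\<^bsub>EA\<^esub> X\<parallel>\<^bsub>EA\<^esub>"
          using F X by (intro add_mono EA.p_mult) auto
        also have "\<dots> = \<parallel>F \<ominus>\<^bsub>EA\<^esub> X\<parallel>\<^bsub>EA\<^esub> * (\<parallel>F\<parallel>\<^bsub>EA\<^esub> + \<parallel>X\<parallel>\<^bsub>EA\<^esub>)"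
          using F X by (simp add: EA.star_diff algebra_simps)
        also have "\<dots> \<le> e * B"
          using F X \<open>\<parallel>F\<parallel>\<^bsub>EA\<^esub> \<le> \<parallel>X\<parallel>\<^bsub>EA\<^esub> + d\<close> e by (intro mult_mono) (auto simp: B_def)
        finally show ?thesis using e by simp
      qed
      obtain vs where vs: "vs \<in> lists U" "red (avg vs (avg [] (g \<ominus> tr g \<odot> \<one>))) \<le> \<tau>"
        using nullD[OF null[OF g] lists.Nil \<tau>] .
      have vU: "set vs \<subseteq> Collect (unitary_elem A)" using vs U by auto
      have vc: "set vs \<subseteq> carrier A" using vU by (rule unitaries_closed)
      define Vs where "Vs = map emb vs"
      have VU: "set Vs \<subseteq> Collect (unitary_elem EA)" using vU by (auto simp: Vs_def emb_unitary)
      have Vc: "set Vs \<subseteq> carrier EA" using VU by (rule EA.unitaries_closed)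
      define Z where "Z = EA.avg Vs (\<star>\<^bsub>EA\<^esub>X \<otimes>\<^bsub>EA\<^esub> X)"
      have Z: "Z \<in> I" unfolding Z_def using XX Vc I.ideal_axioms by (intro ideal_avg)
      have Zc: "Z \<in> carrier EA" using Z by (rule I.Icarr)
      define W where "W = EA.avg Vs (\<star>\<^bsub>EA\<^esub>F \<otimes>\<^bsub>EA\<^esub> F)"
      have Wc: "W \<in> carrier EA" unfolding W_def using Vc F by simp
      have W: "W = emb (avg vs g)"
        using f by (simp add: W_def Vs_def g_def F_def emb_avg vc emb_simps)
      have "Z \<ominus>\<^bsub>EA\<^esub> W = EA.avg Vs (\<star>\<^bsub>EA\<^esub>X \<otimes>\<^bsub>EA\<^esub> X \<ominus>\<^bsub>EA\<^esub> \<star>\<^bsub>EA\<^esub>F \<otimes>\<^bsub>EA\<^esub> F)"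
        unfolding Z_def W_def using Vc F X by (simp add: EA.avg_diff)
      then have ZW: "\<parallel>Z \<ominus>\<^bsub>EA\<^esub> W\<parallel>\<^bsub>EA\<^esub> \<le> \<tau>"
        using EA.p_avg_le[OF VU, of "\<star>\<^bsub>EA\<^esub>X \<otimes>\<^bsub>EA\<^esub> X \<ominus>\<^bsub>EA\<^esub> \<star>\<^bsub>EA\<^esub>F \<otimes>\<^bsub>EA\<^esub> F"] near F X
          EA.p_minus_commute[of "\<star>\<^bsub>EA\<^esub>X \<otimes>\<^bsub>EA\<^esub> X" "\<star>\<^bsub>EA\<^esub>F \<otimes>\<^bsub>EA\<^esub> F"] by simp
      have "avg vs (g \<ominus> tr g \<odot> \<one>) = avg vs g \<ominus> of_real t \<odot> \<one>"
        using vc g by (simp add: avg_diff avg_smult avg_one[OF vU] trg)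
      then have "\<parallel>W \<ominus>\<^bsub>EA\<^esub> of_real t \<odot>\<^bsub>EA\<^esub> \<one>\<^bsub>EA\<^esub>\<parallel>\<^bsub>EA\<^esub> \<le> \<tau>"
        using vs(2) vc g nrm[of "avg vs g \<ominus> of_real t \<odot> \<one>"] emb_simps(4)[of \<one>]
        by (simp add: W emb_diff emb_simps(2))
      then have Zt: "\<parallel>Z \<ominus>\<^bsub>EA\<^esub> of_real t \<odot>\<^bsub>EA\<^esub> \<one>\<^bsub>EA\<^esub>\<parallel>\<^bsub>EA\<^esub> \<le> 2 * \<tau>"
        using EA.p_triangle[of Z W "of_real t \<odot>\<^bsub>EA\<^esub> \<one>\<^bsub>EA\<^esub>"] ZW Zc Wc by simp
      define V where "V = of_real (1/t) \<odot>\<^bsub>EA\<^esub> Z"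
      have "V = (of_real (1/t) \<odot>\<^bsub>EA\<^esub> \<one>\<^bsub>EA\<^esub>) \<otimes>\<^bsub>EA\<^esub> Z"
        using Zc by (simp add: V_def EA.smult_mult_left)
      then have VI: "V \<in> I" using I.I_l_closed[OF Z] by simp
      have "V \<ominus>\<^bsub>EA\<^esub> \<one>\<^bsub>EA\<^esub> = of_real (1/t) \<odot>\<^bsub>EA\<^esub> (Z \<ominus>\<^bsub>EA\<^esub> of_real t \<odot>\<^bsub>EA\<^esub> \<one>\<^bsub>EA\<^esub>)"
        using Zc t by (simp add: V_def EA.smult_diff[symmetric] flip: EA.smult_assoc)
      then have "\<parallel>V \<ominus>\<^bsub>EA\<^esub> \<one>\<^bsub>EA\<^esub>\<parallel>\<^bsub>EA\<^esub> \<le> 2 * \<tau> / t"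
        using Zc t Zt by (simp add: EA.p_smult norm_divide divide_right_mono)
      also have "\<dots> \<le> 2 * \<tau> / \<eta>\<^sup>2" using t \<tau> \<eta> by (intro divide_left_mono) auto
      also have "\<dots> < \<epsilon>" using \<epsilon> \<eta> by (simp add: \<tau>_def)
      finally have "\<parallel>V \<ominus>\<^bsub>EA\<^esub> \<one>\<^bsub>EA\<^esub>\<parallel>\<^bsub>EA\<^esub> < \<epsilon>" .
      then show "\<exists>Y\<in>I. \<parallel>Y \<ominus>\<^bsub>EA\<^esub> \<one>\<^bsub>EA\<^esub>\<parallel>\<^bsub>EA\<^esub> < \<epsilon>" using VI by blast
    qed simp
  qed
  then show "I = {\<zero>\<^bsub>EA\<^esub>} \<or> I = carrier EA"
    using I.one_imp_carrier I.zero_closed by blast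
qed


text \<open>The vanishing traces make the powers of \<open>w\<close> orthonormal, so
  \<open>w\<close> acts on them as a shift and has approximate fixed vectors: the sum of the first
  \<open>M\<close> powers has 2-norm \<open>sqrt M\<close>, but \<open>w \<ominus> \<one>\<close>
  telescopes on it to 2-norm at most 2. Therefore no multiple of \<open>w \<ominus> \<one>\<close>
  comes close to \<open>\<one>\<close>, and the closed ideal it generates is proper.\<close>

theorem not_simple_envelope:
  assumes w: "unitary_elem A w" and central: "\<And>x. x \<in> carrier A \<Longrightarrow> w \<otimes> x = x \<otimes> w"
    and tr_pow: "\<And>k::nat. 0 < k \<Longrightarrow> tr (w [^] k) = 0"
  shows "\<not> cstar_simple EA"
proof
  assume simple: "cstar_simple EA"
  have wc [simp]: "w \<in> carrier A" using w by simp
  define d where "d = w \<ominus> \<one>"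
  have d [simp]: "d \<in> carrier A" by (simp add: d_def)
  have d_central: "d \<otimes> x = x \<otimes> d" if "x \<in> carrier A" for x
    using that central[OF that] by (simp add: d_def minus_eq l_distr r_distr l_minus r_minus)
  have "tr w = 0" using tr_pow[of 1] by simp
  then have "tr d = - 1" by (simp add: d_def minus_eq_smult tr_add tr_smult tr_one)
  then have d0: "d \<noteq> \<zero>" by auto
  \<comment> \<open>The closure of the image of \<open>d A\<close>, which is already a two-sided
    ideal of \<open>A\<close>, as \<open>d\<close> is central. Closure is expressed by approximation
    from \<open>A\<close>.\<close>
  define I where "I = {X \<in> carrier EA. \<forall>e>0. \<exists>f\<in>carrier A. \<parallel>emb (d \<otimes> f) \<ominus>\<^bsub>EA\<^esub> X\<parallel>\<^bsub>EA\<^esub> < e}"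
  have ec: "emb x \<in> carrier EA" if "x \<in> carrier A" for x using that by (simp add: emb_simps)
  have ID: "\<exists>f\<in>carrier A. \<parallel>emb (d \<otimes> f) \<ominus>\<^bsub>EA\<^esub> X\<parallel>\<^bsub>EA\<^esub> < e" if "X \<in> I" "0 < e" for X e
    using that by (simp add: I_def)
  have II: "emb (d \<otimes> f) \<in> I" if "f \<in> carrier A" for f
    using that ec[of "d \<otimes> f"] by (auto simp: I_def intro!: bexI[of _ f])
  have closure: "X \<in> I"
    if X: "X \<in> carrier EA" and near: "\<And>e. 0 < e \<Longrightarrow> \<exists>Y\<in>I. \<parallel>Y \<ominus>\<^bsub>EA\<^esub> X\<parallel>\<^bsub>EA\<^esub> < e" for X
    unfolding I_def
  proof (intro CollectI conjI allI impI X)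
    fix e :: real assume "0 < e"
    then have e: "0 < e/2" by simp
    obtain Y where Y: "Y \<in> I" "\<parallel>Y \<ominus>\<^bsub>EA\<^esub> X\<parallel>\<^bsub>EA\<^esub> < e/2" using near[OF e] by blast
    obtain f where f: "f \<in> carrier A" "\<parallel>emb (d \<otimes> f) \<ominus>\<^bsub>EA\<^esub> Y\<parallel>\<^bsub>EA\<^esub> < e/2" using ID[OF Y(1) e] by blast
    have "\<parallel>emb (d \<otimes> f) \<ominus>\<^bsub>EA\<^esub> X\<parallel>\<^bsub>EA\<^esub> < e"
      using EA.p_triangle[of "emb (d \<otimes> f)" Y X] Y f X ec[of "d \<otimes> f"] by (simp add: I_def)
    then show "\<exists>f\<in>carrier A. \<parallel>emb (d \<otimes> f) \<ominus>\<^bsub>EA\<^esub> X\<parallel>\<^bsub>EA\<^esub> < e" using f by blast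
  qed
  text \<open>Closure under an operation follows from closure on the dense part \<open>emb ` d A\<close>.\<close>
  have lipschitz: "T X \<in> I"
    if X: "X \<in> I" and T: "\<And>Y. Y \<in> carrier EA \<Longrightarrow> T Y \<in> carrier EA" and K: "0 < K"
      and lip: "\<And>Y. Y \<in> carrier EA \<Longrightarrow> \<parallel>T Y \<ominus>\<^bsub>EA\<^esub> T X\<parallel>\<^bsub>EA\<^esub> \<le> K * \<parallel>Y \<ominus>\<^bsub>EA\<^esub> X\<parallel>\<^bsub>EA\<^esub>"
      and mem: "\<And>f. f \<in> carrier A \<Longrightarrow> T (emb (d \<otimes> f)) \<in> I" for X T K
  proof (rule closure)
    show "T X \<in> carrier EA" using T X by (simp add: I_def)
    fix e :: real assume e: "0 < e"
    obtain f where f: "f \<in> carrier A" "\<parallel>emb (d \<otimes> f) \<ominus>\<^bsub>EA\<^esub> X\<parallel>\<^bsub>EA\<^esub> < e / K"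
      using ID[OF X, of "e / K"] e K by auto
    have "\<parallel>T (emb (d \<otimes> f)) \<ominus>\<^bsub>EA\<^esub> T X\<parallel>\<^bsub>EA\<^esub> \<le> K * \<parallel>emb (d \<otimes> f) \<ominus>\<^bsub>EA\<^esub> X\<parallel>\<^bsub>EA\<^esub>"
      using f ec by (intro lip) auto
    also have "\<dots> < e" using f K by (simp add: pos_less_divide_eq mult.commute)
    finally show "\<exists>Y\<in>I. \<parallel>Y \<ominus>\<^bsub>EA\<^esub> T X\<parallel>\<^bsub>EA\<^esub> < e" using mem f by blast
  qed
  have Icarr: "X \<in> carrier EA" if "X \<in> I" for X using that by (simp add: I_def)
  have lmult: "Y \<otimes>\<^bsub>EA\<^esub> X \<in> I" and rmult: "X \<otimes>\<^bsub>EA\<^esub> Y \<in> I"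
    if X: "X \<in> I" and Y: "Y \<in> carrier EA" for X Y
  proof -
    \<comment> \<open>The summand 1 keeps the Lipschitz constant positive for elements of norm
      0.\<close>
    have K: "0 < \<parallel>Z\<parallel>\<^bsub>EA\<^esub> + 1" if "Z \<in> carrier EA" for Z using EA.p_nonneg[OF that] by linarith
    have diff_l: "V \<otimes>\<^bsub>EA\<^esub> Z \<ominus>\<^bsub>EA\<^esub> V \<otimes>\<^bsub>EA\<^esub> Z' = V \<otimes>\<^bsub>EA\<^esub> (Z \<ominus>\<^bsub>EA\<^esub> Z')"
      and diff_r: "Z \<otimes>\<^bsub>EA\<^esub> V \<ominus>\<^bsub>EA\<^esub> Z' \<otimes>\<^bsub>EA\<^esub> V = (Z \<ominus>\<^bsub>EA\<^esub> Z') \<otimes>\<^bsub>EA\<^esub> V"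
      if "V \<in> carrier EA" "Z \<in> carrier EA" "Z' \<in> carrier EA" for V Z Z'
      using that by (simp_all add: EA.minus_eq EA.l_distr EA.r_distr EA.l_minus EA.r_minus)
    have lip_l: "\<parallel>V \<otimes>\<^bsub>EA\<^esub> Z \<ominus>\<^bsub>EA\<^esub> V \<otimes>\<^bsub>EA\<^esub> Z'\<parallel>\<^bsub>EA\<^esub> \<le> (\<parallel>V\<parallel>\<^bsub>EA\<^esub> + 1) * \<parallel>Z \<ominus>\<^bsub>EA\<^esub> Z'\<parallel>\<^bsub>EA\<^esub>"
      and lip_r: "\<parallel>Z \<otimes>\<^bsub>EA\<^esub> V \<ominus>\<^bsub>EA\<^esub> Z' \<otimes>\<^bsub>EA\<^esub> V\<parallel>\<^bsub>EA\<^esub> \<le> (\<parallel>V\<parallel>\<^bsub>EA\<^esub> + 1) * \<parallel>Z \<ominus>\<^bsub>EA\<^esub> Z'\<parallel>\<^bsub>EA\<^esub>"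
      if "V \<in> carrier EA" "Z \<in> carrier EA" "Z' \<in> carrier EA" for V Z Z'
    proof -
      have "0 \<le> \<parallel>Z \<ominus>\<^bsub>EA\<^esub> Z'\<parallel>\<^bsub>EA\<^esub>" using that by simp
      with that show "\<parallel>V \<otimes>\<^bsub>EA\<^esub> Z \<ominus>\<^bsub>EA\<^esub> V \<otimes>\<^bsub>EA\<^esub> Z'\<parallel>\<^bsub>EA\<^esub> \<le> (\<parallel>V\<parallel>\<^bsub>EA\<^esub> + 1) * \<parallel>Z \<ominus>\<^bsub>EA\<^esub> Z'\<parallel>\<^bsub>EA\<^esub>"
        using EA.p_mult[of V "Z \<ominus>\<^bsub>EA\<^esub> Z'"] unfolding diff_l[OF that]
        by (simp add: distrib_right del: EA.p_nonneg)
      from that \<open>0 \<le> \<parallel>Z \<ominus>\<^bsub>EA\<^esub> Z'\<parallel>\<^bsub>EA\<^esub>\<close>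
      show "\<parallel>Z \<otimes>\<^bsub>EA\<^esub> V \<ominus>\<^bsub>EA\<^esub> Z' \<otimes>\<^bsub>EA\<^esub> V\<parallel>\<^bsub>EA\<^esub> \<le> (\<parallel>V\<parallel>\<^bsub>EA\<^esub> + 1) * \<parallel>Z \<ominus>\<^bsub>EA\<^esub> Z'\<parallel>\<^bsub>EA\<^esub>"
        using EA.p_mult[of "Z \<ominus>\<^bsub>EA\<^esub> Z'" V] unfolding diff_r[OF that]
        by (simp add: distrib_right mult.commute del: EA.p_nonneg)
    qed
    have dense: "\<exists>h\<in>carrier A. \<parallel>emb h \<ominus>\<^bsub>EA\<^esub> Y\<parallel>\<^bsub>EA\<^esub> < e / (\<parallel>emb (d \<otimes> f)\<parallel>\<^bsub>EA\<^esub> + 1)"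
      if "0 < e" "f \<in> carrier A" for e f
      using envelope_embed_dense[OF Y, of "e / (\<parallel>emb (d \<otimes> f)\<parallel>\<^bsub>EA\<^esub> + 1)"] that K[OF ec[of "d \<otimes> f"]]
      by (metis d divide_pos_pos m_closed)
    have eq: "emb h \<otimes>\<^bsub>EA\<^esub> emb (d \<otimes> f) = emb (d \<otimes> (h \<otimes> f))"
      "emb (d \<otimes> f) \<otimes>\<^bsub>EA\<^esub> emb h = emb (d \<otimes> (f \<otimes> h))" if "f \<in> carrier A" "h \<in> carrier A" for f h
    proof -
      have "h \<otimes> (d \<otimes> f) = d \<otimes> (h \<otimes> f)" using that d_central[of h] by (simp add: m_assoc[symmetric])
      then show "emb h \<otimes>\<^bsub>EA\<^esub> emb (d \<otimes> f) = emb (d \<otimes> (h \<otimes> f))"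
        using that emb_simps(6)[of h "d \<otimes> f"] by simp
      show "emb (d \<otimes> f) \<otimes>\<^bsub>EA\<^esub> emb h = emb (d \<otimes> (f \<otimes> h))"
        using that emb_simps(6)[of "d \<otimes> f" h] by (simp add: m_assoc)
    qed
    \<comment> \<open>\<open>lipschitz\<close> reduces to an ideal element
      \<open>emb (d \<otimes> f)\<close>; then \<open>Y\<close> is approximated by
      \<open>emb h\<close>, and centrality of \<open>d\<close> puts the product into the image of
      \<open>d A\<close>.\<close>
    show "Y \<otimes>\<^bsub>EA\<^esub> X \<in> I"
    proof (rule lipschitz[OF X _ K[OF Y]])
      fix f assume f: "f \<in> carrier A"
      show "Y \<otimes>\<^bsub>EA\<^esub> emb (d \<otimes> f) \<in> I"
      proof (rule closure)
        fix e :: real assume "0 < e"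
        then obtain h where h: "h \<in> carrier A"
          "\<parallel>emb h \<ominus>\<^bsub>EA\<^esub> Y\<parallel>\<^bsub>EA\<^esub> < e / (\<parallel>emb (d \<otimes> f)\<parallel>\<^bsub>EA\<^esub> + 1)" using dense f by blast
        have "\<parallel>emb h \<otimes>\<^bsub>EA\<^esub> emb (d \<otimes> f) \<ominus>\<^bsub>EA\<^esub> Y \<otimes>\<^bsub>EA\<^esub> emb (d \<otimes> f)\<parallel>\<^bsub>EA\<^esub> < e"
          using lip_r[of "emb (d \<otimes> f)" "emb h" Y] h f Y ec K[OF ec[of "d \<otimes> f"]]
          by (simp add: pos_less_divide_eq mult.commute)
        then show "\<exists>Z\<in>I. \<parallel>Z \<ominus>\<^bsub>EA\<^esub> Y \<otimes>\<^bsub>EA\<^esub> emb (d \<otimes> f)\<parallel>\<^bsub>EA\<^esub> < e"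
          using eq[OF f h(1)] II[of "h \<otimes> f"] h f by force
      qed (use Y f ec in auto)
    qed (use X Y Icarr lip_l in auto)
    show "X \<otimes>\<^bsub>EA\<^esub> Y \<in> I"
    proof (rule lipschitz[OF X _ K[OF Y]])
      fix f assume f: "f \<in> carrier A"
      show "emb (d \<otimes> f) \<otimes>\<^bsub>EA\<^esub> Y \<in> I"
      proof (rule closure)
        fix e :: real assume "0 < e"
        then obtain h where h: "h \<in> carrier A"
          "\<parallel>emb h \<ominus>\<^bsub>EA\<^esub> Y\<parallel>\<^bsub>EA\<^esub> < e / (\<parallel>emb (d \<otimes> f)\<parallel>\<^bsub>EA\<^esub> + 1)" using dense f by blast
        have "\<parallel>emb (d \<otimes> f) \<otimes>\<^bsub>EA\<^esub> emb h \<ominus>\<^bsub>EA\<^esub> emb (d \<otimes> f) \<otimes>\<^bsub>EA\<^esub> Y\<parallel>\<^bsub>EA\<^esub> < e"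
          using lip_l[of "emb (d \<otimes> f)" "emb h" Y] h f Y ec K[OF ec[of "d \<otimes> f"]]
          by (simp add: pos_less_divide_eq mult.commute)
        then show "\<exists>Z\<in>I. \<parallel>Z \<ominus>\<^bsub>EA\<^esub> emb (d \<otimes> f) \<otimes>\<^bsub>EA\<^esub> Y\<parallel>\<^bsub>EA\<^esub> < e"
          using eq[OF f h(1)] II[of "f \<otimes> h"] h f by force
      qed (use Y f ec in auto)
    qed (use X Y Icarr lip_r in auto)
  qed
  have add: "X \<oplus>\<^bsub>EA\<^esub> Y \<in> I" if X: "X \<in> I" and Y: "Y \<in> I" for X Y
  proof (rule closure)
    fix e :: real assume "0 < e"
    then have e: "0 < e/2" by simp
    obtain f where f: "f \<in> carrier A" "\<parallel>emb (d \<otimes> f) \<ominus>\<^bsub>EA\<^esub> X\<parallel>\<^bsub>EA\<^esub> < e/2" using ID[OF X e] by blast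
    obtain h where h: "h \<in> carrier A" "\<parallel>emb (d \<otimes> h) \<ominus>\<^bsub>EA\<^esub> Y\<parallel>\<^bsub>EA\<^esub> < e/2" using ID[OF Y e] by blast
    have "emb (d \<otimes> (f \<oplus> h)) = emb (d \<otimes> f) \<oplus>\<^bsub>EA\<^esub> emb (d \<otimes> h)"
      using f h emb_simps(5)[of "d \<otimes> f" "d \<otimes> h"] by (simp add: r_distr)
    then have "\<parallel>emb (d \<otimes> (f \<oplus> h)) \<ominus>\<^bsub>EA\<^esub> (X \<oplus>\<^bsub>EA\<^esub> Y)\<parallel>\<^bsub>EA\<^esub> < e"
      using f h Icarr X Y ec EA.p_add[of "emb (d \<otimes> f) \<ominus>\<^bsub>EA\<^esub> X" "emb (d \<otimes> h) \<ominus>\<^bsub>EA\<^esub> Y"]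
      by (simp add: EA.add_diff)
    then show "\<exists>Z\<in>I. \<parallel>Z \<ominus>\<^bsub>EA\<^esub> (X \<oplus>\<^bsub>EA\<^esub> Y)\<parallel>\<^bsub>EA\<^esub> < e" using II[of "f \<oplus> h"] f h by blast
  qed (use X Y Icarr in auto)
  have neg: "\<ominus>\<^bsub>EA\<^esub> X \<in> I" if "X \<in> I" for X
    using lmult[OF that, of "\<ominus>\<^bsub>EA\<^esub> \<one>\<^bsub>EA\<^esub>"] Icarr[OF that] by (simp add: EA.l_minus)
  have zero: "\<zero>\<^bsub>EA\<^esub> \<in> I"
  proof -
    have "emb (d \<otimes> \<zero>) \<in> I" by (rule II) simp
    then show ?thesis using lmult[of "emb (d \<otimes> \<zero>)" "\<zero>\<^bsub>EA\<^esub>"] ec by simp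
  qed
  have "ideal I EA"
  proof (rule idealI[OF EA.ring_axioms])
    show "subgroup I (add_monoid EA)"
      by (rule EA.add.subgroupI) (use Icarr zero add neg in \<open>auto simp flip: a_inv_def\<close>)
  qed (use lmult rmult in auto)
  then have "closed_ideal I EA"
    unfolding closed_ideal_def EA.closedin_nrm_iff using Icarr closure by blast
  with simple have "I = {\<zero>\<^bsub>EA\<^esub>} \<or> I = carrier EA" by (simp add: cstar_simple_def)
  then show False
  proof
    assume "I = {\<zero>\<^bsub>EA\<^esub>}"
    then have "emb d = \<zero>\<^bsub>EA\<^esub>" using II[of \<one>] by simp
    then have "envelope_norm A d = 0" using envelope_embed_nrm[OF d] by simp
    then show False using red_le_envelope[OF d] l2_le_red[OF d] l2_pos[OF d d0] by simp
  next
    assume "I = carrier EA"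
    then have "\<one>\<^bsub>EA\<^esub> \<in> I" by simp
    then obtain f where f: "f \<in> carrier A" "\<parallel>emb (d \<otimes> f) \<ominus>\<^bsub>EA\<^esub> \<one>\<^bsub>EA\<^esub>\<parallel>\<^bsub>EA\<^esub> < 1/2"
      using ID[of "\<one>\<^bsub>EA\<^esub>" "1/2"] by auto
    define x where "x = d \<otimes> f \<ominus> \<one>"
    have x: "x \<in> carrier A" using f by (simp add: x_def)
    have "emb x = emb (d \<otimes> f) \<ominus>\<^bsub>EA\<^esub> \<one>\<^bsub>EA\<^esub>"
      using f emb_simps(4)[of \<one>] by (simp add: x_def emb_diff)
    then have rx: "red x < 1/2" using f(2) red_le_envelope[OF x] envelope_embed_nrm[OF x] by simp
    \<comment> \<open>The approximate fixed vectors of \<open>w\<close>.\<close>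
    define v where "v M = finsum A (\<lambda>k::nat. w [^] k) {..<M}" for M
    have v: "v M \<in> carrier A" for M unfolding v_def by (intro finsum_closed) auto
    have v0: "v 0 = \<zero>" and vS: "v (Suc M) = v M \<oplus> w [^] M" for M
      using finsum_insert[of "{..<M}" M "\<lambda>k. w [^] k"] v[of M]
      by (auto simp: v_def lessThan_Suc a_comm)
    have pow_unitary: "unitary_elem A (w [^] k)" for k :: nat
      by (induction k) (simp add: unitary_elem_def, simp add: unitary_mult w)
    have orth: "ip (w [^] j) (w [^] M) = 0" if "j < M" for j M :: nat
    proof -
      have "w [^] M = w [^] j \<otimes> w [^] (M - j)" using that by (simp add: nat_pow_mult)
      then have "ip (w [^] M) (w [^] j) = tr (\<star>(w [^] j) \<otimes> w [^] j \<otimes> w [^] (M - j))"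
        by (simp add: ip_def m_assoc)
      also have "\<dots> = 0" using pow_unitary[of j] tr_pow[of "M - j"] that by (simp add: unitary_elem_def)
      finally show ?thesis using ip_commute[of "w [^] M" "w [^] j"] by simp
    qed
    have orth_v: "ip (v L) (w [^] M) = 0" if "L \<le> M" for L M
      using that
    proof (induction L)
      case 0
      then show ?case using ip_smult_left[of \<zero> "w [^] M" 0] by (simp add: v0)
    next
      case (Suc L)
      then show ?case using orth[of L M] v[of L] by (simp add: vS ip_add_left)
    qed
    have l2_pow: "l2 (w [^] k) = 1" for k :: nat
      using l2_unitary_mult_left[OF pow_unitary, of \<one> k] by (simp add: l2_one)
    have lv: "(l2 (v M))\<^sup>2 = real M" for M
    proof (induction M)
      case (Suc M)
      then show ?case using v[of M] orth_v[of M M] by (simp add: vS l2_add_power2 l2_pow)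
    qed (simp add: v0)
    have dv: "d \<otimes> v M = w [^] M \<ominus> \<one>" for M
    proof (induction M)
      case (Suc M)
      have "d \<otimes> v (Suc M) = (w [^] M \<ominus> \<one>) \<oplus> (w \<ominus> \<one>) \<otimes> w [^] M"
        using Suc v[of M] by (simp add: vS r_distr d_def)
      also have "(w \<ominus> \<one>) \<otimes> w [^] M = w [^] Suc M \<ominus> w [^] M"
        using central[of "w [^] M"] by (simp add: minus_eq l_distr l_minus)
      also have "(w [^] M \<ominus> \<one>) \<oplus> (w [^] Suc M \<ominus> w [^] M) = w [^] Suc M \<ominus> \<one>"
        using diff_trans[of "w [^] Suc M" "w [^] M" \<one>] by (simp add: a_comm)
      finally show ?case .
    qed (simp add: v0)
    have bound: "sqrt (real M) \<le> 4 * red f" for M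
    proof -
      have lvM: "l2 (v M) = sqrt (real M)" using lv[of M] v[of M] by (metis l2_nonneg real_sqrt_unique)
      \<comment> \<open>Centrality moves \<open>d\<close> past \<open>f\<close> onto
        \<open>v M\<close>, where it telescopes.\<close>
      have "x \<otimes> v M = f \<otimes> (w [^] M \<ominus> \<one>) \<ominus> v M"
        using f v[of M] dv[of M] d_central[of f] by (simp add: x_def minus_eq l_distr l_minus m_assoc)
      then have "l2 (v M) - l2 (f \<otimes> (w [^] M \<ominus> \<one>)) \<le> l2 (x \<otimes> v M)"
        using l2_diff_ge[of "v M" "f \<otimes> (w [^] M \<ominus> \<one>)"] f v[of M]
          l2_diff_commute[of "v M" "f \<otimes> (w [^] M \<ominus> \<one>)"] by simp
      also have "\<dots> \<le> red x * l2 (v M)" using x v by (rule red_bound)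
      also have "\<dots> \<le> 1/2 * l2 (v M)" using rx v[of M] by (intro mult_right_mono) auto
      finally have "sqrt (real M) / 2 \<le> l2 (f \<otimes> (w [^] M \<ominus> \<one>))" using lvM by simp
      also have "\<dots> \<le> red f * l2 (w [^] M \<ominus> \<one>)" using f by (intro red_bound) auto
      also have "\<dots> \<le> red f * 2"
        using l2_add[of "w [^] M" "(- 1) \<odot> \<one>"] f
        by (intro mult_left_mono) (auto simp: minus_eq_smult l2_smult l2_pow l2_one)
      finally show ?thesis by simp
    qed
    obtain M where "(4 * red f)\<^sup>2 < real M" using reals_Archimedean2 by blast
    then have "4 * red f < sqrt (real M)" by (simp add: real_less_rsqrt)
    then show False using bound[of M] by simp
  qed
qed

end

section \<open>Twisted group algebras\<close>

context twisted_group
begin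

text \<open>The cocycle value in \<open>\<star>h\<close> is conjugate to the one coming from the
  product, so the \<open>delta r\<close> are orthonormal and \<open>l2\<close> is the usual 2-norm
  of functions.\<close>

lemma T_ip:
  assumes "finite S" "S \<subseteq> carrier G" "supp h \<subseteq> S"
  shows "(\<star>\<^bsub>T\<^esub>h \<otimes>\<^bsub>T\<^esub> f) \<one> = (\<Sum>r\<in>S. f r * cnj (h r))"
proof -
  have "supp (\<star>\<^bsub>T\<^esub>h) \<subseteq> m_inv G ` S"
  proof
    fix t assume "t \<in> supp (\<star>\<^bsub>T\<^esub>h)"
    then have "t \<in> carrier G" "inv t \<in> S" using assms(3) by (auto simp: T_star split: if_splits)
    then show "t \<in> m_inv G ` S" by (metis image_eqI inv_inv)
  qed
  then have "(\<star>\<^bsub>T\<^esub>h \<otimes>\<^bsub>T\<^esub> f) \<one> = (\<Sum>r\<in>m_inv G ` S. (\<star>\<^bsub>T\<^esub>h) r * f (inv r \<otimes> \<one>) * \<sigma> r (inv r \<otimes> \<one>))"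
    using assms by (intro T_mult) auto
  also have "\<dots> = (\<Sum>s\<in>S. (\<star>\<^bsub>T\<^esub>h) (inv s) * f s * \<sigma> (inv s) s)"
    using assms(2) by (subst sum.reindex) (auto intro!: inj_on_subset[OF inv_inj] sum.cong)
  also have "\<dots> = (\<Sum>s\<in>S. f s * cnj (h s))"
  proof (rule sum.cong)
    fix s assume "s \<in> S"
    then have s: "s \<in> carrier G" using assms by auto
    have "(\<star>\<^bsub>T\<^esub>h) (inv s) * f s * \<sigma> (inv s) s = f s * cnj (h s) * (\<sigma> s (inv s) * cnj (\<sigma> s (inv s)))"
      using s sigma_inv_commute[OF s] by (simp add: T_star mult_ac)
    then show "(\<star>\<^bsub>T\<^esub>h) (inv s) * f s * \<sigma> (inv s) s = f s * cnj (h s)"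
      using s sigma_cnj[of s "inv s"] by simp
  qed simp
  finally show ?thesis .
qed

text \<open>By bilinearity it is enough to treat \<open>delta r\<close> and \<open>delta s\<close>;
  a nonzero value occurs only for \<open>s = inv r\<close>, where \<open>sigma_inv_commute\<close>
  makes both sides agree.\<close>

lemma T_trace_commute:
  assumes "f \<in> carrier T" "h \<in> carrier T"
  shows "(f \<otimes>\<^bsub>T\<^esub> h) \<one> = (h \<otimes>\<^bsub>T\<^esub> f) \<one>"
  using assms(1)
proof (induction f rule: T_induct)
  case (step f c r)
  have "(delta r \<otimes>\<^bsub>T\<^esub> h) \<one> = (h \<otimes>\<^bsub>T\<^esub> delta r) \<one>"
    using assms(2)
  proof (induction h rule: T_induct)
    case (step h d s)
    have "(\<sigma> r s \<odot>\<^bsub>T\<^esub> delta (r \<otimes> s)) \<one> = (\<sigma> s r \<odot>\<^bsub>T\<^esub> delta (s \<otimes> r)) \<one>"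
    proof (cases "r \<otimes> s = \<one>")
      case True
      then have "s = inv r" using step \<open>r \<in> carrier G\<close> inv_equality inv_comm by metis
      then show ?thesis using \<open>r \<in> carrier G\<close> sigma_inv_commute by (simp add: T_ops)
    next
      case False
      then have "s \<otimes> r \<noteq> \<one>" using step \<open>r \<in> carrier G\<close> inv_comm by metis
      then show ?thesis using False by (simp add: T_ops delta_def)
    qed
    then have "(delta r \<otimes>\<^bsub>T\<^esub> delta s) \<one> = (delta s \<otimes>\<^bsub>T\<^esub> delta r) \<one>"
      using step \<open>r \<in> carrier G\<close> by (simp add: delta_mult)
    then show ?case using step \<open>r \<in> carrier G\<close>
      by (simp add: T_distribs T_closed) (simp add: T_ops)
  qed (simp add: T_distribs)
  then show ?case using step assms by (simp add: T_distribs T_closed) (simp add: T_ops)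
qed (simp add: T_distribs)

sublocale tracial_algebra T "\<lambda>f. f \<one>"
proof (intro tracial_algebra.intro T_star_algebra tracial_algebra_axioms.intro T_trace_commute)
  fix f assume f: "f \<in> carrier T" "f \<noteq> \<zero>\<^bsub>T\<^esub>"
  then obtain r where r: "f r \<noteq> 0" by (auto simp: T_ops fun_eq_iff)
  have S: "finite (supp f)" "supp f \<subseteq> carrier G" using f by (auto simp: T_carrier)
  have "(\<star>\<^bsub>T\<^esub>f \<otimes>\<^bsub>T\<^esub> f) \<one> = of_real (\<Sum>r\<in>supp f. (cmod (f r))\<^sup>2)"
    using T_ip[OF S, of f f] by (simp add: complex_norm_square[symmetric])
  moreover have "0 < (\<Sum>r\<in>supp f. (cmod (f r))\<^sup>2)"
    using S r by (intro sum_pos) auto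
  ultimately show "0 < Re ((\<star>\<^bsub>T\<^esub>f \<otimes>\<^bsub>T\<^esub> f) \<one>)" by simp
qed (simp_all add: T_ops T_star delta_def)

lemma ip_eq_sum:
  "\<lbrakk>finite S; S \<subseteq> carrier G; supp h \<subseteq> S\<rbrakk> \<Longrightarrow> ip f h = (\<Sum>r\<in>S. f r * cnj (h r))"
  by (simp add: ip_def T_ip)

lemma l2_eq_sum:
  assumes "f \<in> carrier T" "finite S" "S \<subseteq> carrier G" "supp f \<subseteq> S"
  shows "(l2 f)\<^sup>2 = (\<Sum>r\<in>S. (cmod (f r))\<^sup>2)"
  using assms by (simp add: l2_power2 ip_eq_sum[of S] complex_norm_square[symmetric] del: of_real_power)

text \<open>Each \<open>delta r\<close> acts isometrically, so adding
  \<open>c \<odot> delta r\<close> raises the bound by at most \<open>cmod c\<close>.\<close>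

lemma T_left_bounded: assumes "f \<in> carrier T" shows "\<exists>b. \<forall>h\<in>carrier T. l2 (f \<otimes>\<^bsub>T\<^esub> h) \<le> b * l2 h"
  using assms
proof (induction f rule: T_induct)
  case zero
  then show ?case by (intro exI[of _ 0]) (simp add: T_distribs)
next
  case (step f c r)
  then obtain b where b: "\<And>h. h \<in> carrier T \<Longrightarrow> l2 (f \<otimes>\<^bsub>T\<^esub> h) \<le> b * l2 h" by blast
  have "l2 ((f \<oplus>\<^bsub>T\<^esub> c \<odot>\<^bsub>T\<^esub> delta r) \<otimes>\<^bsub>T\<^esub> h) \<le> (b + cmod c) * l2 h" if h: "h \<in> carrier T" for h
  proof -
    have "l2 ((f \<oplus>\<^bsub>T\<^esub> c \<odot>\<^bsub>T\<^esub> delta r) \<otimes>\<^bsub>T\<^esub> h) \<le> l2 (f \<otimes>\<^bsub>T\<^esub> h) + l2 (c \<odot>\<^bsub>T\<^esub> (delta r \<otimes>\<^bsub>T\<^esub> h))"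
      using step h l2_add[of "f \<otimes>\<^bsub>T\<^esub> h" "c \<odot>\<^bsub>T\<^esub> (delta r \<otimes>\<^bsub>T\<^esub> h)"] by (simp add: T_distribs T_closed)
    also have "l2 (c \<odot>\<^bsub>T\<^esub> (delta r \<otimes>\<^bsub>T\<^esub> h)) = cmod c * l2 h"
      using step h by (simp add: l2_smult T_closed l2_unitary_mult_left delta_unitary)
    finally show ?thesis using b[OF h] by (simp add: distrib_right)
  qed
  then show ?case by blast
qed

sublocale tracial_enveloping T "\<lambda>f. f \<one>"
  by unfold_locales (rule T_left_bounded)

lemma supp_mult:
  assumes "f \<in> carrier T"
  shows "supp (f \<otimes>\<^bsub>T\<^esub> h) \<subseteq> {r \<otimes> s | r s. r \<in> supp f \<and> s \<in> supp h}"
proof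
  fix t assume t: "t \<in> supp (f \<otimes>\<^bsub>T\<^esub> h)"
  then have tG: "t \<in> carrier G" using T_mult_out[of t f h] by auto
  have S: "finite (supp f)" "supp f \<subseteq> carrier G" using assms by (auto simp: T_carrier)
  obtain r where r: "r \<in> supp f" "f r * h (inv r \<otimes> t) * \<sigma> r (inv r \<otimes> t) \<noteq> 0"
    using t T_mult[OF S(1) order_refl tG, of h] by (metis (mono_tags, lifting) mem_Collect_eq sum.neutral)
  have "t = r \<otimes> (inv r \<otimes> t)"
    using r S tG by (auto simp flip: group.is_monoid[THEN monoid.m_assoc, OF is_group])
  then show "t \<in> {r \<otimes> s | r s. r \<in> supp f \<and> s \<in> supp h}" using r by auto
qed

section \<open>Subexponential growth\<close>

text \<open>C*-seminorms are at most 1 on the unitaries \<open>delta r\<close>.\<close>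

lemma seminorm_le_l1:
  assumes p: "cstar_seminorm T p" and S: "finite S" "S \<subseteq> carrier G"
  shows "supp f \<subseteq> S \<Longrightarrow> p f \<le> (\<Sum>r\<in>S. cmod (f r))"
  using S
proof (induction S arbitrary: f rule: finite_induct)
  interpret p: star_seminorm T p by unfold_locales (rule p)
  {
    case empty
    then have "f = \<zero>\<^bsub>T\<^esub>" by (auto simp: T_ops)
    then show ?case using p.p_zero by simp
  next
    case (insert r S)
    let ?h = "f(r := 0)"
    have s: "supp ?h \<subseteq> S" using insert by auto
    have h: "?h \<in> carrier T" using insert s by (intro T_I[of S]) (auto simp del: fun_upd_apply)
    have f: "f = ?h \<oplus>\<^bsub>T\<^esub> f r \<odot>\<^bsub>T\<^esub> delta r" by (auto simp: T_ops delta_def)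
    have "p f \<le> p ?h + p (f r \<odot>\<^bsub>T\<^esub> delta r)"
      using h insert by (subst f, intro p.p_add) (auto simp: T_closed)
    also have "p ?h \<le> (\<Sum>r\<in>S. cmod (?h r))" using insert s by blast
    also have "(\<Sum>r\<in>S. cmod (?h r)) = (\<Sum>r\<in>S. cmod (f r))" using insert by (intro sum.cong) auto
    also have "p (f r \<odot>\<^bsub>T\<^esub> delta r) \<le> cmod (f r)"
      using insert p.p_unitary[OF delta_unitary, of r]
      by (simp add: p.p_smult T_closed mult_left_le)
    finally show ?case using insert by simp
  }
qed

end

text \<open>Polynomial growth, sampled at word lengths 2^k: \<open>S k\<close> contains all products
  of 2^k elements of \<open>F\<close>, and a polynomial in 2^k is bounded by an exponential in k.
  The doubling form matches the supports of repeatedly squared elements.\<close>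

definition doubling_growth :: "('g, 'm) monoid_scheme \<Rightarrow> bool" where
  "doubling_growth G \<longleftrightarrow> (\<forall>F. finite F \<longrightarrow> F \<subseteq> carrier G \<longrightarrow>
     (\<exists>S K L. F \<subseteq> S 0 \<and> (\<forall>k::nat. finite (S k) \<and> S k \<subseteq> carrier G \<and>
        (\<forall>x\<in>S k. \<forall>y\<in>S k. x \<otimes>\<^bsub>G\<^esub> y \<in> S (Suc k)) \<and> real (card (S k)) \<le> K * L ^ k)))"

text \<open>After n doublings of the exponent the power of \<open>q\<close> exceeds 2M. Further
  doublings raise this at least to the power i, where M^i absorbs the remaining powers of
  \<open>L\<close> and 2^i absorbs the constant.\<close>

lemma exp_exp_beats_exp:
  fixes q K L :: real
  assumes "1 < q"
  shows "\<exists>k. K * L ^ k < q ^ (2 ^ (k + 1))"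
proof -
  define M where "M = max 1 \<bar>L\<bar>"
  have M: "1 \<le> M" "\<bar>L\<bar> \<le> M" by (auto simp: M_def)
  obtain n where n: "2 * M < q ^ n" using real_arch_pow[OF assms] by blast
  also have "q ^ n \<le> q ^ (2 ^ n)" using assms by (intro power_increasing) (auto simp: less_imp_le)
  finally have Q: "2 * M < q ^ (2 ^ n)" .
  obtain i where i: "\<bar>K\<bar> * M ^ n < 2 ^ i" using real_arch_pow[of 2 "\<bar>K\<bar> * M ^ n"] by auto
  have "K * L ^ (n + i) \<le> \<bar>K\<bar> * M ^ (n + i)"
  proof -
    have "K * L ^ (n + i) \<le> \<bar>K\<bar> * \<bar>L\<bar> ^ (n + i)" by (metis abs_ge_self abs_mult power_abs)
    also have "\<dots> \<le> \<bar>K\<bar> * M ^ (n + i)" using M by (intro mult_left_mono power_mono) auto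
    finally show ?thesis .
  qed
  also have "\<dots> = (\<bar>K\<bar> * M ^ n) * M ^ i" by (simp add: power_add)
  also have "\<dots> < 2 ^ i * M ^ i" using i M by (intro mult_strict_right_mono) auto
  also have "\<dots> = (2 * M) ^ i" by (simp add: power_mult_distrib)
  also have "\<dots> \<le> (q ^ (2 ^ n)) ^ i" using Q M by (intro power_mono) auto
  also have "\<dots> = q ^ (2 ^ n * i)" by (simp add: power_mult)
  also have "\<dots> \<le> q ^ (2 ^ (n + i + 1))"
  proof (rule power_increasing)
    have "i \<le> 2 ^ (i + 1)" by (metis less_exp less_imp_le le_trans add_increasing2 le_add1 order_refl power_increasing one_le_numeral)
    then show "2 ^ n * i \<le> 2 ^ (n + i + 1)" by (simp add: power_add)
  qed (use assms in simp)
  finally show ?thesis by blast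
qed

context twisted_group
begin

text \<open>Every C*-seminorm is exactly multiplicative under squaring a self-adjoint element, so
  its value at \<open>a k\<close>, the 2^k-th power of \<open>\<star>x \<otimes> x\<close>, is the
  power 2^(k+1) of its value at \<open>x\<close>. A factor that is only exponential in k then cannot
  separate \<open>p x\<close> from \<open>red x\<close>.\<close>

theorem envelope_le_red:
  assumes growth: "doubling_growth G" and x: "x \<in> carrier T"
  shows "envelope_norm T x \<le> red x"
proof (rule envelope_le)
  fix p assume p: "cstar_seminorm T p"
  define a where "a k = ((\<lambda>y. y \<otimes>\<^bsub>T\<^esub> y) ^^ k) (\<star>\<^bsub>T\<^esub>x \<otimes>\<^bsub>T\<^esub> x)" for k
  have a0: "a 0 = \<star>\<^bsub>T\<^esub>x \<otimes>\<^bsub>T\<^esub> x" and aS: "a (Suc k) = a k \<otimes>\<^bsub>T\<^esub> a k" for k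
    by (simp_all add: a_def)
  have a: "a k \<in> carrier T \<and> \<star>\<^bsub>T\<^esub>(a k) = a k" for k
    by (induction k) (use x in \<open>simp_all add: a0 aS T_closed T_star_mult T_star_star\<close>)
  have q: "q (a k) = q x ^ (2 ^ (k + 1))" if q: "cstar_seminorm T q" for q k
  proof (induction k)
    case 0
    then show ?case using q x by (simp add: a0 cstar_seminorm_def)
  next
    case (Suc k)
    have "q (a (Suc k)) = (q (a k))\<^sup>2"
      using q a[of k] unfolding cstar_seminorm_def aS by metis
    then show ?case by (simp add: Suc power_mult[symmetric] mult.commute)
  qed
  have "finite (supp (a 0))" "supp (a 0) \<subseteq> carrier G" using a[of 0] by (auto simp: T_carrier)
  then obtain S K L where S: "supp (a 0) \<subseteq> S 0" "\<And>k. finite (S k)" "\<And>k. S k \<subseteq> carrier G"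
    "\<And>k x y. x \<in> S k \<Longrightarrow> y \<in> S k \<Longrightarrow> x \<otimes> y \<in> S (Suc k)"
    "\<And>k::nat. real (card (S k)) \<le> K * L ^ k"
    using growth unfolding doubling_growth_def by metis
  have supp: "supp (a k) \<subseteq> S k" for k
  proof (induction k)
    case (Suc k)
    then show ?case using supp_mult[of "a k" "a k"] a[of k] S(4)[of _ k] unfolding aS by blast
  qed (use S in simp)
  \<comment> \<open>The squared form of: \<open>p\<close> is at most the l1-norm, which is at most
    the root of \<open>card (S k)\<close> times the 2-norm, which is at most
    \<open>red\<close>.\<close>
  have ineq: "(p x ^ (2 ^ (k + 1)))\<^sup>2 \<le> K * L ^ k * (red x ^ (2 ^ (k + 1)))\<^sup>2" for k
  proof -
    have pk: "0 \<le> p (a k)" using p a[of k] by (simp add: cstar_seminorm_def)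
    have "p (a k) \<le> (\<Sum>r\<in>S k. cmod (a k r))" using p S supp by (intro seminorm_le_l1)
    then have "(p (a k))\<^sup>2 \<le> (\<Sum>r\<in>S k. cmod (a k r))\<^sup>2" using pk by (intro power_mono)
    also have "\<dots> \<le> (\<Sum>r\<in>S k. (cmod (a k r))\<^sup>2) * card (S k)"
      by (rule sum_squared_le_sum_of_squares)
    also have "\<dots> = (l2 (a k))\<^sup>2 * card (S k)" using l2_eq_sum[of "a k" "S k"] a S supp by simp
    also have "\<dots> \<le> (red (a k))\<^sup>2 * (K * L ^ k)"
      using a[of k] S(5) l2_le_red[of "a k"] by (intro mult_mono power_mono) auto
    finally show ?thesis by (simp add: q[OF p] q[OF cstar_seminorm_red] mult.commute)
  qed
  show "p x \<le> red x"
  proof (rule ccontr)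
    assume "\<not> p x \<le> red x"
    then have less: "red x < p x" by simp
    show False
    proof (cases "red x = 0")
      case True
      then show False using ineq[of 0] less by simp
    next
      case False
      then have r: "0 < red x" using red_nonneg[OF x] by (simp add: less_le)
      define y where "y = (p x / red x)\<^sup>2"
      have "1 < p x / red x" using less r by simp
      then have y: "1 < y" unfolding y_def by (simp add: one_less_power)
      have "y ^ (2 ^ (k + 1)) \<le> K * L ^ k" for k
      proof -
        have "y ^ (2 ^ (k + 1)) = (p x ^ (2 ^ (k + 1)))\<^sup>2 / (red x ^ (2 ^ (k + 1)))\<^sup>2"
          unfolding y_def by (simp only: power_divide power_mult[symmetric] mult.commute)
        also have "\<dots> \<le> K * L ^ k" using ineq[of k] r by (simp add: pos_divide_le_eq)
        finally show ?thesis .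
      qed
      then show False using exp_exp_beats_exp[OF y, of K L] by (metis not_less)
    qed
  qed
qed

end

section \<open>Averaging away the group elements\<close>

context group
begin

abbreviation "Z \<equiv> group_center G"

lemma center_commute: "z \<in> Z \<Longrightarrow> g \<in> carrier G \<Longrightarrow> g \<otimes> z = z \<otimes> g"
  and center_closed: "z \<in> Z \<Longrightarrow> z \<in> carrier G"
  unfolding group_center_def by blast+

lemma centerI: "\<lbrakk>z \<in> carrier G; \<And>x. x \<in> carrier G \<Longrightarrow> x \<otimes> z = z \<otimes> x\<rbrakk> \<Longrightarrow> z \<in> Z"
  unfolding group_center_def by blast

lemma mult_inv_cancel: "\<lbrakk>x \<in> carrier G; y \<in> carrier G\<rbrakk> \<Longrightarrow> x \<otimes> y \<otimes> inv y = x"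
  by (simp add: m_assoc)

lemma center_mult: assumes "y \<in> Z" "z \<in> Z" shows "y \<otimes> z \<in> Z"
proof -
  have "x \<otimes> (y \<otimes> z) = y \<otimes> z \<otimes> x" if x: "x \<in> carrier G" for x
  proof -
    have "x \<otimes> (y \<otimes> z) = y \<otimes> (x \<otimes> z)"
      using assms x center_commute[OF assms(1) x] by (simp add: center_closed flip: m_assoc)
    also have "\<dots> = y \<otimes> z \<otimes> x"
      using assms x center_commute[OF assms(2) x] by (simp add: center_closed m_assoc)
    finally show ?thesis .
  qed
  then show ?thesis using assms by (intro centerI) (auto intro: center_closed)
qed

lemma center_inv: assumes "z \<in> Z" shows "inv z \<in> Z"
proof -
  have z: "z \<in> carrier G" using assms by (rule center_closed)
  have "x \<otimes> inv z = inv z \<otimes> x" if x: "x \<in> carrier G" for x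
  proof -
    have "x \<otimes> inv z = inv z \<otimes> (z \<otimes> x) \<otimes> inv z" using x z by (simp flip: m_assoc)
    also have "\<dots> = inv z \<otimes> (x \<otimes> z \<otimes> inv z)"
      using x z center_commute[OF assms x] by (simp add: m_assoc)
    also have "\<dots> = inv z \<otimes> x" using x z by (simp add: mult_inv_cancel)
    finally show ?thesis .
  qed
  then show ?thesis using z by (intro centerI) auto
qed

text \<open>The central factor \<open>z\<close> passes through the conjugation, so one commutator,
  that of \<open>g\<close> and \<open>s\<close>, translates the whole coset of
  \<open>s\<close>.\<close>

lemma conj_coset:
  assumes "s \<in> carrier G" "g \<in> carrier G" "z \<in> Z"
  shows "g \<otimes> (s \<otimes> z) \<otimes> inv g = (g \<otimes> s \<otimes> inv g \<otimes> inv s) \<otimes> (s \<otimes> z)"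
proof -
  have z: "z \<in> carrier G" using assms by (simp add: center_closed)
  have "g \<otimes> (s \<otimes> z) \<otimes> inv g = g \<otimes> s \<otimes> (z \<otimes> inv g)" using assms z by (simp add: m_assoc)
  also have "\<dots> = g \<otimes> s \<otimes> (inv g \<otimes> z)" using center_commute[OF assms(3), of "inv g"] assms by simp
  also have "\<dots> = g \<otimes> s \<otimes> inv g \<otimes> (inv s \<otimes> s) \<otimes> z" using assms z by (simp add: m_assoc)
  also have "\<dots> = (g \<otimes> s \<otimes> inv g \<otimes> inv s) \<otimes> (s \<otimes> z)"
    using assms z by (simp only: m_assoc m_closed inv_closed)
  finally show ?thesis .
qed

text \<open>Applied to an element \<open>Y\<close> supported in the coset of \<open>s\<close>, it
  shows that \<open>Y \<otimes> \<star>Y\<close> is supported in the center.\<close>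

lemma coset_quotient:
  assumes "s \<in> carrier G" "y \<in> Z" "z \<in> Z"
  shows "(s \<otimes> y) \<otimes> inv (s \<otimes> z) \<in> Z"
proof -
  have yz: "y \<otimes> inv z \<in> Z" using assms by (intro center_mult center_inv)
  have "(s \<otimes> y) \<otimes> inv (s \<otimes> z) = s \<otimes> (y \<otimes> inv z) \<otimes> inv s"
    using assms by (simp add: center_closed inv_mult_group m_assoc)
  also have "\<dots> = (y \<otimes> inv z) \<otimes> s \<otimes> inv s" using center_commute[OF yz assms(1)] by simp
  also have "\<dots> = y \<otimes> inv z" using assms by (simp add: center_closed m_assoc)
  finally show ?thesis using yz by simp
qed

lemma coset_shift:
  assumes "s \<in> carrier G" "y \<in> Z" "z \<in> Z"
  shows "y \<otimes> (s \<otimes> z) = s \<otimes> (y \<otimes> z)"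
proof -
  have yz: "y \<in> carrier G" "z \<in> carrier G" using assms by (auto intro: center_closed)
  then have "y \<otimes> (s \<otimes> z) = (y \<otimes> s) \<otimes> z" using assms by (simp only: m_assoc)
  also have "\<dots> = (s \<otimes> y) \<otimes> z" by (simp only: center_commute[OF assms(2,1)])
  also have "\<dots> = s \<otimes> (y \<otimes> z)" using assms yz by (simp only: m_assoc)
  finally show ?thesis .
qed

lemma center_one: "\<one> \<in> Z"
  by (simp add: group_center_def)

end

context twisted_group
begin
abbreviation "\<U> \<equiv> delta ` carrier G"

lemma deltas_unitary: "\<U> \<subseteq> Collect (unitary_elem T)"
  using delta_unitary by auto

lemma lists_deltas:
  assumes "us \<in> lists \<U>"
  shows "set us \<subseteq> Collect (unitary_elem T)" "set us \<subseteq> carrier T"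
proof -
  have "set us \<subseteq> \<U>" using assms by (auto simp: lists_eq_set)
  with deltas_unitary show "set us \<subseteq> Collect (unitary_elem T)" by blast
  then show "set us \<subseteq> carrier T" by (rule unitaries_closed)
qed

lemma minus_trace:
  assumes "f \<in> carrier T"
  shows "f \<ominus>\<^bsub>T\<^esub> f \<one> \<odot>\<^bsub>T\<^esub> \<one>\<^bsub>T\<^esub> = (\<lambda>r. if r = \<one> then 0 else f r)"
proof -
  have "f \<one> \<odot>\<^bsub>T\<^esub> \<one>\<^bsub>T\<^esub> \<in> carrier T" by (simp add: T_closed T_ops(4))
  then have "f \<ominus>\<^bsub>T\<^esub> f \<one> \<odot>\<^bsub>T\<^esub> \<one>\<^bsub>T\<^esub> = f \<oplus>\<^bsub>T\<^esub> (- 1) \<odot>\<^bsub>T\<^esub> (f \<one> \<odot>\<^bsub>T\<^esub> \<one>\<^bsub>T\<^esub>)"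
    using assms by (intro minus_eq_smult)
  then show ?thesis by (simp add: T_ops delta_def fun_eq_iff)
qed

section \<open>Averages of central unitaries\<close>

lemma delta_swap_center:
  assumes z: "z \<in> Z" and g: "g \<in> carrier G"
  shows "delta g \<otimes>\<^bsub>T\<^esub> delta z = (\<sigma> g z * cnj (\<sigma> z g)) \<odot>\<^bsub>T\<^esub> (delta z \<otimes>\<^bsub>T\<^esub> delta g)"
proof -
  have zG: "z \<in> carrier G" using z by (rule center_closed)
  have "\<sigma> g z * cnj (\<sigma> z g) * \<sigma> z g = \<sigma> g z * (\<sigma> z g * cnj (\<sigma> z g))" by (simp add: mult_ac)
  then have "\<sigma> g z * cnj (\<sigma> z g) * \<sigma> z g = \<sigma> g z" using sigma_cnj[OF zG g] by simp
  then show ?thesis using zG g center_commute[OF z g] by (simp only: delta_mult T_module)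
qed

text \<open>Conjugation by \<open>delta g\<close> multiplies \<open>delta z\<close> by a scalar of
  modulus 1, so \<open>delta z\<close> is an eigenvector of every average.\<close>

lemma half_avg_center:
  assumes z: "z \<in> Z" and g: "g \<in> carrier G"
  shows "half_avg (delta g) (c \<odot>\<^bsub>T\<^esub> delta z) = (c * ((1 + \<sigma> g z * cnj (\<sigma> z g)) / 2)) \<odot>\<^bsub>T\<^esub> delta z"
proof -
  have zG: "z \<in> carrier G" using z by (rule center_closed)
  have "delta g \<otimes>\<^bsub>T\<^esub> \<star>\<^bsub>T\<^esub>(delta g) = \<one>\<^bsub>T\<^esub>" using delta_unitary[OF g] by (simp add: unitary_elem_def)
  then have "delta g \<otimes>\<^bsub>T\<^esub> delta z \<otimes>\<^bsub>T\<^esub> \<star>\<^bsub>T\<^esub>(delta g) = (\<sigma> g z * cnj (\<sigma> z g)) \<odot>\<^bsub>T\<^esub> delta z"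
    using zG g T_one[OF delta_closed[OF zG]]
    by (simp add: delta_swap_center[OF z g] T_distribs T_closed T_assoc)
  then show ?thesis using zG g
    by (simp add: half_avg_def T_distribs T_closed T_module(4-7))
      (simp add: T_ops fun_eq_iff algebra_simps add_divide_distrib)
qed

lemma avg_center:
  assumes z: "z \<in> Z" and us: "us \<in> lists \<U>"
  obtains c' where "avg us (c \<odot>\<^bsub>T\<^esub> delta z) = c' \<odot>\<^bsub>T\<^esub> delta z"
  using us
proof (induction us arbitrary: thesis rule: lists.induct)
  case Nil
  then show ?case by simp
next
  case (Cons w us)
  obtain g where g: "g \<in> carrier G" "w = delta g" using Cons by auto
  from Cons.IH obtain c' where "avg us (c \<odot>\<^bsub>T\<^esub> delta z) = c' \<odot>\<^bsub>T\<^esub> delta z" .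
  then show ?case using Cons.prems half_avg_center[OF z g(1), of c'] g by simp
qed

text \<open>The closed unit disc is strictly convex: the midpoint of two distinct boundary points is
  interior.\<close>

lemma norm_half_one_add_less:
  assumes "cmod a = 1" "a \<noteq> 1" shows "cmod ((1 + a) / 2) < 1"
proof -
  have "(Re a)\<^sup>2 + (Im a)\<^sup>2 = 1" using assms(1) by (simp add: cmod_power2[symmetric])
  moreover from this have "Re a < 1"
    using assms(2) by (smt (verit) complex_eqI one_complex.sel power2_eq_iff power2_less_eq_zero_iff zero_le_power2 one_power2 power2_le_imp_le)
  moreover have "(cmod (1 + a))\<^sup>2 = (1 + Re a)\<^sup>2 + (Im a)\<^sup>2" by (simp add: cmod_power2)
  ultimately have "(cmod (1 + a))\<^sup>2 < 2\<^sup>2" by (simp add: power2_sum)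
  then have "cmod (1 + a) < 2" by (rule power2_less_imp_less) simp
  then show ?thesis by (simp add: norm_divide)
qed

lemma red_delta: "r \<in> carrier G \<Longrightarrow> red (c \<odot>\<^bsub>T\<^esub> delta r) \<le> cmod c"
proof -
  assume r: "r \<in> carrier G"
  interpret red: star_seminorm T red by (rule red_seminorm)
  show ?thesis using red.p_unitary[OF delta_unitary[OF r]] r
    by (simp add: red.p_smult T_closed mult_left_le)
qed

text \<open>Earlier averages only rescale \<open>delta z\<close>; repeating the one with
  \<open>g\<close> then multiplies by powers of a number of modulus less than 1.\<close>

lemma null_center:
  assumes z: "z \<in> Z" and g: "g \<in> carrier G" "\<sigma> g z \<noteq> \<sigma> z g"
  shows "null \<U> (c \<odot>\<^bsub>T\<^esub> delta z)"
  unfolding null_def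
proof (intro ballI allI impI)
  fix us and e :: real assume us: "us \<in> lists \<U>" and e: "0 < e"
  have zG: "z \<in> carrier G" using z by (rule center_closed)
  define b where "b = (1 + \<sigma> g z * cnj (\<sigma> z g)) / 2"
  have "\<sigma> g z * cnj (\<sigma> z g) \<noteq> 1"
  proof
    assume 1: "\<sigma> g z * cnj (\<sigma> z g) = 1"
    have "\<sigma> g z = (\<sigma> g z * cnj (\<sigma> z g)) * \<sigma> z g" using sigma_cnj[OF zG g(1)] by (simp add: mult_ac)
    then show False using g(2) 1 by simp
  qed
  then have b: "cmod b < 1"
    unfolding b_def using zG g by (intro norm_half_one_add_less) (auto simp: norm_mult sigma_norm)
  obtain c' where c': "avg us (c \<odot>\<^bsub>T\<^esub> delta z) = c' \<odot>\<^bsub>T\<^esub> delta z" using avg_center[OF z us] .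
  have pow: "avg (replicate m (delta g)) (c' \<odot>\<^bsub>T\<^esub> delta z) = (c' * b ^ m) \<odot>\<^bsub>T\<^esub> delta z" for m
    by (induction m) (simp_all add: half_avg_center[OF z g(1)] mult_ac flip: b_def)
  have "(\<lambda>m. cmod c' * cmod b ^ m) \<longlonglongrightarrow> 0"
    using b by (intro tendsto_mult_right_zero LIMSEQ_realpow_zero) auto
  then obtain m where m: "cmod c' * cmod b ^ m < e"
    using e by (metis (no_types, lifting) order_tendstoD(2) eventually_sequentially order_refl)
  have "red ((c' * b ^ m) \<odot>\<^bsub>T\<^esub> delta z) \<le> e"
    using red_delta[OF zG, of "c' * b ^ m"] m by (simp add: norm_mult norm_power)
  then show "\<exists>vs\<in>lists \<U>. red (avg vs (avg us (c \<odot>\<^bsub>T\<^esub> delta z))) \<le> e"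
    using g by (intro bexI[of _ "replicate m (delta g)"]) (auto simp: c' pow)
qed

lemma null_of_support:
  assumes "finite S" "S \<subseteq> carrier G" "\<And>r c. r \<in> S \<Longrightarrow> null \<U> (c \<odot>\<^bsub>T\<^esub> delta r)" "supp f \<subseteq> S"
  shows "null \<U> f"
  using assms
proof (induction S arbitrary: f rule: finite_induct)
  case empty
  then have "f = \<zero>\<^bsub>T\<^esub>" by (auto simp: T_ops)
  then show ?case using null_zero[OF deltas_unitary] by simp
next
  case (insert r S)
  let ?h = "f(r := 0)"
  have s: "supp ?h \<subseteq> S" using insert by auto
  have h: "?h \<in> carrier T" using insert s by (intro T_I[of S]) (auto simp del: fun_upd_apply)
  have f: "f = ?h \<oplus>\<^bsub>T\<^esub> f r \<odot>\<^bsub>T\<^esub> delta r" by (auto simp: T_ops delta_def)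
  have "null \<U> (?h \<oplus>\<^bsub>T\<^esub> f r \<odot>\<^bsub>T\<^esub> delta r)"
    using insert s h by (intro null_add deltas_unitary) (auto simp: T_closed)
  then show ?case using f by simp
qed

text \<open>When all commutators are central, conjugation preserves this set.\<close>

definition coset_supported :: "'g \<Rightarrow> ('g \<Rightarrow> complex) set" where
  "coset_supported s = {f \<in> carrier T. \<forall>t\<in>supp f. \<exists>z\<in>Z. t = s \<otimes> z}"

lemma conj_supp:
  assumes f: "f \<in> carrier T" and g: "g \<in> carrier G"
  shows "supp (delta g \<otimes>\<^bsub>T\<^esub> f \<otimes>\<^bsub>T\<^esub> \<star>\<^bsub>T\<^esub>(delta g)) \<subseteq> {g \<otimes> t \<otimes> inv g | t. t \<in> supp f}"
proof -
  have "supp (\<star>\<^bsub>T\<^esub>(delta g)) \<subseteq> {inv g}" "supp (delta g) \<subseteq> {g}"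
    using g by (auto simp: T_ops delta_star delta_def)
  then show ?thesis
    using supp_mult[of "delta g \<otimes>\<^bsub>T\<^esub> f" "\<star>\<^bsub>T\<^esub>(delta g)"] supp_mult[of "delta g" f] f g
    by (force simp: T_closed)
qed

lemma half_avg_coset:
  assumes comm: "\<And>g. g \<in> carrier G \<Longrightarrow> g \<otimes> s \<otimes> inv g \<otimes> inv s \<in> Z" and s: "s \<in> carrier G"
    and f: "f \<in> coset_supported s" and g: "g \<in> carrier G"
  shows "half_avg (delta g) f \<in> coset_supported s"
proof -
  have fT: "f \<in> carrier T" using f by (simp add: coset_supported_def)
  let ?h = "delta g \<otimes>\<^bsub>T\<^esub> f \<otimes>\<^bsub>T\<^esub> \<star>\<^bsub>T\<^esub>(delta g)"
  have "\<exists>z\<in>Z. t = s \<otimes> z" if "t \<in> supp ?h" for t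
  proof -
    obtain r where r: "r \<in> supp f" "t = g \<otimes> r \<otimes> inv g" using \<open>t \<in> supp ?h\<close> conj_supp[OF fT g] by blast
    obtain z where z: "z \<in> Z" "r = s \<otimes> z" using r f by (auto simp: coset_supported_def)
    have "t = s \<otimes> ((g \<otimes> s \<otimes> inv g \<otimes> inv s) \<otimes> z)"
      using r(2) z conj_coset[OF s g z(1)] coset_shift[OF s comm[OF g] z(1)] by simp
    then show ?thesis using center_mult[OF comm[OF g] z(1)] by blast
  qed
  moreover have "supp (half_avg (delta g) f) \<subseteq> supp f \<union> supp ?h"
    by (auto simp: half_avg_def T_ops)
  ultimately show ?thesis
    using f fT g by (auto simp: coset_supported_def delta_closed)
qed

lemma avg_coset:
  assumes comm: "\<And>g. g \<in> carrier G \<Longrightarrow> g \<otimes> s \<otimes> inv g \<otimes> inv s \<in> Z" and s: "s \<in> carrier G"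
    and f: "f \<in> coset_supported s" and us: "us \<in> lists \<U>"
  shows "avg us f \<in> coset_supported s"
  using us
proof (induction us rule: lists.induct)
  case (Cons w us)
  then obtain g where "g \<in> carrier G" "w = delta g" by blast
  then show ?case using half_avg_coset[OF comm s Cons.IH] by simp
qed (use f in simp)

text \<open>If \<open>g\<close> moves the support of \<open>f\<close> off itself, then \<open>f\<close> and its conjugate are orthogonal.\<close>

lemma half_avg_l2:
  assumes comm: "\<And>g. g \<in> carrier G \<Longrightarrow> g \<otimes> s \<otimes> inv g \<otimes> inv s \<in> Z" and s: "s \<in> carrier G"
    and inf: "infinite ((\<lambda>g. g \<otimes> s \<otimes> inv g \<otimes> inv s) ` carrier G)" and f: "f \<in> coset_supported s"
  obtains g where "g \<in> carrier G" "(l2 (half_avg (delta g) f))\<^sup>2 = (l2 f)\<^sup>2 / 2"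
proof -
  have fT: "f \<in> carrier T" using f by (simp add: coset_supported_def)
  have S: "finite (supp f)" "supp f \<subseteq> carrier G" using fT by (auto simp: T_carrier)
  \<comment> \<open>If the commutator of \<open>g\<close> and \<open>s\<close> is not a quotient of
    two support elements, conjugation by \<open>g\<close> moves the support off itself. There are
    infinitely many commutators and only finitely many quotients.\<close>
  define D where "D = (\<lambda>(t, t'). t \<otimes> inv t') ` (supp f \<times> supp f)"
  have "finite D" using S by (simp add: D_def)
  then have "\<not> (\<lambda>g. g \<otimes> s \<otimes> inv g \<otimes> inv s) ` carrier G \<subseteq> D" using inf finite_subset by blast
  then obtain g where g: "g \<in> carrier G" "g \<otimes> s \<otimes> inv g \<otimes> inv s \<notin> D" by blast
  let ?h = "delta g \<otimes>\<^bsub>T\<^esub> f \<otimes>\<^bsub>T\<^esub> \<star>\<^bsub>T\<^esub>(delta g)"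
  have h: "?h \<in> carrier T" using fT g by (simp add: T_closed)
  have disj: "f t = 0" if t: "t \<in> supp ?h" for t
  proof (rule ccontr)
    assume "f t \<noteq> 0"
    obtain r where r: "r \<in> supp f" "t = g \<otimes> r \<otimes> inv g" using t conj_supp[OF fT g(1)] by blast
    obtain z where z: "z \<in> Z" "r = s \<otimes> z" using r f by (auto simp: coset_supported_def)
    have "t \<otimes> inv r = g \<otimes> s \<otimes> inv g \<otimes> inv s"
      using r(2) z conj_coset[OF s g(1) z(1)] center_closed[OF comm[OF g(1)]] center_closed[OF z(1)] s
      by (simp add: mult_inv_cancel)
    moreover have "t \<otimes> inv r \<in> D"
      unfolding D_def using r(1) \<open>f t \<noteq> 0\<close> by (intro image_eqI[of _ _ "(t, r)"]) auto
    ultimately show False using g by simp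
  qed
  have "ip f ?h = (\<Sum>r\<in>supp ?h. f r * cnj (?h r))"
    using h by (intro ip_eq_sum) (auto simp: T_carrier)
  also have "\<dots> = 0" using disj by (intro sum.neutral) auto
  finally have "ip f ?h = 0" .
  moreover have "l2 ?h = l2 f"
    using fT g by (simp add: l2_unitary_mult_left l2_unitary_mult_right unitary_star delta_unitary T_closed)
  ultimately have "(l2 (f \<oplus>\<^bsub>T\<^esub> ?h))\<^sup>2 = 2 * (l2 f)\<^sup>2" using l2_add_power2[OF fT h] by simp
  then have "(l2 (half_avg (delta g) f))\<^sup>2 = (l2 f)\<^sup>2 / 2"
    using fT h by (simp add: half_avg_def l2_smult T_add_closed power_mult_distrib power2_eq_square)
  then show thesis using g that by blast
qed

text \<open>Averages stay supported in the coset of \<open>s\<close>, so the halving of the squared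
  2-norm can be iterated, with \<open>g\<close> chosen anew each time.\<close>

lemma avg_l2_small:
  assumes comm: "\<And>g. g \<in> carrier G \<Longrightarrow> g \<otimes> s \<otimes> inv g \<otimes> inv s \<in> Z" and s: "s \<in> carrier G"
    and inf: "infinite ((\<lambda>g. g \<otimes> s \<otimes> inv g \<otimes> inv s) ` carrier G)" and f: "f \<in> coset_supported s"
    and e: "0 < e"
  obtains us where "us \<in> lists \<U>" "(l2 (avg us f))\<^sup>2 \<le> e"
proof -
  have "\<exists>us\<in>lists \<U>. (l2 (avg us f))\<^sup>2 = (l2 f)\<^sup>2 / 2 ^ n" for n
  proof (induction n)
    case (Suc n)
    then obtain us where us: "us \<in> lists \<U>" "(l2 (avg us f))\<^sup>2 = (l2 f)\<^sup>2 / 2 ^ n" by blast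
    obtain g where "g \<in> carrier G" "(l2 (half_avg (delta g) (avg us f)))\<^sup>2 = (l2 (avg us f))\<^sup>2 / 2"
      using half_avg_l2[OF comm s inf avg_coset[OF comm s f us(1)]] .
    then show ?case using us by (intro bexI[of _ "delta g # us"]) auto
  qed (auto intro!: bexI[of _ "[]"])
  moreover obtain n where "(l2 f)\<^sup>2 / e < 2 ^ n" using real_arch_pow[of 2 "(l2 f)\<^sup>2 / e"] by auto
  then have "(l2 f)\<^sup>2 / 2 ^ n \<le> e" using e by (simp add: field_simps)
  ultimately show thesis using that by metis
qed

lemma null_coset:
  assumes comm: "\<And>g. g \<in> carrier G \<Longrightarrow> g \<otimes> s \<otimes> inv g \<otimes> inv s \<in> Z" and s: "s \<in> carrier G"
    and inf: "infinite ((\<lambda>g. g \<otimes> s \<otimes> inv g \<otimes> inv s) ` carrier G)" and f: "f \<in> coset_supported s"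
    and center: "\<And>z c. z \<in> Z \<Longrightarrow> z \<noteq> \<one> \<Longrightarrow> null \<U> (c \<odot>\<^bsub>T\<^esub> delta z)"
  shows "null \<U> f"
  unfolding null_def
proof (intro ballI allI impI)
  interpret red: star_seminorm T red by (rule red_seminorm)
  fix us and e :: real assume us: "us \<in> lists \<U>" and e: "0 < e"
  \<comment> \<open>One half is for the trace of \<open>P\<close>, the other for the norm of the
    average of \<open>P\<close> minus its trace; Kadison-Schwarz then bounds the square of the
    desired norm by the sum.\<close>
  have e2: "0 < e\<^sup>2 / 2" using e by simp
  obtain vs where vs: "vs \<in> lists \<U>" "(l2 (avg vs (avg us f)))\<^sup>2 \<le> e\<^sup>2 / 2"
    using avg_l2_small[OF comm s inf avg_coset[OF comm s f us] e2] .
  define Y where "Y = avg vs (avg us f)"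
  have Yc: "Y \<in> coset_supported s" unfolding Y_def by (intro avg_coset[OF comm s] f us vs)
  then have Y: "Y \<in> carrier T" by (simp add: coset_supported_def)
  define P where "P = Y \<otimes>\<^bsub>T\<^esub> \<star>\<^bsub>T\<^esub>Y"
  have P: "P \<in> carrier T" using Y by (simp add: P_def T_closed)
  define t where "t = (l2 Y)\<^sup>2"
  have trP: "P \<one> = of_real t"
    using ip_self[OF Y] T_trace_commute[of Y "\<star>\<^bsub>T\<^esub>Y"] Y by (simp add: P_def t_def ip_def T_closed)
  have suppP: "supp P \<subseteq> Z"
  proof
    fix r assume "r \<in> supp P"
    then obtain x y where xy: "x \<in> supp Y" "y \<in> supp (\<star>\<^bsub>T\<^esub>Y)" "r = x \<otimes> y"
      using supp_mult[OF Y] unfolding P_def by blast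
    then have y: "inv y \<in> supp Y" "y \<in> carrier G" by (auto simp: T_star split: if_splits)
    obtain z where z: "z \<in> Z" "x = s \<otimes> z" using xy(1) Yc by (auto simp: coset_supported_def)
    obtain z' where z': "z' \<in> Z" "inv y = s \<otimes> z'" using y(1) Yc by (auto simp: coset_supported_def)
    have "r = (s \<otimes> z) \<otimes> inv (s \<otimes> z')" using xy(3) y(2) z z'(2)[symmetric] by simp
    then show "r \<in> Z" using coset_quotient[OF s z(1) z'(1)] by simp
  qed
  \<comment> \<open>\<open>P\<close> without its coefficient at \<open>\<one>\<close>: its support
    consists of nontrivial central elements, where the hypothesis \<open>center\<close>
    applies.\<close>
  let ?Q = "P \<ominus>\<^bsub>T\<^esub> P \<one> \<odot>\<^bsub>T\<^esub> \<one>\<^bsub>T\<^esub>"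
  have "null \<U> ?Q"
  proof (rule null_of_support)
    show "finite (supp P - {\<one>})" "supp P - {\<one>} \<subseteq> carrier G" using P by (auto simp: T_carrier)
    show "supp ?Q \<subseteq> supp P - {\<one>}" unfolding minus_trace[OF P] by (auto split: if_splits)
  qed (use suppP center in auto)
  then obtain ws where ws: "ws \<in> lists \<U>" "red (avg ws (avg [] ?Q)) \<le> e\<^sup>2 / 2"
    using e2 nullD by (metis lists.Nil)
  note wU = lists_deltas[OF ws(1)]
  have "avg ws P = avg ws ?Q \<oplus>\<^bsub>T\<^esub> of_real t \<odot>\<^bsub>T\<^esub> \<one>\<^bsub>T\<^esub>"
    using wU P by (simp add: avg_diff avg_smult avg_one trP diff_add_cancel)
  then have "red (avg ws P) \<le> red (avg ws ?Q) + red (of_real t \<odot>\<^bsub>T\<^esub> \<one>\<^bsub>T\<^esub>)"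
    using wU P by (simp add: red.p_add)
  also have "\<dots> \<le> e\<^sup>2 / 2 + t"
  proof (rule add_mono)
    show "red (avg ws ?Q) \<le> e\<^sup>2 / 2" using ws(2) by simp
    have "red (of_real t \<odot>\<^bsub>T\<^esub> \<one>\<^bsub>T\<^esub>) = t * red \<one>\<^bsub>T\<^esub>"
      by (simp only: red.p_smult one_closed norm_of_real) (simp add: t_def)
    also have "\<dots> \<le> t" using red.p_one_le by (simp add: t_def mult_left_le)
    finally show "red (of_real t \<odot>\<^bsub>T\<^esub> \<one>\<^bsub>T\<^esub>) \<le> t" .
  qed
  also have "\<dots> \<le> e\<^sup>2" using vs(2) by (simp add: t_def Y_def)
  finally have "(red (avg ws Y))\<^sup>2 \<le> e\<^sup>2"
    using kadison_schwarz[OF wU(1) Y] by (simp add: P_def)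
  then have "red (avg ws Y) \<le> e" by (rule power2_le_imp_le) (use e in simp)
  then show "\<exists>vs\<in>lists \<U>. red (avg vs (avg us f)) \<le> e"
    using ws(1) vs(1) by (intro bexI[of _ "ws @ vs"]) (auto simp: Y_def avg_append)
qed

text \<open>\<open>class2\<close> and \<open>inf\<close> serve the noncentral elements,
  \<open>growth\<close> identifies the full with the reduced norm, and \<open>torsion_free\<close>
  makes the traces of the powers of a central unitary vanish when the criterion fails.\<close>

theorem simple_iff:
  assumes class2: "\<And>g s. \<lbrakk>g \<in> carrier G; s \<in> carrier G\<rbrakk> \<Longrightarrow> g \<otimes> s \<otimes> inv g \<otimes> inv s \<in> Z"
    and inf: "\<And>s. \<lbrakk>s \<in> carrier G; s \<notin> Z\<rbrakk> \<Longrightarrow> infinite ((\<lambda>g. g \<otimes> s \<otimes> inv g \<otimes> inv s) ` carrier G)"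
    and torsion_free: "\<And>z k. \<lbrakk>z \<in> Z; z \<noteq> \<one>; 0 < k\<rbrakk> \<Longrightarrow> z [^] (k::nat) \<noteq> \<one>"
    and growth: "doubling_growth G"
  shows "cstar_simple CG \<longleftrightarrow> (\<forall>z\<in>Z - {\<one>}. \<exists>g\<in>carrier G. \<sigma> g z \<noteq> \<sigma> z g)"
proof
  assume simple: "cstar_simple CG"
  show "\<forall>z\<in>Z - {\<one>}. \<exists>g\<in>carrier G. \<sigma> g z \<noteq> \<sigma> z g"
  proof (rule ccontr)
    assume "\<not> ?thesis"
    then obtain z where z: "z \<in> Z" "z \<noteq> \<one>" "\<And>g. g \<in> carrier G \<Longrightarrow> \<sigma> g z = \<sigma> z g" by blast
    have zG: "z \<in> carrier G" using z by (simp add: center_closed)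
    have central: "delta z \<otimes>\<^bsub>T\<^esub> f = f \<otimes>\<^bsub>T\<^esub> delta z" if "f \<in> carrier T" for f
      using that
    proof (induction f rule: T_induct)
      case (step f c r)
      then show ?case
        using zG z(3)[of r] center_commute[OF z(1), of r] by (simp add: T_distribs T_closed delta_mult)
    qed (simp add: T_distribs)
    have pow: "\<exists>c. delta z [^]\<^bsub>T\<^esub> k = c \<odot>\<^bsub>T\<^esub> delta (z [^] k)" for k :: nat
    proof (induction k)
      case 0
      show ?case by (intro exI[of _ 1]) (simp add: T_ops(4) T_module)
    next
      case (Suc k)
      then obtain c where "delta z [^]\<^bsub>T\<^esub> k = c \<odot>\<^bsub>T\<^esub> delta (z [^] k)" by blast
      then show ?case using zG by (auto simp: T_distribs T_closed delta_mult T_module)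
    qed
    have "(delta z [^]\<^bsub>T\<^esub> k) \<one> = 0" if "0 < k" for k :: nat
    proof -
      obtain c where "delta z [^]\<^bsub>T\<^esub> k = c \<odot>\<^bsub>T\<^esub> delta (z [^] k)" using pow by blast
      then show ?thesis using torsion_free[OF z(1,2) that] by (simp add: T_ops delta_def)
    qed
    from not_simple_envelope[OF delta_unitary[OF zG] central this] simple
    show False by (simp add: twisted_group_cstar_def)
  qed
next
  assume nondeg: "\<forall>z\<in>Z - {\<one>}. \<exists>g\<in>carrier G. \<sigma> g z \<noteq> \<sigma> z g"
  have center: "null \<U> (c \<odot>\<^bsub>T\<^esub> delta z)" if "z \<in> Z" "z \<noteq> \<one>" for z c
    using nondeg that null_center by blast
  have "null \<U> (c \<odot>\<^bsub>T\<^esub> delta r)" if r: "r \<in> carrier G" "r \<noteq> \<one>" for r c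
  proof (cases "r \<in> Z")
    case False
    have "c \<odot>\<^bsub>T\<^esub> delta r \<in> coset_supported r"
      using r center_one by (auto simp: coset_supported_def T_closed T_smult_closed)
        (auto simp: T_ops delta_def intro!: bexI[of _ \<one>] split: if_splits)
    then show ?thesis
      by (rule null_coset[OF class2[OF _ r(1)] r(1) inf[OF r(1) False], rotated]) (fact center)
  next
    case True
    then show ?thesis using r(2) by (rule center)
  qed
  then have delta: "null \<U> (c \<odot>\<^bsub>T\<^esub> delta r)" if "r \<in> carrier G - {\<one>}" for r c
    using that by blast
  have null: "null \<U> (f \<ominus>\<^bsub>T\<^esub> f \<one> \<odot>\<^bsub>T\<^esub> \<one>\<^bsub>T\<^esub>)" if f: "f \<in> carrier T" for f
  proof (rule null_of_support)
    show "finite (supp f - {\<one>})" "supp f - {\<one>} \<subseteq> carrier G" using f by (auto simp: T_carrier)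
    then show "null \<U> (c \<odot>\<^bsub>T\<^esub> delta r)" if "r \<in> supp f - {\<one>}" for r c
      using that by (intro delta) blast
    show "supp (f \<ominus>\<^bsub>T\<^esub> f \<one> \<odot>\<^bsub>T\<^esub> \<one>\<^bsub>T\<^esub>) \<subseteq> supp f - {\<one>}"
      unfolding minus_trace[OF f] by (auto split: if_splits)
  qed
  have "cstar_simple (cstar_envelope T)"
    by (rule simple_envelope[OF deltas_unitary envelope_le_red[OF growth] null])
  then show "cstar_simple CG" by (simp add: twisted_group_cstar_def)
qed

end

section \<open>The free nilpotent group of class 2\<close>

text \<open>Checking \<open>g \<otimes> s = c \<otimes> (s \<otimes> g)\<close> avoids computing
  inverses in the group.\<close>

lemma (in group) commutator_eqI:
  assumes "g \<in> carrier G" "s \<in> carrier G" "c \<in> carrier G" "g \<otimes> s = c \<otimes> (s \<otimes> g)"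
  shows "g \<otimes> s \<otimes> inv g \<otimes> inv s = c"
proof -
  have "g \<otimes> s \<otimes> inv g \<otimes> inv s = c \<otimes> s \<otimes> (g \<otimes> inv g) \<otimes> inv s"
    using assms(1-3) unfolding assms(4) by (simp only: m_assoc m_closed inv_closed)
  then show ?thesis using assms(1-3) by (simp add: mult_inv_cancel)
qed

lemma free_nil2_commutator:
  assumes "(r, r2) \<in> carrier (free_nil2 n)" "(s, s2) \<in> carrier (free_nil2 n)"
  shows "(r, r2) \<otimes>\<^bsub>free_nil2 n\<^esub> (s, s2) \<otimes>\<^bsub>free_nil2 n\<^esub> inv\<^bsub>free_nil2 n\<^esub> (r, r2)
      \<otimes>\<^bsub>free_nil2 n\<^esub> inv\<^bsub>free_nil2 n\<^esub> (s, s2) =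
    (\<lambda>i. 0, \<lambda>j k. if (j, k) \<in> index_pairs n then r j * s k - s j * r k else 0)"
proof -
  interpret group "free_nil2 n" by (rule group_free_nil2)
  show ?thesis
    using assms by (intro commutator_eqI) (auto simp: free_nil2_carrier free_nil2_mult fun_eq_iff)
qed

lemma free_nil2_infinite_commutators:
  assumes n: "2 \<le> n" and s: "s \<in> carrier (free_nil2 n)" "s \<notin> group_center (free_nil2 n)"
  shows "infinite ((\<lambda>g. g \<otimes>\<^bsub>free_nil2 n\<^esub> s \<otimes>\<^bsub>free_nil2 n\<^esub> inv\<^bsub>free_nil2 n\<^esub> g
      \<otimes>\<^bsub>free_nil2 n\<^esub> inv\<^bsub>free_nil2 n\<^esub> s) ` carrier (free_nil2 n))" (is "infinite (?c ` _)")
proof -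
  obtain r r2 where s_eq: "s = (r, r2)" by (metis surj_pair)
  then obtain m where m: "r m \<noteq> 0" using s group_center_free_nil2[OF n] by (auto simp: fun_eq_iff)
  have r: "(r, r2) \<in> carrier (free_nil2 n)" using s s_eq by simp
  then have mn: "1 \<le> m" "m \<le> n" using m by (auto simp: free_nil2_carrier intro: ccontr)
  \<comment> \<open>An index other than \<open>m\<close>. The commutator of \<open>g M\<close> with
    \<open>s\<close> has entry \<open>M * r m\<close>, up to sign, at the pair formed by
    \<open>l\<close> and \<open>m\<close>, so it determines \<open>M\<close>.\<close>
  define l where "l = (if m = 1 then 2 else 1::nat)"
  define g :: "int \<Rightarrow> nil2" where "g M = (\<lambda>i. if i = l then M else 0, \<lambda>j k. 0)" for M
  have g: "g M \<in> carrier (free_nil2 n)" for M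
    using n by (auto simp: g_def l_def free_nil2_carrier)
  have "?c (g M) =
      (\<lambda>i. 0, \<lambda>j k. if (j, k) \<in> index_pairs n then (if j = l then M else 0) * r k - r j * (if k = l then M else 0) else 0)"
    for M
    unfolding s_eq g_def by (rule free_nil2_commutator[OF g[unfolded g_def] r])
  then have c: "snd (?c (g M)) j k =
      (if (j, k) \<in> index_pairs n then (if j = l then M else 0) * r k - r j * (if k = l then M else 0) else 0)"
    for M j k by simp
  have "inj (\<lambda>M. ?c (g M))"
  proof (rule injI)
    fix M M' assume "?c (g M) = ?c (g M')"
    then have eq: "snd (?c (g M)) j k = snd (?c (g M')) j k" for j k by simp
    show "M = M'"
    proof (cases "m = 1")
      case True
      then show ?thesis using eq[of 1 2] m n unfolding c by (simp add: index_pairs_def l_def)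
    next
      case False
      then show ?thesis using eq[of 1 m] m mn unfolding c by (simp add: index_pairs_def l_def)
    qed
  qed
  then have "infinite (range (\<lambda>M. ?c (g M)))" using finite_imageD infinite_UNIV_int by blast
  moreover have "range (\<lambda>M. ?c (g M)) \<subseteq> ?c ` carrier (free_nil2 n)" using g by blast
  ultimately show ?thesis using finite_subset by blast
qed

lemma free_nil2_center_pow:
  "(\<lambda>i. 0, z2) \<in> carrier (free_nil2 n) \<Longrightarrow>
    (\<lambda>i. 0, z2) [^]\<^bsub>free_nil2 n\<^esub> (k::nat) = (\<lambda>i. 0, \<lambda>i j. int k * z2 i j)"
proof (induction k)
  case 0
  then show ?case by (simp add: free_nil2_one nat_pow_def)
next
  case (Suc k)
  then show ?case by (auto simp: nat_pow_def free_nil2_mult free_nil2_carrier fun_eq_iff algebra_simps)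
qed

text \<open>The coordinates on pairs have weight 2, as products of two first coordinates enter them.
  With this scaling multiplication only doubles the radius, since R^2 + R^2 + R^2 \<le>
  (2R)^2.\<close>

definition box :: "nat \<Rightarrow> int \<Rightarrow> nil2 set" where
  "box n R = {x \<in> carrier (free_nil2 n). (\<forall>i. \<bar>fst x i\<bar> \<le> R) \<and> (\<forall>j k. \<bar>snd x j k\<bar> \<le> R\<^sup>2)}"

lemma box_mono: "0 \<le> R \<Longrightarrow> R \<le> R' \<Longrightarrow> box n R \<subseteq> box n R'"
  unfolding box_def using power_mono[of R R' 2] by (fastforce intro: order_trans)

lemma box_mult:
  assumes "x \<in> box n R" "y \<in> box n R" shows "x \<otimes>\<^bsub>free_nil2 n\<^esub> y \<in> box n (2 * R)"
proof -
  obtain r r2 s s2 where xy: "x = (r, r2)" "y = (s, s2)" by (metis surj_pair)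
  have *: "(r, r2) \<in> carrier (free_nil2 n)" "(s, s2) \<in> carrier (free_nil2 n)"
    "\<And>i. \<bar>r i\<bar> \<le> R" "\<And>i. \<bar>s i\<bar> \<le> R" "\<And>j k. \<bar>r2 j k\<bar> \<le> R\<^sup>2" "\<And>j k. \<bar>s2 j k\<bar> \<le> R\<^sup>2"
    using assms by (auto simp: box_def xy)
  have R: "0 \<le> R" using *(3)[of 0] by linarith
  have "\<bar>r j * s k\<bar> \<le> R\<^sup>2" for j k
    unfolding abs_mult power2_eq_square using *(3)[of j] *(4)[of k] R by (intro mult_mono) auto
  then have "\<bar>r2 j k + s2 j k + r j * s k\<bar> \<le> (2 * R)\<^sup>2" for j k
    using *(5)[of j k] *(6)[of j k] zero_le_power2[of R] by (simp add: power_mult_distrib) (smt (verit))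
  moreover have "\<bar>r i + s i\<bar> \<le> 2 * R" for i using *(3)[of i] *(4)[of i] by linarith
  ultimately show ?thesis
    using *(1,2) by (auto simp: box_def xy free_nil2_mult free_nil2_carrier)
qed

lemma in_box: assumes "x \<in> carrier (free_nil2 n)" shows "\<exists>R\<ge>1. x \<in> box n R"
proof -
  obtain r r2 where x: "x = (r, r2)" by (metis surj_pair)
  \<comment> \<open>The summand 1 gives \<open>R \<le> R\<^sup>2\<close>, so that the bound by
    \<open>R\<close> also suffices for the coordinates on pairs.\<close>
  define R where "R = 1 + (\<Sum>i\<in>{1..n}. \<bar>r i\<bar>) + (\<Sum>(j, k)\<in>index_pairs n. \<bar>r2 j k\<bar>)"
  have nn: "0 \<le> (\<Sum>i\<in>{1..n}. \<bar>r i\<bar>)" "0 \<le> (\<Sum>(j, k)\<in>index_pairs n. \<bar>r2 j k\<bar>)"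
    by (auto intro!: sum_nonneg)
  then have R: "1 \<le> R" by (simp add: R_def)
  have 1: "\<bar>r i\<bar> \<le> R" for i
  proof (cases "i \<in> {1..n}")
    case True
    then have "\<bar>r i\<bar> \<le> (\<Sum>i\<in>{1..n}. \<bar>r i\<bar>)" by (intro member_le_sum) auto
    then show ?thesis using nn by (simp add: R_def)
  qed (use assms R x in \<open>auto simp: free_nil2_carrier\<close>)
  have 2: "\<bar>r2 j k\<bar> \<le> R" for j k
  proof (cases "(j, k) \<in> index_pairs n")
    case True
    then have "(case (j, k) of (j, k) \<Rightarrow> \<bar>r2 j k\<bar>) \<le> (\<Sum>(j, k)\<in>index_pairs n. \<bar>r2 j k\<bar>)"
      by (intro member_le_sum) auto
    then show ?thesis using nn unfolding R_def prod.case by linarith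
  qed (use assms R x in \<open>auto simp: free_nil2_carrier\<close>)
  have "R \<le> R\<^sup>2" using R by (simp add: power2_eq_square)
  then have "x \<in> box n R" using 1 2 assms x by (auto simp: box_def intro: order_trans)
  then show ?thesis using R by blast
qed

lemma finite_subset_box:
  assumes "finite F" "F \<subseteq> carrier (free_nil2 n)" shows "\<exists>R\<ge>1. F \<subseteq> box n R"
  using assms
proof (induction F rule: finite_induct)
  case (insert x F)
  obtain R where R: "R \<ge> 1" "F \<subseteq> box n R" using insert by auto
  obtain R' where R': "R' \<ge> 1" "x \<in> box n R'" using in_box insert by blast
  have "insert x F \<subseteq> box n (max R R')"
    using R R' box_mono[of R "max R R'" n] box_mono[of R' "max R R'" n] by auto
  then show ?case using R by (intro exI[of _ "max R R'"]) auto
qed (auto intro: exI[of _ 1])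

lemma card_box:
  assumes "1 \<le> R"
  shows "finite (box n R) \<and> card (box n R) \<le> nat (3 * R\<^sup>2) ^ (n + card (index_pairs n))"
proof -
  define P where "P = ({1..n} \<rightarrow>\<^sub>E {-R..R}) \<times> (index_pairs n \<rightarrow>\<^sub>E {-R\<^sup>2..R\<^sup>2})"
  \<comment> \<open>Elements vanish off the index sets, so restriction to these finite sets is
    injective.\<close>
  define \<phi> :: "nil2 \<Rightarrow> _" where "\<phi> = (\<lambda>(r, r2). (restrict r {1..n}, restrict (case_prod r2) (index_pairs n)))"
  have "\<phi> ` box n R \<subseteq> P"
    by (auto simp: \<phi>_def P_def box_def abs_le_iff minus_le_iff)
  moreover have "inj_on \<phi> (box n R)"
  proof (rule inj_onI)
    fix x y assume xy: "x \<in> box n R" "y \<in> box n R" "\<phi> x = \<phi> y"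
    obtain r r2 s s2 where eq: "x = (r, r2)" "y = (s, s2)" by (metis surj_pair)
    have c: "(r, r2) \<in> carrier (free_nil2 n)" "(s, s2) \<in> carrier (free_nil2 n)"
      using xy eq by (auto simp: box_def)
    have "r i = s i" for i
      using xy(3) c by (cases "i \<in> {1..n}") (auto simp: eq \<phi>_def free_nil2_carrier dest: fun_cong[of _ _ i])
    moreover have "r2 j k = s2 j k" for j k
      using xy(3) c by (cases "(j, k) \<in> index_pairs n") (auto simp: eq \<phi>_def free_nil2_carrier dest: fun_cong[of _ _ "(j, k)"])
    ultimately show "x = y" by (auto simp: eq fun_eq_iff)
  qed
  moreover have "finite P" unfolding P_def by (intro finite_cartesian_product finite_PiE) auto
  ultimately have fin: "finite (box n R)" and le: "card (box n R) \<le> card P"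
    by (auto intro: inj_on_finite card_inj_on_le)
  have "card P = nat (2 * R + 1) ^ n * nat (2 * R\<^sup>2 + 1) ^ card (index_pairs n)"
    by (simp add: P_def card_cartesian_product card_PiE)
  also have "\<dots> \<le> nat (3 * R\<^sup>2) ^ n * nat (3 * R\<^sup>2) ^ card (index_pairs n)"
  proof (intro mult_mono power_mono nat_mono)
    have "R \<le> R\<^sup>2" using assms by (simp add: power2_eq_square)
    then show "2 * R + 1 \<le> 3 * R\<^sup>2" "2 * R\<^sup>2 + 1 \<le> 3 * R\<^sup>2" using assms by linarith+
  qed auto
  finally show ?thesis using fin le by (simp add: power_add)
qed

text \<open>\<open>S k\<close> is the box of radius 2^k R. Its cardinality is bounded by a
  polynomial of degree 2N in that radius, which is the origin of the base 4^N.\<close>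

lemma doubling_growth_free_nil2: "doubling_growth (free_nil2 n)"
  unfolding doubling_growth_def
proof (intro allI impI)
  fix F assume "finite F" "F \<subseteq> carrier (free_nil2 n)"
  then obtain R where R: "1 \<le> R" "F \<subseteq> box n R" using finite_subset_box by blast
  define N where "N = n + card (index_pairs n)"
  have pos: "1 \<le> 2 ^ k * R" for k :: nat using R(1) one_le_power[of "2::int" k] mult_mono[of 1 "2 ^ k" 1 R] by simp
  have "real (card (box n (2 ^ k * R))) \<le> (3 * (real_of_int R)\<^sup>2) ^ N * (4 ^ N) ^ k" for k
  proof -
    have "real (card (box n (2 ^ k * R))) \<le> real (nat (3 * (2 ^ k * R)\<^sup>2) ^ N)"
      using card_box[OF pos, of n k] unfolding N_def of_nat_le_iff by blast
    also have "\<dots> = (3 * (2 ^ k * real_of_int R)\<^sup>2) ^ N" by simp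
    also have "3 * (2 ^ k * real_of_int R)\<^sup>2 = 3 * (real_of_int R)\<^sup>2 * 4 ^ k"
      by (simp add: power_mult_distrib power2_eq_square flip: power_mult_distrib)
    also have "(3 * (real_of_int R)\<^sup>2 * 4 ^ k) ^ N = (3 * (real_of_int R)\<^sup>2) ^ N * (4 ^ N) ^ k"
      by (simp add: power_mult_distrib flip: power_mult)
    finally show ?thesis .
  qed
  moreover have "box n (2 ^ k * R) \<subseteq> carrier (free_nil2 n)" "finite (box n (2 ^ k * R))" for k
    using card_box[OF pos, of n k] by (auto simp: box_def)
  moreover have "x \<otimes>\<^bsub>free_nil2 n\<^esub> y \<in> box n (2 ^ Suc k * R)"
    if "x \<in> box n (2 ^ k * R)" "y \<in> box n (2 ^ k * R)" for x y k
    using box_mult[OF that] by (simp add: mult.assoc)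
  ultimately show "\<exists>S K L. F \<subseteq> S 0 \<and> (\<forall>k::nat. finite (S k) \<and> S k \<subseteq> carrier (free_nil2 n) \<and>
      (\<forall>x\<in>S k. \<forall>y\<in>S k. x \<otimes>\<^bsub>free_nil2 n\<^esub> y \<in> S (Suc k)) \<and> real (card (S k)) \<le> K * L ^ k)"
    using R(2) by (intro exI[of _ "\<lambda>k. box n (2 ^ k * R)"] exI[of _ "(3 * (real_of_int R)\<^sup>2) ^ N"]
        exI[of _ "4 ^ N"]) auto
qed

section \<open>The commutation character of a central element\<close>

text \<open>Each pair \<open>(i, (j, k))\<close> with \<open>j < k\<close> satisfies exactly one of \<open>i < j\<close>, \<open>i = j\<close>,
  \<open>j < i < k\<close>, \<open>i = k\<close>, \<open>k < i\<close>.\<close>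

lemma prod_triples:
  fixes w :: "nat \<Rightarrow> nat \<Rightarrow> nat \<Rightarrow> 'a :: comm_monoid_mult"
  shows "(\<Prod>i\<in>{1..n}. \<Prod>(j, k)\<in>index_pairs n. w i j k) =
    (\<Prod>(i, j, k)\<in>index_triples n. w i j k * w j i k * w k i j) *
    (\<Prod>(j, k)\<in>index_pairs n. w j j k * w k j k)"
proof -
  let ?X = "{1..n} \<times> index_pairs n" and ?w = "\<lambda>(i, j, k). w i j k"
  have fin: "finite ?X" by simp
  have part: "prod ?w {x \<in> ?X. P x} = (\<Prod>x\<in>?X. if P x then ?w x else 1)" for P
    using fin by (rule prod.inter_filter)
  have "(\<Prod>i\<in>{1..n}. \<Prod>(j, k)\<in>index_pairs n. w i j k) = prod ?w ?X"
    by (simp add: prod.cartesian_product case_prod_unfold)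
  also have "\<dots> = (\<Prod>x\<in>?X.
      (if (case x of (i, j, k) \<Rightarrow> i < j) then ?w x else 1) *
      (if (case x of (i, j, k) \<Rightarrow> j < i \<and> i < k) then ?w x else 1) *
      (if (case x of (i, j, k) \<Rightarrow> k < i) then ?w x else 1) *
      ((if (case x of (i, j, k) \<Rightarrow> i = j) then ?w x else 1) *
       (if (case x of (i, j, k) \<Rightarrow> i = k) then ?w x else 1)))"
    by (rule prod.cong) (auto simp: index_pairs_def)
  also have "\<dots> =
      prod ?w {x \<in> ?X. case x of (i, j, k) \<Rightarrow> i < j} *
      prod ?w {x \<in> ?X. case x of (i, j, k) \<Rightarrow> j < i \<and> i < k} *
      prod ?w {x \<in> ?X. case x of (i, j, k) \<Rightarrow> k < i} *
      (prod ?w {x \<in> ?X. case x of (i, j, k) \<Rightarrow> i = j} *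
       prod ?w {x \<in> ?X. case x of (i, j, k) \<Rightarrow> i = k})"
    unfolding part prod.distrib ..
  \<comment> \<open>When the three indices are distinct and sorted as i < j < k, the first argument
    of \<open>w\<close> is the smallest, the middle or the largest of them.\<close>
  also have "prod ?w {x \<in> ?X. case x of (i, j, k) \<Rightarrow> i < j} = (\<Prod>(i, j, k)\<in>index_triples n. w i j k)"
    by (rule prod.cong) (auto simp: index_pairs_def index_triples_def)
  also have "prod ?w {x \<in> ?X. case x of (i, j, k) \<Rightarrow> j < i \<and> i < k} =
      (\<Prod>(i, j, k)\<in>index_triples n. w j i k)"
    by (rule prod.reindex_bij_witness[of _ "\<lambda>(i, j, k). (j, i, k)" "\<lambda>(i, j, k). (j, i, k)"])
      (auto simp: index_pairs_def index_triples_def)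
  also have "prod ?w {x \<in> ?X. case x of (i, j, k) \<Rightarrow> k < i} = (\<Prod>(i, j, k)\<in>index_triples n. w k i j)"
    by (rule prod.reindex_bij_witness[of _ "\<lambda>(i, j, k). (k, i, j)" "\<lambda>(i, j, k). (j, k, i)"])
      (auto simp: index_pairs_def index_triples_def)
  also have "prod ?w {x \<in> ?X. case x of (i, j, k) \<Rightarrow> i = j} = (\<Prod>(j, k)\<in>index_pairs n. w j j k)"
    by (rule prod.reindex_bij_witness[of _ "\<lambda>(j, k). (j, j, k)" "\<lambda>(i, j, k). (j, k)"])
      (auto simp: index_pairs_def)
  also have "prod ?w {x \<in> ?X. case x of (i, j, k) \<Rightarrow> i = k} = (\<Prod>(j, k)\<in>index_pairs n. w k j k)"
    by (rule prod.reindex_bij_witness[of _ "\<lambda>(j, k). (k, j, k)" "\<lambda>(i, j, k). (j, k)"])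
      (auto simp: index_pairs_def)
  finally show ?thesis by (simp add: prod.distrib case_prod_unfold)
qed

text \<open>Against a central second argument the cocycle yields the factors \<open>w i j k\<close>
  with i \<le> k; against a central first argument it yields, by \<open>jacobi\<close>, the inverses
  of the factors whose first index exceeds both others. The quotient is therefore the full product
  over all i and all pairs.\<close>

lemma nil2_cocycle_center:
  fixes lam :: "nat \<Rightarrow> nat \<Rightarrow> nat \<Rightarrow> complex"
  assumes norm: "\<And>i j k. \<lbrakk>1 \<le> i; i \<le> k; 1 \<le> j; j < k; k \<le> n\<rbrakk> \<Longrightarrow> cmod (lam i j k) = 1"
    and jacobi: "\<And>i j k. \<lbrakk>1 \<le> i; i < j; j < k; k \<le> n\<rbrakk> \<Longrightarrow> lam k i j = cnj (lam i j k) * lam j i k"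
  shows "nil2_cocycle n lam (r, r2) (\<lambda>i. 0, z2) =
    nil2_cocycle n lam (\<lambda>i. 0, z2) (r, r2) *
    (\<Prod>i\<in>{1..n}. (\<Prod>(j, k)\<in>index_pairs n. lam i j k powi z2 j k) powi r i)"
proof -
  define w where "w i j k = lam i j k powi (z2 j k * r i)" for i j k
  define B where "B = nil2_cocycle n lam (\<lambda>i. 0, z2) (r, r2)"
  have pull: "(\<Prod>i\<in>{1..n}. (\<Prod>(j, k)\<in>index_pairs n. lam i j k powi z2 j k) powi r i) =
      (\<Prod>i\<in>{1..n}. \<Prod>(j, k)\<in>index_pairs n. w i j k)"
  proof (rule prod.cong)
    fix i
    have "(\<Prod>x\<in>S. f x) powi m = (\<Prod>x\<in>S. f x powi m)" if "finite S" for S :: "(nat \<times> nat) set" and f :: "_ \<Rightarrow> complex" and m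
      using that by (induction S rule: finite_induct) (auto simp: power_int_mult_distrib)
    then show "(\<Prod>(j, k)\<in>index_pairs n. lam i j k powi z2 j k) powi r i = (\<Prod>(j, k)\<in>index_pairs n. w i j k)"
      by (simp add: w_def power_int_mult case_prod_unfold)
  qed simp
  have B: "B = (\<Prod>(i, j, k)\<in>index_triples n. lam i j k powi (r k * z2 i j) * lam j i k powi (- (r k * z2 i j)))"
    by (simp add: B_def nil2_cocycle_def)
  have Bw: "B * (\<Prod>(i, j, k)\<in>index_triples n. w k i j) = 1"
  proof -
    have "lam i j k powi (r k * z2 i j) * lam j i k powi (- (r k * z2 i j)) * w k i j = 1"
      if "(i, j, k) \<in> index_triples n" for i j k
    proof -
      have ijk: "1 \<le> i" "i < j" "j < k" "k \<le> n" using that by (auto simp: index_triples_def)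
      have n1: "cmod (lam i j k) = 1" "cmod (lam j i k) = 1" using ijk by (auto intro!: norm)
      then have nz: "lam i j k \<noteq> 0" "lam j i k \<noteq> 0" by auto
      have one: "lam i j k * cnj (lam i j k) = 1" using n1 by (simp add: complex_norm_square[symmetric])
      define a where "a = r k * z2 i j"
      have "w k i j = cnj (lam i j k) powi a * lam j i k powi a"
        by (simp add: w_def jacobi[OF ijk] power_int_mult_distrib a_def mult.commute)
      then have "lam i j k powi a * lam j i k powi (- a) * w k i j =
          (lam i j k powi a * cnj (lam i j k) powi a) * (lam j i k powi a * lam j i k powi (- a))"
        by (simp add: mult_ac)
      also have "\<dots> = 1"
        using nz by (simp add: power_int_mult_distrib[symmetric] one power_int_minus)
      finally show ?thesis by (simp add: a_def)
    qed
    then show ?thesis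
      unfolding B prod.distrib[symmetric] by (intro prod.neutral) auto
  qed
  have "nil2_cocycle n lam (r, r2) (\<lambda>i. 0, z2) =
      (\<Prod>(i, j, k)\<in>index_triples n. w i j k * w j i k) * (\<Prod>(j, k)\<in>index_pairs n. w j j k * w k j k)"
    by (simp add: nil2_cocycle_def w_def mult.commute)
  also have "\<dots> = (B * (\<Prod>(i, j, k)\<in>index_triples n. w k i j)) *
      ((\<Prod>(i, j, k)\<in>index_triples n. w i j k * w j i k) * (\<Prod>(j, k)\<in>index_pairs n. w j j k * w k j k))"
    using Bw by simp
  also have "\<dots> = B * (\<Prod>i\<in>{1..n}. \<Prod>(j, k)\<in>index_pairs n. w i j k)"
    unfolding prod_triples by (simp add: prod.distrib case_prod_unfold mult_ac)
  finally show ?thesis unfolding pull B_def .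
qed

theorem corollary4p6:
  fixes n :: nat and lam :: "nat \<Rightarrow> nat \<Rightarrow> nat \<Rightarrow> complex"
  assumes "2 \<le> n"
    and "\<And>i j k. \<lbrakk>1 \<le> i; i \<le> k; 1 \<le> j; j < k; k \<le> n\<rbrakk> \<Longrightarrow> cmod (lam i j k) = 1"
    and "\<And>i j k. \<lbrakk>1 \<le> i; i < j; j < k; k \<le> n\<rbrakk> \<Longrightarrow> lam k i j = cnj (lam i j k) * lam j i k"
  shows "cstar_simple (twisted_group_cstar (free_nil2 n) (nil2_cocycle n lam)) \<longleftrightarrow>
    (\<forall>s \<in> group_center (free_nil2 n) - {\<one>\<^bsub>free_nil2 n\<^esub>}.
      \<exists>i\<in>{1..n}. (\<Prod>(j, k)\<in>index_pairs n. lam i j k powi snd s j k) \<noteq> 1)"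
proof -
  let ?G = "free_nil2 n" and ?\<sigma> = "nil2_cocycle n lam"
  interpret twisted_group ?G ?\<sigma>
    by (intro twisted_group.intro group_free_nil2 twisted_group_axioms.intro two_cocycle_nil2_cocycle assms(2))
  have cocycle_center: "?\<sigma> (r, r2) (\<lambda>i. 0, z2) = ?\<sigma> (\<lambda>i. 0, z2) (r, r2) *
      (\<Prod>i\<in>{1..n}. (\<Prod>(j, k)\<in>index_pairs n. lam i j k powi z2 j k) powi r i)" for r r2 z2
    by (rule nil2_cocycle_center) (use assms in auto)
  have center: "z \<in> group_center ?G \<longleftrightarrow> z \<in> carrier ?G \<and> fst z = (\<lambda>i. 0)" for z
    using group_center_free_nil2[OF assms(1)] by auto
  have "cstar_simple (twisted_group_cstar ?G ?\<sigma>) \<longleftrightarrow>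
      (\<forall>z\<in>group_center ?G - {\<one>\<^bsub>?G\<^esub>}. \<exists>g\<in>carrier ?G. ?\<sigma> g z \<noteq> ?\<sigma> z g)"
  proof (rule simple_iff)
    fix g s assume "g \<in> carrier ?G" "s \<in> carrier ?G"
    then show "g \<otimes>\<^bsub>?G\<^esub> s \<otimes>\<^bsub>?G\<^esub> inv\<^bsub>?G\<^esub> g \<otimes>\<^bsub>?G\<^esub> inv\<^bsub>?G\<^esub> s \<in> group_center ?G"
      unfolding center by (cases g; cases s) (auto simp: free_nil2_commutator free_nil2_carrier)
  next
    fix z and k :: nat assume z: "z \<in> group_center ?G" "z \<noteq> \<one>\<^bsub>?G\<^esub>" and k: "0 < k"
    obtain z2 where z2: "z = (\<lambda>i. 0, z2)" using z(1) by (cases z) (simp add: center)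
    show "z [^]\<^bsub>?G\<^esub> k \<noteq> \<one>\<^bsub>?G\<^esub>"
      using z k unfolding z2 center by (auto simp: free_nil2_center_pow free_nil2_one fun_eq_iff)
  qed (use free_nil2_infinite_commutators[OF assms(1)] doubling_growth_free_nil2 in auto)
  also have "\<dots> \<longleftrightarrow> (\<forall>s \<in> group_center ?G - {\<one>\<^bsub>?G\<^esub>}.
      \<exists>i\<in>{1..n}. (\<Prod>(j, k)\<in>index_pairs n. lam i j k powi snd s j k) \<noteq> 1)"
  proof (rule ball_cong)
    fix z assume "z \<in> group_center ?G - {\<one>\<^bsub>?G\<^esub>}"
    then obtain z2 where z2: "z = (\<lambda>i. 0, z2)" and zG: "z \<in> carrier ?G" by (cases z) (auto simp: center)
    define P where "P i = (\<Prod>(j, k)\<in>index_pairs n. lam i j k powi z2 j k)" for i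
    have nz: "?\<sigma> z g \<noteq> 0" if "g \<in> carrier ?G" for g using sigma_norm[OF zG that] by auto
    have eq: "?\<sigma> (r, r2) z = ?\<sigma> z (r, r2) \<longleftrightarrow> (\<Prod>i\<in>{1..n}. P i powi r i) = 1"
      if "(r, r2) \<in> carrier ?G" for r r2
      using nz[OF that] cocycle_center[of r r2 z2] by (simp add: z2 P_def)
    \<comment> \<open>The left side says that the character sending r to the product of the
      \<open>P i powi r i\<close> is nontrivial; the coordinate vectors detect this.\<close>
    have "(\<exists>g\<in>carrier ?G. ?\<sigma> g z \<noteq> ?\<sigma> z g) \<longleftrightarrow> (\<exists>i\<in>{1..n}. P i \<noteq> 1)"
    proof
      assume "\<exists>g\<in>carrier ?G. ?\<sigma> g z \<noteq> ?\<sigma> z g"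
      then obtain r r2 where "(r, r2) \<in> carrier ?G" "?\<sigma> (r, r2) z \<noteq> ?\<sigma> z (r, r2)" by (metis surj_pair)
      then have "(\<Prod>i\<in>{1..n}. P i powi r i) \<noteq> 1" using eq by blast
      then show "\<exists>i\<in>{1..n}. P i \<noteq> 1" by (metis (no_types, lifting) power_int_1_left prod.neutral)
    next
      assume "\<exists>i\<in>{1..n}. P i \<noteq> 1"
      then obtain m where m: "m \<in> {1..n}" "P m \<noteq> 1" by blast
      define e where "e i = (if i = m then 1 else 0::int)" for i
      have e: "(e, \<lambda>j k. 0) \<in> carrier ?G" using m by (auto simp: free_nil2_carrier e_def)
      have "(\<Prod>i\<in>{1..n}. P i powi e i) = (\<Prod>i\<in>{1..n}. if i = m then P i else 1)"
        by (rule prod.cong) (auto simp: e_def)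
      then have "(\<Prod>i\<in>{1..n}. P i powi e i) = P m" using m by simp
      then show "\<exists>g\<in>carrier ?G. ?\<sigma> g z \<noteq> ?\<sigma> z g" using eq[OF e] e m by auto
    qed
    then show "(\<exists>g\<in>carrier ?G. ?\<sigma> g z \<noteq> ?\<sigma> z g) \<longleftrightarrow>
        (\<exists>i\<in>{1..n}. (\<Prod>(j, k)\<in>index_pairs n. lam i j k powi snd z j k) \<noteq> 1)"
      by (simp add: P_def z2)
  qed simp
  finally show ?thesis .
qed

end
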